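(* Let $N\ge 3$ and let $a:[0,1]\to\mathbb{R}$ be such that $x\mapsto a(|x|)$ belongs to $C^2(\overline{B_1})$, $a(r)>0$ on $[0,1]$, and $a(0)=1$. Then there exists a unique singular radial solution $(\lambda_*,U_* )$ of $$-\Delta u=\lambda a(|x|)e^{u}\ \text{ in } B_1,\qquad u>0\ \text{ in } B_1,\qquad u=0\ \text{ on }\partial B_1, \tag{P}$$ in the sense that if $(\lambda,U)$ is a singular radial solution of (P), then $\lambda=\lambda_*$ and $U=U_*$. In addition, $$\lambda(\beta)\to\lambda_*\quad\text{and}\quad u_\beta\to U_*\ \text{ in } C^2_{\mathrm{loc}}((0,1])\qquad\text{as }\beta\to\infty .$$ In particular, $\alpha(\beta)\to\infty$ if and only if $\beta\to\infty$. Moreover, there exists $\hat\lambda>0$ such that the bifurcation curve $\mathcal{C}$ is parametrized by $\lambda$ for $\lambda<\hat\lambda$ (that is, for each $0<\lambda<\hat\lambda$ there is exactly one point of $\mathcal{C}$ with first coordinate $\lambda$). Furthermore, $U_*\in H^1_0(B_1)$ and $$U_*(r)=-2\log r+\log 2(N-2)-\log\lambda_*+o(1)\qquad\text{as } r\to0 .$$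
   Context: $B_1\subset\mathbb{R}^N$ is the open unit ball. Radial functions are identified with functions of $r=|x|$, and then $\Delta=\frac{d^2}{dr^2}+\frac{N-1}{r}\frac{d}{dr}$. A pair $(\lambda,U)$ with $\lambda>0$ is a singular radial solution of (P) if $U$ is radial, $U\in C^2((0,1])$ as a function of $r$, $U$ satisfies $-\Delta U=\lambda a(r)e^{U}$ and $U>0$ for $0<r<1$, $U(1)=0$, and $U(r)\to\infty$ as $r\to0$. For $\beta\in\mathbb{R}$, $v(\cdot,\beta)$ denotes the solution on $[0,1]$ of $-\Delta v=a(r)e^{v}$, $v(0,\beta)=\beta$, $\frac{d}{dr}v(0,\beta)=0$. Put $\lambda(\beta):=e^{v(1,\beta)}$, $u_\beta(r):=v(r,\beta)-\log\lambda(\beta)$, $\alpha(\beta):=\beta-\log\lambda(\beta)=\lVert u_\beta\rVert_{L^\infty(B_1)}$. The pairs $(\lambda(\beta),u_\beta)$, $\beta\in\mathbb{R}$, are exactly the classical radial solutions of (P), and $\mathcal{C}:=\{(\lambda(\beta),\alpha(\beta));\beta\in\mathbb{R}\}$ is called the bifurcation curve. *)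

theory Defs
  imports "HOL-Analysis.Analysis" "HOL-Library.Landau_Symbols"
begin

subsection \<open>Smoothness classes on subsets of Euclidean space\<close>

text \<open>
  For an open set \<open>S\<close>, \<open>Ck_closure k S f\<close> says that \<open>f\<close> belongs to \<open>C\<^sup>k\<close> of the closure of \<open>S\<close>: the
  partial derivatives of order at most \<open>k\<close> exist and are continuous in \<open>S\<close>, and each of them has a
  continuous extension to the closure (for \<open>f\<close> itself the extension is \<open>f\<close>). For \<open>S = UNIV\<close> it is
  plain \<open>C\<^sup>k\<close> regularity on the whole space. Differentiability is required in the Frechet sense,
  which \<open>C\<^sup>1\<close> functions satisfy.
\<close>

primrec Ck_closure :: "nat \<Rightarrow> 'a::euclidean_space set \<Rightarrow> ('a \<Rightarrow> real) \<Rightarrow> bool" where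
  "Ck_closure 0 S f \<longleftrightarrow> continuous_on (closure S) f"
| "Ck_closure (Suc k) S f \<longleftrightarrow>
     continuous_on (closure S) f \<and> (\<forall>x\<in>S. f differentiable (at x)) \<and>
     (\<forall>i\<in>Basis. \<exists>g. (\<forall>x\<in>S. g x = frechet_derivative f (at x) i) \<and> Ck_closure k S g)"

definition test_function :: "'a::euclidean_space set \<Rightarrow> ('a \<Rightarrow> real) \<Rightarrow> bool" where
  "test_function \<Omega> \<phi> \<longleftrightarrow>
     (\<forall>k. Ck_closure k UNIV \<phi>) \<and>
     compact (closure {x. \<phi> x \<noteq> 0}) \<and> closure {x. \<phi> x \<noteq> 0} \<subseteq> \<Omega>"


subsection \<open>The Sobolev space \<open>H\<^sup>1\<^sub>0\<close>\<close>

definition grad :: "('a::euclidean_space \<Rightarrow> real) \<Rightarrow> 'a \<Rightarrow> 'a" where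
  "grad f x = (\<Sum>i\<in>Basis. frechet_derivative f (at x) i *\<^sub>R i)"

definition L2_on :: "'a::euclidean_space set \<Rightarrow> ('a \<Rightarrow> 'b::euclidean_space) \<Rightarrow> bool" where
  "L2_on \<Omega> f \<longleftrightarrow>
     set_borel_measurable lebesgue \<Omega> f \<and> set_integrable lebesgue \<Omega> (\<lambda>x. (norm (f x))\<^sup>2)"

definition weak_gradient :: "'a::euclidean_space set \<Rightarrow> ('a \<Rightarrow> real) \<Rightarrow> ('a \<Rightarrow> 'a) \<Rightarrow> bool" where
  "weak_gradient \<Omega> f g \<longleftrightarrow>
     (\<forall>\<phi>. test_function \<Omega> \<phi> \<longrightarrow> (\<forall>i\<in>Basis.
        (LINT x:\<Omega>|lebesgue. f x * (grad \<phi> x \<bullet> i)) = - (LINT x:\<Omega>|lebesgue. (g x \<bullet> i) * \<phi> x)))"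

text \<open>\<open>H\<^sup>1\<^sub>0(\<Omega>)\<close> is the closure of the test functions in the norm of \<open>H\<^sup>1(\<Omega>)\<close>.\<close>

definition H10 :: "'a::euclidean_space set \<Rightarrow> ('a \<Rightarrow> real) set" where
  "H10 \<Omega> = {f. \<exists>g. L2_on \<Omega> f \<and> L2_on \<Omega> g \<and> weak_gradient \<Omega> f g \<and>
     (\<exists>\<phi> :: nat \<Rightarrow> 'a \<Rightarrow> real. (\<forall>n. test_function \<Omega> (\<phi> n)) \<and>
       (\<lambda>n. (LINT x:\<Omega>|lebesgue. (\<phi> n x - f x)\<^sup>2)
            + (LINT x:\<Omega>|lebesgue. (norm (grad (\<phi> n) x - g x))\<^sup>2)) \<longlonglongrightarrow> 0)}"


subsection \<open>Functions of the radial variable\<close>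

text \<open>
  \<open>rderiv S f\<close> is the derivative of \<open>f\<close> relative to the interval \<open>S\<close>, hence one-sided at an end point
  that belongs to \<open>S\<close>. It ignores the values of \<open>f\<close> outside \<open>S\<close>.
\<close>

definition rderiv :: "real set \<Rightarrow> (real \<Rightarrow> real) \<Rightarrow> real \<Rightarrow> real" where
  "rderiv S f r = vector_derivative f (at r within S)"

definition C2_on :: "real set \<Rightarrow> (real \<Rightarrow> real) \<Rightarrow> bool" where
  "C2_on S f \<longleftrightarrow>
     f differentiable_on S \<and> rderiv S f differentiable_on S \<and>
     continuous_on S (rderiv S (rderiv S f))"

definition C2_loc_limit ::
    "real set \<Rightarrow> ('b \<Rightarrow> real \<Rightarrow> real) \<Rightarrow> (real \<Rightarrow> real) \<Rightarrow> 'b filter \<Rightarrow> bool" where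
  "C2_loc_limit S f g F \<longleftrightarrow>
     (\<forall>K. compact K \<and> K \<subseteq> S \<longrightarrow>
        uniform_limit K f g F \<and>
        uniform_limit K (\<lambda>b. rderiv S (f b)) (rderiv S g) F \<and>
        uniform_limit K (\<lambda>b. rderiv S (rderiv S (f b))) (rderiv S (rderiv S g)) F)"

definition radial_laplacian :: "nat \<Rightarrow> real set \<Rightarrow> (real \<Rightarrow> real) \<Rightarrow> real \<Rightarrow> real" where
  "radial_laplacian N S f r = rderiv S (rderiv S f) r + (real N - 1) / r * rderiv S f r"


subsection \<open>The problem (P) in dimension \<open>N\<close> with weight \<open>a\<close>\<close>

definition singular_radial_solution ::
    "nat \<Rightarrow> (real \<Rightarrow> real) \<Rightarrow> real \<Rightarrow> (real \<Rightarrow> real) \<Rightarrow> bool" where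
  "singular_radial_solution N a l U \<longleftrightarrow>
     l > 0 \<and> C2_on {0<..1} U \<and>
     (\<forall>r. 0 < r \<and> r < 1 \<longrightarrow> - radial_laplacian N {0<..1} U r = l * a r * exp (U r) \<and> U r > 0) \<and>
     U 1 = 0 \<and> filterlim U at_top (at_right 0)"

text \<open>The equation is imposed for \<open>r > 0\<close> only, because \<open>radial_laplacian\<close> divides by \<open>r\<close>.\<close>

definition initial_value_solution ::
    "nat \<Rightarrow> (real \<Rightarrow> real) \<Rightarrow> real \<Rightarrow> (real \<Rightarrow> real) \<Rightarrow> bool" where
  "initial_value_solution N a \<beta> w \<longleftrightarrow>
     C2_on {0..1} w \<and>
     (\<forall>r\<in>{0<..1}. - radial_laplacian N {0..1} w r = a r * exp (w r)) \<and>
     w 0 = \<beta> \<and> rderiv {0..1} w 0 = 0"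

text \<open>
  The solution is unique on \<open>[0,1]\<close>, and Hilbert choice leaves only the irrelevant values outside \<open>[0,1]\<close>
  undetermined.
\<close>

definition v_sol :: "nat \<Rightarrow> (real \<Rightarrow> real) \<Rightarrow> real \<Rightarrow> real \<Rightarrow> real" where
  "v_sol N a \<beta> = (SOME w. initial_value_solution N a \<beta> w)"

definition lam :: "nat \<Rightarrow> (real \<Rightarrow> real) \<Rightarrow> real \<Rightarrow> real" where
  "lam N a \<beta> = exp (v_sol N a \<beta> 1)"

definition u_sol :: "nat \<Rightarrow> (real \<Rightarrow> real) \<Rightarrow> real \<Rightarrow> real \<Rightarrow> real" where
  "u_sol N a \<beta> r = v_sol N a \<beta> r - ln (lam N a \<beta>)"

definition alpha :: "nat \<Rightarrow> (real \<Rightarrow> real) \<Rightarrow> real \<Rightarrow> real" where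
  "alpha N a \<beta> = \<beta> - ln (lam N a \<beta>)"

definition bifurcation_curve :: "nat \<Rightarrow> (real \<Rightarrow> real) \<Rightarrow> (real \<times> real) set" where
  "bifurcation_curve N a = range (\<lambda>\<beta>. (lam N a \<beta>, alpha N a \<beta>))"

end

(*
  Along a radial solution V of - Delta V = a e^V put m = N - 2, s = ln r,
  eta = V + 2 ln r - ln (2 m) and sigma = - d eta / ds. Then
    d sigma / ds = - m sigma + 2 m (a e^eta - 1),   d eta / ds = - sigma,
  an autonomous system up to a perturbation of size O(r) = O(e^s), with the Lyapunov function
  sigma^2 / 2 + 2 m (e^eta - 1 - eta). Subtracting kappa sigma (e^eta - 1) from it gives strict
  dissipation, so solutions that start with bounded energy at radius r0 satisfy
  |sigma| + |e^eta - 1| <= K ((r0 / r)^c + r^c). This rate is integrable in ds; hence the difference of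
  two such solutions, governed by the linearization at the stable equilibrium, is at most
  K (r0 / r)^(1/6).

  The solution v(., beta) has bounded energy at r0 = e^(- beta / 2), and every singular solution has
  bounded energy on all of (0,1]. Letting r0 tend to 0, the contraction yields convergence of
  v(., beta) as beta tends to infinity, uniqueness of the singular solution, and, from the decay
  estimate, its asymptotics.

  For small lambda the curve is a graph because lambda is strictly monotone in beta for very negative
  beta (the nonlinearity is then a small Lipschitz perturbation) and bounded below elsewhere.

  Membership in H^1_0 follows by dominated convergence, with bound C / |x|, from test functions
  theta_n (P_n (|x|^2)), where P_n is a polynomial with P_n' = - s_n^2 and P_n(1) = 0, and theta_n is a
  smooth truncation vanishing on a neighbourhood of (-infinity, 0].
*)

theory Submission
  imports Defs "HOL-Real_Asymp.Real_Asymp"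
begin

text \<open>In s = ln r the linearization p' = - m p + 2 m z, z' = - p has the characteristic
  equation x^2 + m x + 2 m = 0, with complex roots for m < 8 and real ones for m \<ge> 8. A
  quadratic form with a fixed cross term treats all m \<ge> 1 alike; its rate is not optimal, but
  any positive rate is enough. Besides N and a, the constants of the decay and contraction estimates
  depend only on an energy bound at the starting radius r0, not on r0 itself. This permits r0
  \<rightarrow> 0: the accumulated error of the linearization is the integral of (r0 / t)^c + t^c
  against dt / t, at most 2 / c for every r0. Singular solutions satisfy the equation off the origin
  only. A point source there, V of order r^(2-N), has to be ruled out; it would contradict an a
  priori bound r^2 e^V \<le> M. Unbounded energy is impossible as well: it would make r^2 e^V small
  near 0, and a bootstrap would then keep V bounded. In the H^1_0 part, smoothness on the whole
  space is the obstacle. Polynomials in |x|^2 are smooth at the origin, and the truncation comes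
  from a family of flat functions closed under differentiation.\<close>

subsection \<open>Smooth functions\<close>

text \<open>On the whole space the extension \<open>g\<close> in the definition is forced to be the
  partial derivative, and differentiability gives continuity; only the recursion in the derivatives
  remains.\<close>

lemma Ck_closure_UNIV_Suc:
  "Ck_closure (Suc k) UNIV f \<longleftrightarrow>
     (\<forall>x. f differentiable (at x)) \<and>
     (\<forall>i\<in>Basis. Ck_closure k UNIV (\<lambda>x. frechet_derivative f (at x) i))"
  (is "?L \<longleftrightarrow> ?R")
proof
  assume ?L
  have "Ck_closure k UNIV (\<lambda>x. frechet_derivative f (at x) i)" if i: "i \<in> Basis" for i
  proof -
    obtain g where g: "\<forall>x\<in>UNIV. g x = frechet_derivative f (at x) i" "Ck_closure k UNIV g"
      using \<open>?L\<close> i unfolding Ck_closure.simps by blast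
    then have "g = (\<lambda>x. frechet_derivative f (at x) i)" by auto
    with g show ?thesis by simp
  qed
  with \<open>?L\<close> show ?R by auto
next
  assume ?R
  then have "continuous_on (closure UNIV) f"
    by (simp add: continuous_at_imp_continuous_on differentiable_imp_continuous_within)
  with \<open>?R\<close> show ?L by auto
qed

lemma Ck_closure_UNIV_SucD: "Ck_closure (Suc k) UNIV f \<Longrightarrow> Ck_closure k UNIV f"
proof (induction k arbitrary: f)
  case (Suc k)
  then show ?case
    unfolding Ck_closure_UNIV_Suc[of "Suc k" f] Ck_closure_UNIV_Suc[of k f] by (auto simp del: Ck_closure.simps)
qed simp

lemma Ck_closure_UNIV_const: "Ck_closure k UNIV (\<lambda>x. c)"
proof (induction k arbitrary: c)
  case (Suc k)
  then show ?case
    unfolding Ck_closure_UNIV_Suc by (simp add: frechet_derivative_const)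
qed simp

lemma Ck_closure_UNIV_linear:
  assumes "bounded_linear f"
  shows "Ck_closure k UNIV f"
proof (cases k)
  case 0
  then show ?thesis using assms by (simp add: linear_continuous_on)
next
  case (Suc j)
  have "(f has_derivative f) (at x)" for x
    using assms by (rule bounded_linear_imp_has_derivative)
  then have "frechet_derivative f (at x) = f" and "f differentiable (at x)" for x
    by (auto simp: differentiable_def frechet_derivative_at[symmetric])
  then show ?thesis
    unfolding Suc Ck_closure_UNIV_Suc by (simp add: Ck_closure_UNIV_const)
qed

lemma Ck_closure_UNIV_add:
  assumes "Ck_closure k UNIV f" "Ck_closure k UNIV g"
  shows "Ck_closure k UNIV (\<lambda>x. f x + g x)"
  using assms
proof (induction k arbitrary: f g)
  case 0
  then show ?case by (auto intro: continuous_intros)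
next
  case (Suc k)
  then have d: "f differentiable (at x)" "g differentiable (at x)" for x
    unfolding Ck_closure_UNIV_Suc by auto
  have "frechet_derivative (\<lambda>x. f x + g x) (at x) =
      (\<lambda>i. frechet_derivative f (at x) i + frechet_derivative g (at x) i)" for x
    by (rule frechet_derivative_at[symmetric])
      (intro derivative_intros d[THEN frechet_derivative_works[THEN iffD1]])
  then show ?case
    using Suc d unfolding Ck_closure_UNIV_Suc by simp
qed

lemma Ck_closure_UNIV_mult:
  assumes "Ck_closure k UNIV f" "Ck_closure k UNIV g"
  shows "Ck_closure k UNIV (\<lambda>x. f x * g x)"
  using assms
proof (induction k arbitrary: f g)
  case 0
  then show ?case by (auto intro: continuous_intros)
next
  case (Suc k)
  then have d: "f differentiable (at x)" "g differentiable (at x)" for x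
    unfolding Ck_closure_UNIV_Suc by auto
  have "frechet_derivative (\<lambda>x. f x * g x) (at x) =
      (\<lambda>i. f x * frechet_derivative g (at x) i + frechet_derivative f (at x) i * g x)" for x
    by (rule frechet_derivative_at[symmetric])
      (intro derivative_intros d[THEN frechet_derivative_works[THEN iffD1]])
  then show ?case
    using Suc d Ck_closure_UNIV_SucD[OF Suc.prems(1)] Ck_closure_UNIV_SucD[OF Suc.prems(2)]
    unfolding Ck_closure_UNIV_Suc by (simp add: Ck_closure_UNIV_add)
qed

lemma Ck_closure_UNIV_sum:
  "finite I \<Longrightarrow> (\<And>i. i \<in> I \<Longrightarrow> Ck_closure k UNIV (f i)) \<Longrightarrow> Ck_closure k UNIV (\<lambda>x. \<Sum>i\<in>I. f i x)"
  by (induction I rule: finite_induct) (auto simp: Ck_closure_UNIV_const Ck_closure_UNIV_add)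

lemma frechet_derivative_real_compose:
  fixes u :: "'a::real_normed_vector \<Rightarrow> real"
  assumes "u differentiable (at x)" "(h has_real_derivative d) (at (u x))"
  shows "frechet_derivative (\<lambda>x. h (u x)) (at x) = (\<lambda>i. d * frechet_derivative u (at x) i)"
    and "(\<lambda>x. h (u x)) differentiable (at x)"
proof -
  have "((\<lambda>x. h (u x)) has_derivative (\<lambda>i. d * frechet_derivative u (at x) i)) (at x)"
    using has_derivative_compose[of u "frechet_derivative u (at x)" x UNIV h "(*) d"] assms
    by (simp add: frechet_derivative_works has_field_derivative_def)
  then show "frechet_derivative (\<lambda>x. h (u x)) (at x) = (\<lambda>i. d * frechet_derivative u (at x) i)"
    and "(\<lambda>x. h (u x)) differentiable (at x)"
    by (auto simp: differentiable_def frechet_derivative_at[symmetric])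
qed

text \<open>The chain rule brings in the derivative of the outer function, so the induction on
  \<open>k\<close> runs over a family \<open>\<H>\<close> closed under differentiation instead of a
  single \<open>h\<close>. It is applied to polynomials and to the functions
  \<open>flat q\<close>.\<close>

lemma Ck_closure_UNIV_compose:
  fixes u :: "'a::euclidean_space \<Rightarrow> real"
  assumes "\<And>h. h \<in> \<H> \<Longrightarrow> \<exists>h'\<in>\<H>. \<forall>x. (h has_real_derivative h' x) (at x)"
    and "h \<in> \<H>" "Ck_closure k UNIV u"
  shows "Ck_closure k UNIV (\<lambda>x. h (u x))"
  using assms(2,3)
proof (induction k arbitrary: h)
  case 0
  then obtain h' where "\<forall>x. (h has_real_derivative h' x) (at x)" using assms(1) by blast
  then have "continuous_on UNIV h"
    by (meson DERIV_isCont continuous_at_imp_continuous_on)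
  then show ?case
    using 0 continuous_on_compose2[of UNIV h UNIV u] by simp
next
  case (Suc k)
  obtain h' where h': "h' \<in> \<H>" "\<And>x. (h has_real_derivative h' x) (at x)"
    using assms(1) Suc.prems(1) by blast
  have d: "u differentiable (at x)" for x
    using Suc.prems(2) unfolding Ck_closure_UNIV_Suc by auto
  show ?case
    unfolding Ck_closure_UNIV_Suc frechet_derivative_real_compose(1)[OF d h'(2)]
    using frechet_derivative_real_compose(2)[OF d h'(2)] Suc.IH[OF h'(1)]
      Ck_closure_UNIV_SucD[OF Suc.prems(2)] Suc.prems(2)
    by (auto simp: Ck_closure_UNIV_mult Ck_closure_UNIV_Suc simp del: Ck_closure.simps)
qed

lemma Ck_closure_UNIV_polynomial:
  fixes u :: "'a::euclidean_space \<Rightarrow> real"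
  assumes "real_polynomial_function p" "Ck_closure k UNIV u"
  shows "Ck_closure k UNIV (\<lambda>x. p (u x))"
proof (rule Ck_closure_UNIV_compose[of "Collect real_polynomial_function" p])
  fix h :: "real \<Rightarrow> real" assume "h \<in> Collect real_polynomial_function"
  then show "\<exists>h'\<in>Collect real_polynomial_function. \<forall>x. (h has_real_derivative h' x) (at x)"
    using has_real_derivative_polynomial_function[of h] by auto
qed (use assms in auto)

lemma Ck_closure_UNIV_norm_squared:
  "Ck_closure k UNIV (\<lambda>x::'a::euclidean_space. (norm x)\<^sup>2)"
proof -
  have "(\<lambda>x::'a. (norm x)\<^sup>2) = (\<lambda>x. \<Sum>i\<in>Basis. (x \<bullet> i) * (x \<bullet> i))"
    by (rule ext) (subst power2_norm_eq_inner, subst euclidean_inner, rule refl)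
  then show ?thesis
    by (simp only:) (intro Ck_closure_UNIV_sum Ck_closure_UNIV_mult Ck_closure_UNIV_linear
        bounded_linear_inner_left finite_Basis)
qed

section \<open>Smooth functions that are flat at 0\<close>

lemma polynomial_exp_tendsto_0:
  assumes "real_polynomial_function q"
  shows "((\<lambda>y. q y * exp (- y)) \<longlongrightarrow> 0) at_top"
proof -
  obtain a n where q: "q = (\<lambda>x. \<Sum>i\<le>n. a i * x ^ i)"
    using assms real_polynomial_function_iff_sum by blast
  have "((\<lambda>y. \<Sum>i\<le>n. a i * (y ^ i / exp y)) \<longlongrightarrow> (\<Sum>i\<le>n. a i * 0)) at_top"
    by (intro tendsto_intros tendsto_power_div_exp_0)
  then show ?thesis
    by (simp add: q sum_distrib_right exp_minus divide_inverse mult.assoc)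
qed

text \<open>The classical function exp (- 1 / z), extended by 0. The polynomial factor in 1 / z
  makes the family closed under differentiation, as \<open>Ck_closure_UNIV_compose\<close>
  demands.\<close>

definition flat :: "(real \<Rightarrow> real) \<Rightarrow> real \<Rightarrow> real" where
  "flat q z = (if z > 0 then q (1 / z) * exp (- (1 / z)) else 0)"

lemma flat_derivative:
  assumes q: "real_polynomial_function q" "\<And>x. (q has_real_derivative q' x) (at x)"
  shows "(flat q has_real_derivative flat (\<lambda>y. y\<^sup>2 * (q y - q' y)) z) (at z)"
proof -
  consider "z > 0" | "z < 0" | "z = 0" by linarith
  then show ?thesis
  proof cases
    case 1
    have "((\<lambda>z. q (1 / z) * exp (- (1 / z))) has_real_derivative
        flat (\<lambda>y. y\<^sup>2 * (q y - q' y)) z) (at z)"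
      using 1 
      by (auto intro!: derivative_eq_intros DERIV_chain2[OF q(2)]
          simp: flat_def power2_eq_square field_simps)
    then show ?thesis
      by (rule has_field_derivative_transform_within_open[where S="{0<..}"])
        (use 1 in \<open>auto simp: flat_def\<close>)
  next
    case 2
    have "((\<lambda>z. 0) has_real_derivative flat (\<lambda>y. y\<^sup>2 * (q y - q' y)) z) (at z)"
      using 2 by (auto simp: flat_def)
    then show ?thesis
      by (rule has_field_derivative_transform_within_open[where S="{..<0}"])
        (use 2 in \<open>auto simp: flat_def\<close>)
  next
    case 3
    \<comment> \<open>With y = 1 / h the difference quotient at 0 from the right is q(y) y exp (-
      y).\<close>
    have "((\<lambda>y. (q y * y) * exp (- y)) \<longlongrightarrow> 0) at_top"
      by (rule polynomial_exp_tendsto_0)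
        (intro real_polynomial_function.intros(4) real_polynomial_function.intros(1) q bounded_linear_ident)
    then have "((\<lambda>h. (q (inverse h) * inverse h) * exp (- inverse h)) \<longlongrightarrow> 0) (at_right 0)"
      by (rule filterlim_compose[OF _ filterlim_inverse_at_top_right])
    then have r: "((\<lambda>h. flat q h / h) \<longlongrightarrow> 0) (at_right 0)"
      by (rule Lim_transform_eventually)
        (auto simp: eventually_at_filter flat_def field_simps)
    have l: "((\<lambda>h. flat q h / h) \<longlongrightarrow> 0) (at_left 0)"
      by (rule Lim_transform_eventually[OF tendsto_const])
        (auto simp: eventually_at_filter flat_def)
    show ?thesis
      using filterlim_split_at[OF l r] 3 by (simp add: DERIV_def flat_def)
  qed
qed

lemma Ck_closure_UNIV_flat:
  assumes "real_polynomial_function q" "Ck_closure k UNIV u"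
  shows "Ck_closure k UNIV (\<lambda>x. flat q (u x))"
proof (rule Ck_closure_UNIV_compose[of "flat ` Collect real_polynomial_function" "flat q"])
  fix h assume "h \<in> flat ` Collect real_polynomial_function"
  then obtain q where q: "real_polynomial_function q" "h = flat q" by auto
  obtain q' where q': "real_polynomial_function q'" "\<And>x. (q has_real_derivative q' x) (at x)"
    using has_real_derivative_polynomial_function[OF q(1)] by blast
  have "real_polynomial_function (\<lambda>y. y\<^sup>2 * (q y - q' y))"
    by (intro real_polynomial_function_power real_polynomial_function_diff
        real_polynomial_function.intros(4) q q' real_polynomial_function.intros(1) bounded_linear_ident)
  then show "\<exists>h'\<in>flat ` Collect real_polynomial_function. \<forall>x. (h has_real_derivative h' x) (at x)"
    using flat_derivative[OF q(1) q'(2)] q(2) by blast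
qed (use assms in auto)

subsection \<open>Approximation in \<open>H\<^sup>1\<^sub>0\<close>\<close>

lemma integral_translation_lborel:
  fixes f :: "'a::euclidean_space \<Rightarrow> real"
  assumes "f \<in> borel_measurable borel"
  shows "(\<integral>x. f (c + x) \<partial>lborel) = (\<integral>x. f x \<partial>lborel)"
proof -
  have "(\<integral>x. f x \<partial>distr lborel borel (\<lambda>x. c + x)) = (\<integral>x. f (c + x) \<partial>lborel)"
    by (rule integral_distr) (use assms in auto)
  then show ?thesis by (simp add: lborel_distr_plus)
qed

lemma integrable_continuous_bounded_support:
  fixes \<psi> :: "'a::euclidean_space \<Rightarrow> real"
  assumes "continuous_on UNIV \<psi>" "\<And>x. norm x \<ge> R \<Longrightarrow> \<psi> x = 0"
  shows "integrable lborel \<psi>"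
proof -
  have "integrable lborel (\<lambda>x. indicator (cball 0 R) x *\<^sub>R \<psi> x)"
    by (rule borel_integrable_compact) (auto intro: continuous_on_subset[OF assms(1)])
  moreover have "(\<lambda>x. indicator (cball 0 R) x *\<^sub>R \<psi> x) = \<psi>"
    using assms(2) by (force simp: indicator_def)
  ultimately show ?thesis by simp
qed

text \<open>Difference quotients of \<open>\<psi>\<close> integrate to 0 by translation invariance.
  The mean value theorem bounds them uniformly, and dominated convergence passes to the
  derivative.\<close>

lemma integral_directional_derivative_eq_0:
  fixes \<psi> :: "'a::euclidean_space \<Rightarrow> real"
  assumes der: "\<And>x. (\<psi> has_derivative D x) (at x)"
    and cont: "continuous_on UNIV (\<lambda>x. D x i)"
    and supp: "\<And>x. norm x \<ge> R \<Longrightarrow> \<psi> x = 0"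
    and i: "norm i \<le> 1"
  shows "(\<integral>x. D x i \<partial>lborel) = 0"
proof -
  have cpsi: "continuous_on UNIV \<psi>"
    by (meson der has_derivative_continuous continuous_at_imp_continuous_on)
  have int: "integrable lborel \<psi>"
    using cpsi supp by (rule integrable_continuous_bounded_support)
  have line: "((\<lambda>t. \<psi> (x + t *\<^sub>R i)) has_real_derivative D (x + t *\<^sub>R i) i) (at t)" for x t
  proof -
    have "((\<lambda>t. x + t *\<^sub>R i) has_derivative (\<lambda>h. h *\<^sub>R i)) (at t)"
      by (auto intro!: derivative_eq_intros)
    from has_derivative_compose[OF this der]
    have "((\<lambda>t. \<psi> (x + t *\<^sub>R i)) has_derivative (\<lambda>h. D (x + t *\<^sub>R i) (h *\<^sub>R i))) (at t)" .
    moreover have "(\<lambda>h. D (x + t *\<^sub>R i) (h *\<^sub>R i)) = (*) (D (x + t *\<^sub>R i) i)"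
      using linear_scale[OF has_derivative_linear[OF der]] by (auto simp: mult.commute)
    ultimately show ?thesis by (simp add: has_field_derivative_def)
  qed
  \<comment> \<open>The shifts below have length at most 1: the difference quotients vanish outside
    the ball of radius R + 1, and the mean value points belonging to that ball lie within R +
    2.\<close>
  have "bounded ((\<lambda>x. D x i) ` cball 0 (R + 2))"
    by (intro compact_imp_bounded compact_continuous_image continuous_on_subset[OF cont]) auto
  then obtain B where B: "\<And>x. norm x \<le> R + 2 \<Longrightarrow> \<bar>D x i\<bar> \<le> B"
    by (simp add: bounded_iff) (metis mem_cball_0)
  define h where "h = (\<lambda>n. inverse (real (Suc n)))"
  have h: "0 < h n" "h n \<le> 1" for n by (auto simp: h_def field_simps)
  have h0: "h \<longlonglongrightarrow> 0" unfolding h_def by (rule LIMSEQ_inverse_real_of_nat)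
  define s where "s = (\<lambda>n x. (\<psi> (h n *\<^sub>R i + x) - \<psi> x) / h n)"
  have bound: "norm (s n x) \<le> indicator (cball 0 (R + 1)) x *\<^sub>R B" for n x
  proof (cases "norm x \<le> R + 1")
    case True
    have "\<exists>z. 0 < z \<and> z < h n \<and> \<psi> (x + h n *\<^sub>R i) - \<psi> (x + 0 *\<^sub>R i) = (h n - 0) * D (x + z *\<^sub>R i) i"
      using h by (intro MVT2) (auto intro: line)
    then obtain z where z: "0 < z" "z < h n" "\<psi> (x + h n *\<^sub>R i) - \<psi> x = h n * D (x + z *\<^sub>R i) i"
      by auto
    have "norm (z *\<^sub>R i) \<le> 1"
      using z h[of n] i mult_le_one[of z "norm i"] by auto
    then have "norm (x + z *\<^sub>R i) \<le> R + 2"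
      using True norm_triangle_ineq[of x "z *\<^sub>R i"] by linarith
    then show ?thesis
      using z h[of n] B True by (simp add: s_def add.commute)
  next
    case False
    have "norm (h n *\<^sub>R i) \<le> 1"
      using h[of n] i mult_le_one[of "h n" "norm i"] by auto
    then have "norm (h n *\<^sub>R i + x) \<ge> R"
      using False norm_diff_ineq[of x "h n *\<^sub>R i"] by (simp add: add.commute)
    then show ?thesis
      using False supp by (simp add: s_def)
  qed
  have "(\<lambda>n. \<integral>x. s n x \<partial>lborel) \<longlonglongrightarrow> (\<integral>x. D x i \<partial>lborel)"
  proof (rule integral_dominated_convergence)
    show "(\<lambda>x. D x i) \<in> borel_measurable lborel"
      using cont by (simp add: borel_measurable_continuous_onI)
    have "(\<lambda>x. \<psi> (h n *\<^sub>R i + x)) \<in> borel_measurable borel" for n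
      by (intro borel_measurable_continuous_onI continuous_on_compose2[OF cpsi])
        (auto intro: continuous_intros)
    then show "s n \<in> borel_measurable lborel" for n
      using borel_measurable_continuous_onI[OF cpsi] unfolding s_def by measurable
    show "integrable lborel (\<lambda>x. indicator (cball 0 (R + 1)) x *\<^sub>R B)"
      by (rule borel_integrable_compact) auto
    have "(\<lambda>n. s n x) \<longlonglongrightarrow> D x i" for x
    proof -
      have "((\<lambda>t. (\<psi> (x + t *\<^sub>R i) - \<psi> x) / t) \<longlongrightarrow> D x i) (at 0)"
        using line[of x 0] by (simp add: DERIV_def)
      moreover have "filterlim h (at 0) sequentially"
        using h h0 by (simp add: filterlim_at less_imp_neq[symmetric])
      ultimately show ?thesis
        unfolding s_def add.commute[of _ x] by (rule filterlim_compose)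
    qed
    then show "AE x in lborel. (\<lambda>n. s n x) \<longlonglongrightarrow> D x i" by simp
    show "\<And>n. AE x in lborel. norm (s n x) \<le> indicator (cball 0 (R + 1)) x *\<^sub>R B"
      using bound by simp
  qed
  moreover have "(\<integral>x. s n x \<partial>lborel) = 0" for n
  proof -
    have m: "\<psi> \<in> borel_measurable borel"
      using cpsi by (rule borel_measurable_continuous_onI)
    have "integrable lborel (\<lambda>x. \<psi> (h n *\<^sub>R i + x))"
    proof (rule integrable_continuous_bounded_support[where R="R + norm (h n *\<^sub>R i)"])
      show "continuous_on UNIV (\<lambda>x. \<psi> (h n *\<^sub>R i + x))"
        by (intro continuous_on_compose2[OF cpsi] continuous_intros subset_UNIV)
      show "\<psi> (h n *\<^sub>R i + x) = 0" if "norm x \<ge> R + norm (h n *\<^sub>R i)" for x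
        using that norm_diff_ineq[of x "h n *\<^sub>R i"] by (intro supp) (simp add: add.commute)
    qed
    then show ?thesis
      using int integral_translation_lborel[OF m] by (simp add: s_def)
  qed
  ultimately show ?thesis
    by (simp add: LIMSEQ_const_iff)
qed

lemma test_functionD:
  assumes "test_function \<Omega> \<phi>"
  shows "continuous_on UNIV \<phi>" "\<And>x. (\<phi> has_derivative frechet_derivative \<phi> (at x)) (at x)"
    "i \<in> Basis \<Longrightarrow> continuous_on UNIV (\<lambda>x. frechet_derivative \<phi> (at x) i)"
    "\<exists>R. \<forall>x. norm x \<ge> R \<longrightarrow> \<phi> x = 0" "\<And>x. x \<notin> \<Omega> \<Longrightarrow> \<phi> x = 0"
proof -
  have 1: "Ck_closure (Suc 0) UNIV \<phi>" and 0: "Ck_closure 0 UNIV \<phi>"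
    using assms unfolding test_function_def by blast+
  show "continuous_on UNIV \<phi>" using 0 by simp
  show "(\<phi> has_derivative frechet_derivative \<phi> (at x)) (at x)" for x
    using 1 unfolding Ck_closure_UNIV_Suc by (simp add: frechet_derivative_works)
  show "continuous_on UNIV (\<lambda>x. frechet_derivative \<phi> (at x) i)" if "i \<in> Basis"
    using 1 that unfolding Ck_closure_UNIV_Suc by simp
  have "bounded (closure {x. \<phi> x \<noteq> 0})"
    using assms by (simp add: test_function_def compact_imp_bounded)
  then obtain R where R: "\<And>x. x \<in> closure {x. \<phi> x \<noteq> 0} \<Longrightarrow> norm x \<le> R"
    by (auto simp: bounded_iff)
  have "norm x \<le> R" if "\<phi> x \<noteq> 0" for x
    by (rule R, rule set_mp[OF closure_subset]) (use that in simp)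
  then have "\<forall>x. norm x \<ge> R + 1 \<longrightarrow> \<phi> x = 0" by fastforce
  then show "\<exists>R. \<forall>x. norm x \<ge> R \<longrightarrow> \<phi> x = 0" ..
  show "\<phi> x = 0" if "x \<notin> \<Omega>" for x
    using assms that closure_subset[of "{x. \<phi> x \<noteq> 0}"] unfolding test_function_def by blast
qed

lemma grad_inner_Basis: "i \<in> Basis \<Longrightarrow> grad \<phi> x \<bullet> i = frechet_derivative \<phi> (at x) i"
  by (simp add: grad_def inner_sum_left inner_Basis if_distrib cong: if_cong)

text \<open>Off the support, which is closed, \<open>\<phi>\<close> vanishes in a whole
  neighbourhood, and so does its gradient.\<close>

lemma test_function_grad:
  assumes "test_function \<Omega> \<phi>"
  shows "continuous_on UNIV (grad \<phi>)"
    and "x \<notin> \<Omega> \<Longrightarrow> grad \<phi> x = 0"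
proof -
  show "continuous_on UNIV (grad \<phi>)"
    unfolding grad_def by (intro continuous_intros test_functionD(3)[OF assms])
  let ?C = "closure {x. \<phi> x \<noteq> 0}"
  assume "x \<notin> \<Omega>"
  then have "x \<in> - ?C" "open (- ?C)"
    using assms by (auto simp: test_function_def)
  have "(\<phi> has_derivative (\<lambda>_. 0)) (at x)"
  proof (rule has_derivative_transform_within_open[OF has_derivative_const, of "- ?C"])
    have z: "\<phi> y = 0" if "y \<in> - ?C" for y
      using that closure_subset[of "{x. \<phi> x \<noteq> 0}"] by blast
    show "0 = \<phi> y" if "y \<in> - ?C" for y
      by (rule z[OF that, symmetric])
  qed fact+
  then have "frechet_derivative \<phi> (at x) = (\<lambda>_. 0)"
    by (simp add: frechet_derivative_at[symmetric])
  then show "grad \<phi> x = 0" by (simp add: grad_def)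
qed

text \<open>The partial derivatives of the compactly supported product
  \<open>\<psi> x * \<phi> x\<close> have integral 0. Both functions vanish off
  \<open>\<Omega>\<close>, so integrals over \<open>\<Omega>\<close> and over the whole space
  agree.\<close>

lemma test_function_integration_by_parts:
  assumes "test_function \<Omega> \<phi>" "test_function \<Omega> \<psi>" and i: "i \<in> Basis"
  shows "(LINT x:\<Omega>|lebesgue. \<psi> x * (grad \<phi> x \<bullet> i)) = - (LINT x:\<Omega>|lebesgue. (grad \<psi> x \<bullet> i) * \<phi> x)"
proof -
  note d = test_functionD[OF assms(1)] and e = test_functionD[OF assms(2)]
  obtain R where R: "\<And>x. norm x \<ge> R \<Longrightarrow> \<phi> x = 0" using d(4) by blast
  obtain R' where R': "\<And>x. norm x \<ge> R' \<Longrightarrow> \<psi> x = 0" using e(4) by blast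
  have c: "continuous_on UNIV (\<lambda>x. \<psi> x * (grad \<phi> x \<bullet> i))" "continuous_on UNIV (\<lambda>x. (grad \<psi> x \<bullet> i) * \<phi> x)"
    by (intro continuous_intros d e test_function_grad(1)[OF assms(1)] test_function_grad(1)[OF assms(2)])+
  have int: "integrable lborel (\<lambda>x. \<psi> x * (grad \<phi> x \<bullet> i))" "integrable lborel (\<lambda>x. (grad \<psi> x \<bullet> i) * \<phi> x)"
    by (rule integrable_continuous_bounded_support[OF c(1), of R'], simp add: R')
      (rule integrable_continuous_bounded_support[OF c(2), of R], simp add: R)
  have der: "((\<lambda>x. \<psi> x * \<phi> x) has_derivative
     (\<lambda>h. \<psi> x * frechet_derivative \<phi> (at x) h + frechet_derivative \<psi> (at x) h * \<phi> x)) (at x)" for x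
    by (intro derivative_intros d e)
  have "(\<integral>x. \<psi> x * (grad \<phi> x \<bullet> i) + (grad \<psi> x \<bullet> i) * \<phi> x \<partial>lborel) = 0"
    using integral_directional_derivative_eq_0[OF der, of i R] i c R
    by (simp add: grad_inner_Basis continuous_on_add)
  then have "(\<integral>x. \<psi> x * (grad \<phi> x \<bullet> i) \<partial>lborel) = - (\<integral>x. (grad \<psi> x \<bullet> i) * \<phi> x \<partial>lborel)"
    using int by simp
  moreover have "(LINT x:\<Omega>|lebesgue. f x) = (\<integral>x. f x \<partial>lborel)"
    if "continuous_on UNIV f" "\<And>x. x \<notin> \<Omega> \<Longrightarrow> f x = 0" for f :: "'a \<Rightarrow> real"
  proof -
    have "(\<lambda>x. indicator \<Omega> x *\<^sub>R f x) = f" using that(2) by (force simp: indicator_def)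
    then show ?thesis
      using that(1) by (simp add: set_lebesgue_integral_def integral_completion borel_measurable_continuous_onI)
  qed
  then have "(LINT x:\<Omega>|lebesgue. \<psi> x * (grad \<phi> x \<bullet> i)) = (\<integral>x. \<psi> x * (grad \<phi> x \<bullet> i) \<partial>lborel)"
    "(LINT x:\<Omega>|lebesgue. (grad \<psi> x \<bullet> i) * \<phi> x) = (\<integral>x. (grad \<psi> x \<bullet> i) * \<phi> x \<partial>lborel)"
    using c d(5) e(5) by simp_all
  ultimately show ?thesis by simp
qed

text \<open>Integrability of the common bound \<open>D\<close> passes the integration by parts to
  the limit, because a test function and its gradient are bounded. Integrability of the square of
  \<open>D\<close> gives the convergence in the norm of H^1.\<close>

lemma H10_dominated_limit:
  fixes f :: "'a::euclidean_space \<Rightarrow> real" and g :: "'a \<Rightarrow> 'a" and D :: "'a \<Rightarrow> real"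
  assumes \<Omega>: "\<Omega> \<in> sets lebesgue" and Z: "Z \<in> null_sets lebesgue"
    and test: "\<And>n. test_function \<Omega> (\<phi> n)"
    and meas: "set_borel_measurable lebesgue \<Omega> f" "set_borel_measurable lebesgue \<Omega> g"
    and int: "set_integrable lebesgue \<Omega> D" "set_integrable lebesgue \<Omega> (\<lambda>x. (D x)\<^sup>2)"
    and bound: "\<And>n x. x \<in> \<Omega> - Z \<Longrightarrow> \<bar>\<phi> n x\<bar> \<le> D x" "\<And>n x. x \<in> \<Omega> - Z \<Longrightarrow> norm (grad (\<phi> n) x) \<le> D x"
    and lim: "\<And>x. x \<in> \<Omega> - Z \<Longrightarrow> (\<lambda>n. \<phi> n x) \<longlonglongrightarrow> f x" "\<And>x. x \<in> \<Omega> - Z \<Longrightarrow> (\<lambda>n. grad (\<phi> n) x) \<longlonglongrightarrow> g x"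
  shows "f \<in> H10 \<Omega>"
proof -
  have AE: "AE x in lebesgue. x \<notin> Z" using Z by (rule AE_not_in)
  have fD: "\<bar>f x\<bar> \<le> D x" if "x \<in> \<Omega> - Z" for x
    using tendsto_rabs[OF lim(1)[OF that]] bound(1)[OF that] by (intro LIMSEQ_le_const2) auto
  have gD: "norm (g x) \<le> D x" if "x \<in> \<Omega> - Z" for x
    using tendsto_norm[OF lim(2)[OF that]] bound(2)[OF that] by (intro LIMSEQ_le_const2) auto
  have contM: "(\<lambda>x. indicator \<Omega> x *\<^sub>R h x) \<in> borel_measurable lebesgue"
    if "continuous_on UNIV h" for h :: "'a \<Rightarrow> 'b::euclidean_space"
    using that \<Omega> by (intro borel_measurable_scaleR borel_measurable_indicator measurable_completion)
      (auto intro: borel_measurable_continuous_onI)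
  note mf = meas(1)[unfolded set_borel_measurable_def] and mg = meas(2)[unfolded set_borel_measurable_def]
  have mphi: "(\<lambda>x. indicator \<Omega> x *\<^sub>R \<phi> n x) \<in> borel_measurable lebesgue"
    "(\<lambda>x. indicator \<Omega> x *\<^sub>R grad (\<phi> n) x) \<in> borel_measurable lebesgue" for n
    by (intro contM test_functionD(1)[OF test] test_function_grad(1)[OF test])+
  have dct: "(\<lambda>n. LINT x:\<Omega>|lebesgue. s n x) \<longlonglongrightarrow> (LINT x:\<Omega>|lebesgue. t x)"
    if "\<And>n. (\<lambda>x. indicator \<Omega> x *\<^sub>R s n x) \<in> borel_measurable lebesgue"
      "(\<lambda>x. indicator \<Omega> x *\<^sub>R t x) \<in> borel_measurable lebesgue"
      "set_integrable lebesgue \<Omega> w"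
      "\<And>x n. x \<in> \<Omega> - Z \<Longrightarrow> \<bar>s n x\<bar> \<le> w x" "\<And>x. x \<in> \<Omega> - Z \<Longrightarrow> (\<lambda>n. s n x) \<longlonglongrightarrow> t x"
    for s :: "nat \<Rightarrow> 'a \<Rightarrow> real" and t w
    unfolding set_lebesgue_integral_def
  proof (rule integral_dominated_convergence[OF that(2,1) that(3)[unfolded set_integrable_def]])
    show "AE x in lebesgue. (\<lambda>n. indicator \<Omega> x *\<^sub>R s n x) \<longlonglongrightarrow> indicator \<Omega> x *\<^sub>R t x"
      using AE by eventually_elim (use that(5) in \<open>auto simp: indicator_def\<close>)
    show "AE x in lebesgue. norm (indicator \<Omega> x *\<^sub>R s n x) \<le> indicator \<Omega> x *\<^sub>R w x" for n
      using AE by eventually_elim (use that(4) in \<open>auto simp: indicator_def\<close>)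
  qed
  have sq: "set_integrable lebesgue \<Omega> (\<lambda>x. (norm (h x))\<^sup>2)"
    if "set_borel_measurable lebesgue \<Omega> h" "\<And>x. x \<in> \<Omega> - Z \<Longrightarrow> norm (h x) \<le> D x"
    for h :: "'a \<Rightarrow> 'b::euclidean_space"
    unfolding set_integrable_def
  proof (rule Bochner_Integration.integrable_bound[OF int(2)[unfolded set_integrable_def]])
    have "(\<lambda>x. (norm (indicator \<Omega> x *\<^sub>R h x))\<^sup>2) \<in> borel_measurable lebesgue"
      using that(1) unfolding set_borel_measurable_def by measurable
    also have "(\<lambda>x. (norm (indicator \<Omega> x *\<^sub>R h x))\<^sup>2) = (\<lambda>x. indicator \<Omega> x *\<^sub>R (norm (h x))\<^sup>2)"
      by (auto simp: indicator_def)
    finally show "(\<lambda>x. indicator \<Omega> x *\<^sub>R (norm (h x))\<^sup>2) \<in> borel_measurable lebesgue" .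
    show "AE x in lebesgue. norm (indicator \<Omega> x *\<^sub>R (norm (h x))\<^sup>2) \<le> norm (indicator \<Omega> x *\<^sub>R (D x)\<^sup>2)"
      using AE by eventually_elim (use that(2) in \<open>auto simp: indicator_def intro!: power_mono\<close>)
  qed
  have "L2_on \<Omega> f" "L2_on \<Omega> g"
    using meas sq[OF meas(1)] sq[OF meas(2)] fD gD by (auto simp: L2_on_def)
  moreover have "weak_gradient \<Omega> f g"
    unfolding weak_gradient_def
  proof (intro allI impI ballI)
    fix \<eta> and i :: 'a assume \<eta>: "test_function \<Omega> \<eta>" and i: "i \<in> Basis"
    obtain R where R: "\<And>x. norm x \<ge> R \<Longrightarrow> \<eta> x = 0"
      using test_functionD(4)[OF \<eta>] by blast
    have ceta: "continuous_on UNIV \<eta>" "continuous_on UNIV (grad \<eta>)"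
      by (rule test_functionD(1)[OF \<eta>], rule test_function_grad(1)[OF \<eta>])
    have cptsupp: "compact (closure {x. \<eta> x \<noteq> 0})" using \<eta> by (simp add: test_function_def)
    \<comment> \<open>\<open>test_function_grad\<close> is used with the support of
      \<open>\<eta>\<close> in the role of the domain.\<close>
    have gz: "grad \<eta> x = 0" if "x \<notin> closure {x. \<eta> x \<noteq> 0}" for x
    proof (rule test_function_grad(2)[OF _ that])
      show "test_function (closure {x. \<eta> x \<noteq> 0}) \<eta>" using \<eta> by (simp add: test_function_def)
    qed
    have ez: "\<eta> x = 0" if "x \<notin> closure {x. \<eta> x \<noteq> 0}" for x
      using that closure_subset[of "{x. \<eta> x \<noteq> 0}"] by blast
    have "bounded (\<eta> ` closure {x. \<eta> x \<noteq> 0})" "bounded (grad \<eta> ` closure {x. \<eta> x \<noteq> 0})"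
      by (intro compact_imp_bounded compact_continuous_image cptsupp continuous_on_subset[OF ceta(1)]
          continuous_on_subset[OF ceta(2)] subset_UNIV)+
    then obtain B1 B2 where B: "\<And>x. x \<in> closure {x. \<eta> x \<noteq> 0} \<Longrightarrow> \<bar>\<eta> x\<bar> \<le> B1"
      "\<And>x. x \<in> closure {x. \<eta> x \<noteq> 0} \<Longrightarrow> norm (grad \<eta> x) \<le> B2"
      by (fastforce simp: bounded_iff)
    define B where "B = max 0 (max B1 B2)"
    have Beta: "\<bar>\<eta> x\<bar> \<le> B" "norm (grad \<eta> x) \<le> B" for x
      using B[of x] gz[of x] ez[of x] by (cases "x \<in> closure {x. \<eta> x \<noteq> 0}"; force simp: B_def)+
    have Bi: "\<bar>grad \<eta> x \<bullet> i\<bar> \<le> B" for x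
      using Beta(2)[of x] Basis_le_norm[OF i, of "grad \<eta> x"] by linarith
    have w: "set_integrable lebesgue \<Omega> (\<lambda>x. D x * B)" using int(1) by (rule set_integrable_mult_left) 
    have bor: "(\<lambda>x. grad \<eta> x \<bullet> i) \<in> borel_measurable lebesgue" "\<eta> \<in> borel_measurable lebesgue"
      using ceta by (auto intro!: measurable_completion borel_measurable_continuous_onI continuous_intros)
    have m1: "(\<lambda>x. indicator \<Omega> x *\<^sub>R (h x * (grad \<eta> x \<bullet> i))) \<in> borel_measurable lebesgue"
      if "(\<lambda>x. indicator \<Omega> x *\<^sub>R h x) \<in> borel_measurable lebesgue" for h :: "'a \<Rightarrow> real"
      using borel_measurable_times[OF that bor(1)] by (simp add: mult.assoc)
    have m2: "(\<lambda>x. indicator \<Omega> x *\<^sub>R ((h x \<bullet> i) * \<eta> x)) \<in> borel_measurable lebesgue"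
      if "(\<lambda>x. indicator \<Omega> x *\<^sub>R h x) \<in> borel_measurable lebesgue" for h :: "'a \<Rightarrow> 'a"
    proof -
      have "(\<lambda>x. (indicator \<Omega> x *\<^sub>R h x) \<bullet> i) \<in> borel_measurable lebesgue"
        using that by measurable
      from borel_measurable_times[OF this bor(2)] show ?thesis by (simp add: mult.assoc)
    qed
    have "(\<lambda>n. LINT x:\<Omega>|lebesgue. \<phi> n x * (grad \<eta> x \<bullet> i)) \<longlonglongrightarrow> (LINT x:\<Omega>|lebesgue. f x * (grad \<eta> x \<bullet> i))"
    proof (rule dct[OF m1[OF mphi(1)] m1[OF mf] w])
      fix x n assume "x \<in> \<Omega> - Z"
      then show "\<bar>\<phi> n x * (grad \<eta> x \<bullet> i)\<bar> \<le> D x * B"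
        using bound(1)[of x n] Bi[of x] by (simp add: abs_mult mult_mono')
    qed (intro tendsto_intros lim)
    moreover have "(\<lambda>n. LINT x:\<Omega>|lebesgue. (grad (\<phi> n) x \<bullet> i) * \<eta> x) \<longlonglongrightarrow> (LINT x:\<Omega>|lebesgue. (g x \<bullet> i) * \<eta> x)"
    proof (rule dct[OF m2[OF mphi(2)] m2[OF mg] w])
      fix x n assume "x \<in> \<Omega> - Z"
      then show "\<bar>(grad (\<phi> n) x \<bullet> i) * \<eta> x\<bar> \<le> D x * B"
        using bound(2)[of x n] Beta(1)[of x] Basis_le_norm[OF i, of "grad (\<phi> n) x"]
        by (simp add: abs_mult mult_mono')
    qed (intro tendsto_intros lim)
    then have "(\<lambda>n. LINT x:\<Omega>|lebesgue. \<phi> n x * (grad \<eta> x \<bullet> i)) \<longlonglongrightarrow> - (LINT x:\<Omega>|lebesgue. (g x \<bullet> i) * \<eta> x)"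
      unfolding test_function_integration_by_parts[OF \<eta> test i] by (rule tendsto_minus)
    ultimately show "(LINT x:\<Omega>|lebesgue. f x * (grad \<eta> x \<bullet> i)) = - (LINT x:\<Omega>|lebesgue. (g x \<bullet> i) * \<eta> x)"
      by (rule LIMSEQ_unique)
  qed
  moreover have "(\<lambda>n. (LINT x:\<Omega>|lebesgue. (\<phi> n x - f x)\<^sup>2)
            + (LINT x:\<Omega>|lebesgue. (norm (grad (\<phi> n) x - g x))\<^sup>2)) \<longlonglongrightarrow> 0"
  proof -
    have w: "set_integrable lebesgue \<Omega> (\<lambda>x. (D x)\<^sup>2 * 4)" using int(2) by (rule set_integrable_mult_left)
    have m: "(\<lambda>x. indicator \<Omega> x *\<^sub>R (norm (h x))\<^sup>2) \<in> borel_measurable lebesgue"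
      if "(\<lambda>x. indicator \<Omega> x *\<^sub>R h x) \<in> borel_measurable lebesgue" for h :: "'a \<Rightarrow> 'b::euclidean_space"
    proof -
      have "(\<lambda>x. (norm (indicator \<Omega> x *\<^sub>R h x))\<^sup>2) \<in> borel_measurable lebesgue"
        using that by measurable
      also have "(\<lambda>x. (norm (indicator \<Omega> x *\<^sub>R h x))\<^sup>2) = (\<lambda>x. indicator \<Omega> x *\<^sub>R (norm (h x))\<^sup>2)"
        by (auto simp: indicator_def)
      finally show ?thesis .
    qed
    have conv: "(\<lambda>n. LINT x:\<Omega>|lebesgue. (norm (s n x - t x))\<^sup>2) \<longlonglongrightarrow> 0"
      if "\<And>n. (\<lambda>x. indicator \<Omega> x *\<^sub>R s n x) \<in> borel_measurable lebesgue"
        "(\<lambda>x. indicator \<Omega> x *\<^sub>R t x) \<in> borel_measurable lebesgue"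
        "\<And>x n. x \<in> \<Omega> - Z \<Longrightarrow> norm (s n x) \<le> D x" "\<And>x. x \<in> \<Omega> - Z \<Longrightarrow> norm (t x) \<le> D x"
        "\<And>x. x \<in> \<Omega> - Z \<Longrightarrow> (\<lambda>n. s n x) \<longlonglongrightarrow> t x"
      for s :: "nat \<Rightarrow> 'a \<Rightarrow> 'b::euclidean_space" and t
    proof -
      have "(\<lambda>n. LINT x:\<Omega>|lebesgue. (norm (s n x - t x))\<^sup>2) \<longlonglongrightarrow> (LINT x:\<Omega>|lebesgue. 0)"
      proof (rule dct[OF _ _ w])
        show "(\<lambda>x. indicator \<Omega> x *\<^sub>R (norm (s n x - t x))\<^sup>2) \<in> borel_measurable lebesgue" for n
          using borel_measurable_diff[OF that(1)[of n] that(2)]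
          by (intro m) (simp add: scaleR_diff_right)
        fix x assume x: "x \<in> \<Omega> - Z"
        show "\<bar>(norm (s n x - t x))\<^sup>2\<bar> \<le> (D x)\<^sup>2 * 4" for n
        proof -
          have "norm (s n x - t x) \<le> 2 * D x"
            using that(3)[OF x, of n] that(4)[OF x] norm_triangle_ineq4[of "s n x" "t x"] by linarith
          then have "(norm (s n x - t x))\<^sup>2 \<le> (2 * D x)\<^sup>2" by (intro power_mono) auto
          then show ?thesis by (simp add: power_mult_distrib)
        qed
        have "(\<lambda>n. (norm (s n x - t x))\<^sup>2) \<longlonglongrightarrow> (norm (t x - t x))\<^sup>2"
          by (intro tendsto_intros that(5) x)
        then show "(\<lambda>n. (norm (s n x - t x))\<^sup>2) \<longlonglongrightarrow> 0" by simp
      qed simp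
      then show ?thesis by (simp add: set_lebesgue_integral_def)
    qed
    have "(\<lambda>n. LINT x:\<Omega>|lebesgue. (\<phi> n x - f x)\<^sup>2) \<longlonglongrightarrow> 0"
      using conv[OF mphi(1) mf] bound(1) fD lim(1) by simp
    moreover have "(\<lambda>n. LINT x:\<Omega>|lebesgue. (norm (grad (\<phi> n) x - g x))\<^sup>2) \<longlonglongrightarrow> 0"
      using conv[OF mphi(2) mg] bound(2) gD lim(2) by simp
    ultimately show ?thesis using tendsto_add by fastforce
  qed
  ultimately show ?thesis
    unfolding H10_def using test by blast
qed

text \<open>On the shell where |x| lies between 2^-(k+1) and 2^-k the function is at most 4^(k+1),
  and in dimension at least 3 the ball of radius 2^-k has volume at most V 8^-k. The resulting
  geometric series has ratio 1/2. Whole balls replace the shells, which only enlarges the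
  sum.\<close>

lemma set_integrable_inverse_norm_squared:
  assumes dim: "DIM('a) \<ge> 3"
  shows "set_integrable lebesgue (ball 0 1) (\<lambda>x::'a::euclidean_space. 1 / (norm x)\<^sup>2)"
proof -
  define V where "V = unit_ball_vol (real DIM('a))"
  have V: "V \<ge> 0" by (simp add: V_def)
  define f where "f = (\<lambda>x::'a. indicator (ball 0 1) x *\<^sub>R (1 / (norm x)\<^sup>2))"
  have meas: "f \<in> borel_measurable borel" unfolding f_def
    by (intro borel_measurable_scaleR borel_measurable_indicator borel_measurable_divide
        borel_measurable_power borel_measurable_norm measurable_ident_sets borel_measurable_const) auto
  have le_suminf: "h k \<le> suminf h" for h :: "nat \<Rightarrow> ennreal" and k
    using sum_le_suminf[of h "{k}"] by simp
  have pt: "ennreal (f x) \<le> (\<Sum>k. ennreal (4 ^ Suc k) * indicator (cball 0 ((1/2) ^ k)) x)" (is "_ \<le> suminf ?t") for x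
  proof (cases "x \<in> ball 0 1 - {0}")
    case True
    then have x: "0 < norm x" "norm x < 1" by auto
    obtain j where j: "(1/2) ^ j < norm x"
      using real_arch_pow_inv[OF x(1), of "1/2"] by auto
    define k where "k = (LEAST k. (1/2) ^ Suc k < norm x)"
    have "(1/2) ^ Suc j < norm x" using j norm_ge_zero[of x] by (simp, linarith)
    then have k: "(1/2) ^ Suc k < norm x" unfolding k_def by (rule LeastI)
    have "norm x \<le> (1/2) ^ k"
    proof (cases k)
      case (Suc i)
      then have "i < k" by simp
      then have "\<not> (1/2) ^ Suc i < norm x" unfolding k_def by (rule not_less_Least)
      then show ?thesis using Suc by simp
    qed (use x in simp)
    then have xin: "x \<in> cball 0 ((1/2) ^ k)" by simp
    have "((1/2) ^ Suc k)\<^sup>2 \<le> (norm x)\<^sup>2"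
      using k by (intro power_mono) auto
    then have "1 / (norm x)\<^sup>2 \<le> 1 / ((1/2) ^ Suc k)\<^sup>2"
      by (rule divide_left_mono) (use x in \<open>auto intro!: mult_pos_pos\<close>)
    also have "\<dots> = 4 ^ Suc k"
      by (simp add: power_one_over power2_eq_square power_mult_distrib[symmetric])
    finally have "ennreal (f x) \<le> ?t k"
      using x xin by (simp add: f_def ennreal_leI)
    also have "\<dots> \<le> suminf ?t"
      by (rule le_suminf)
    finally show ?thesis .
  qed (auto simp: f_def)
  have "(\<integral>\<^sup>+x. ennreal (f x) \<partial>lborel) \<le> (\<integral>\<^sup>+x. (\<Sum>k. ennreal (4 ^ Suc k) * indicator (cball 0 ((1/2) ^ k)) (x::'a)) \<partial>lborel)"
    by (intro nn_integral_mono pt)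
  also have "\<dots> = (\<Sum>k. \<integral>\<^sup>+x. ennreal (4 ^ Suc k) * indicator (cball 0 ((1/2) ^ k)) (x::'a) \<partial>lborel)"
    by (rule nn_integral_suminf)
      (intro borel_measurable_times_ennreal borel_measurable_indicator borel_measurable_const, simp)
  also have "\<dots> = (\<Sum>k. ennreal (4 ^ Suc k) * ennreal (V * ((1/2) ^ k) ^ DIM('a)))"
    by (intro suminf_cong) (simp add: nn_integral_cmult_indicator emeasure_cball V_def)
  also have "\<dots> \<le> (\<Sum>k. ennreal (4 * V * (1/2) ^ k))"
  proof (intro suminf_le summableI)
    fix k
    have "((1/2::real) ^ k) ^ DIM('a) \<le> ((1/2) ^ k) ^ 3"
      using dim by (intro power_decreasing) (auto simp: power_le_one)
    also have "\<dots> = (1/8) ^ k" by (simp add: power_mult[symmetric] mult.commute[of k 3]) (simp add: power_mult power3_eq_cube)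
    finally have "4 ^ Suc k * (V * ((1/2) ^ k) ^ DIM('a)) \<le> 4 ^ Suc k * (V * (1/8) ^ k)"
      using V by (intro mult_left_mono) auto
    also have "\<dots> = 4 * V * (4 * (1/8)) ^ k" by (simp only: power_mult_distrib power_Suc ac_simps)
    finally show "ennreal (4 ^ Suc k) * ennreal (V * ((1/2) ^ k) ^ DIM('a)) \<le> ennreal (4 * V * (1/2) ^ k)"
      by (simp add: ennreal_mult[symmetric] ennreal_leI V)
  qed
  also have "\<dots> < \<infinity>"
  proof -
    have "(\<lambda>k. 4 * V * (1/2) ^ k) sums (4 * V * (1 / (1 - 1/2)))"
      by (intro sums_mult geometric_sums) auto
    then have "(\<Sum>k. ennreal (4 * V * (1/2) ^ k)) = ennreal (4 * V * (1 / (1 - 1/2)))"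
      using V by (intro suminf_ennreal_eq) auto
    then show ?thesis by simp
  qed
  finally have "integrable lborel f"
    using meas by (intro integrableI_bounded) (auto simp: f_def)
  then show ?thesis
    using meas by (simp add: set_integrable_def f_def integrable_completion)
qed

section \<open>Polynomial approximation and smooth truncation\<close>

lemma polynomial_antiderivative:
  assumes "real_polynomial_function f"
  shows "\<exists>F. real_polynomial_function F \<and> (\<forall>x. (F has_real_derivative f x) (at x))"
proof -
  obtain a n where f: "f = (\<lambda>x. \<Sum>i\<le>n. a i * x ^ i)"
    using assms real_polynomial_function_iff_sum by blast
  let ?F = "\<lambda>x. \<Sum>i\<le>n. (a i / real (Suc i)) * x ^ Suc i"
  have "real_polynomial_function ?F"
    by (intro real_polynomial_function_sum real_polynomial_function.intros(4)
        real_polynomial_function.intros(2) real_polynomial_function_power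
        real_polynomial_function.intros(1) bounded_linear_ident) auto
  moreover have "(?F has_real_derivative f x) (at x)" for x
    unfolding f by (rule DERIV_sum) (auto intro!: derivative_eq_intros simp del: power_Suc)
  ultimately show ?thesis by blast
qed

text \<open>Stone-Weierstrass is applied to the square root of \<open>k\<close> and the result is
  squared. A square has a sign, which makes the antiderivatives in \<open>H10_radial\<close>
  monotone.\<close>

lemma approximate_by_polynomial_square:
  fixes k :: "real \<Rightarrow> real"
  assumes "continuous_on {0..1} k" "\<And>t. t \<in> {0..1} \<Longrightarrow> k t \<ge> 0" "e > 0"
  shows "\<exists>s. real_polynomial_function s \<and> (\<forall>t\<in>{0..1}. \<bar>(s t)\<^sup>2 - k t\<bar> < e)"
proof -
  have c: "continuous_on {0..1} (\<lambda>t. sqrt (k t))" by (intro continuous_intros assms(1))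
  obtain B where "\<forall>y\<in>(\<lambda>t. sqrt (k t)) ` {0..1}. norm y \<le> B"
    using compact_imp_bounded[OF compact_continuous_image[OF c compact_Icc]]
    by (auto simp: bounded_iff)
  then have B: "sqrt (k t) \<le> B" if "t \<in> {0..1}" for t
    using that by (metis (mono_tags, lifting) abs_le_D1 image_eqI real_norm_def)
  have "B \<ge> 0" 
    using assms(2)[of 0] by (intro order_trans[OF _ B[of 0]]) auto
  \<comment> \<open>If \<open>s\<close> is within \<open>d\<close> \<le> 1 of the root, then |s^2 -
    k| \<le> d (2 B + 1), and \<open>d\<close> is chosen to put this below \<open>e\<close>.\<close>
  define d where "d = min 1 (e / (2 * B + 2))"
  have d: "0 < d" "d \<le> 1" "d * (2 * B + 1) < e"
  proof -
    show "0 < d" "d \<le> 1" using \<open>B \<ge> 0\<close> assms(3) by (auto simp: d_def)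
    have "d * (2 * B + 1) < d * (2 * B + 2)" using \<open>0 < d\<close> by simp
    also have "\<dots> \<le> e / (2 * B + 2) * (2 * B + 2)"
      using \<open>B \<ge> 0\<close> by (intro mult_right_mono) (auto simp: d_def)
    also have "\<dots> = e" using \<open>B \<ge> 0\<close> by simp
    finally show "d * (2 * B + 1) < e" .
  qed
  obtain s where s: "real_polynomial_function s" "\<And>t. t \<in> {0..1} \<Longrightarrow> \<bar>sqrt (k t) - s t\<bar> < d"
    using Stone_Weierstrass_real_polynomial_function[OF compact_Icc c d(1)] by blast
  have "\<bar>(s t)\<^sup>2 - k t\<bar> < e" if t: "t \<in> {0..1}" for t
  proof -
    have "(s t)\<^sup>2 - k t = (s t - sqrt (k t)) * (s t + sqrt (k t))"
      using assms(2)[OF t] by (simp add: algebra_simps power2_eq_square)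
    then have "\<bar>(s t)\<^sup>2 - k t\<bar> = \<bar>s t - sqrt (k t)\<bar> * \<bar>s t + sqrt (k t)\<bar>" by (simp add: abs_mult)
    also have "\<dots> \<le> d * (2 * B + 1)"
    proof (intro mult_mono)
      have "0 \<le> sqrt (k t)" using assms(2)[OF t] by simp
      then show "\<bar>s t + sqrt (k t)\<bar> \<le> 2 * B + 1"
        using s(2)[OF t] B[OF t] d(2) by linarith
    qed (use s(2)[OF t] d(1) in auto)
    finally show ?thesis using d(3) by linarith
  qed
  with s(1) show ?thesis by blast
qed

text \<open>Equals (y - e) exp (- e / (y - e)) above \<open>e\<close> and 0 below. Scaling by
  \<open>e\<close> inside \<open>flat\<close> makes the slope (1 + t) exp (- t) with t = e / (y -
  e), which lies between 0 and 1 for every \<open>e\<close>.\<close>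

definition trunc :: "real \<Rightarrow> real \<Rightarrow> real" where
  "trunc e y = (y - e) * flat (\<lambda>_. 1) ((y - e) / e)"

definition trunc' :: "real \<Rightarrow> real \<Rightarrow> real" where
  "trunc' e y = (if y > e then exp (- (e / (y - e))) * (1 + e / (y - e)) else 0)"

lemma trunc_derivative:
  assumes "e > 0"
  shows "(trunc e has_real_derivative trunc' e y) (at y)"
proof -
  have f: "(flat (\<lambda>_. 1) has_real_derivative flat (\<lambda>y. y\<^sup>2 * (1 - 0)) z) (at z)" for z
    by (rule flat_derivative) (auto intro: real_polynomial_function.intros)
  have g: "((\<lambda>y. (y - e) / e) has_real_derivative 1 / e) (at y)"
    using assms by (auto intro!: derivative_eq_intros)
  have d: "((\<lambda>y. y - e) has_real_derivative 1) (at y)"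
    by (auto intro!: derivative_eq_intros)
  have "1 * flat (\<lambda>_. 1) ((y - e) / e) + flat (\<lambda>y. y\<^sup>2 * (1 - 0)) ((y - e) / e) * (1 / e) * (y - e) = trunc' e y"
  proof (cases "y > e")
    case True
    then obtain d where "y = d + e" "d > 0" by (metis add.commute diff_add_cancel diff_gt_0_iff_gt)
    then show ?thesis using assms by (simp add: trunc'_def flat_def field_simps power2_eq_square)
  qed (use assms in \<open>auto simp: trunc'_def flat_def zero_less_divide_iff\<close>)
  then have "((\<lambda>y. (y - e) * flat (\<lambda>_. 1) ((y - e) / e)) has_real_derivative trunc' e y) (at y)"
    using DERIV_mult[OF d DERIV_chain2[OF f g]] by simp
  then show ?thesis by (simp add: trunc_def[abs_def])
qed

lemma trunc'_bounds:
  assumes "e > 0"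
  shows "0 \<le> trunc' e y" "trunc' e y \<le> 1"
proof -
  have "exp (- t) * (1 + t) \<le> 1" for t :: real
    using exp_ge_add_one_self[of t] by (simp add: exp_minus field_simps)
  then show "trunc' e y \<le> 1" by (simp add: trunc'_def)
  show "0 \<le> trunc' e y" using assms by (simp add: trunc'_def)
qed

lemma trunc_eq: "e > 0 \<Longrightarrow> trunc e y = (if y > e then (y - e) * exp (- (e / (y - e))) else 0)"
  by (simp add: trunc_def flat_def zero_less_divide_iff)

lemma trunc_bounds:
  assumes "e > 0" "y \<ge> 0"
  shows "\<bar>trunc e y\<bar> \<le> y"
proof (cases "y > e")
  case True
  then have "\<bar>trunc e y\<bar> = (y - e) * exp (- (e / (y - e)))"
    using assms by (simp add: trunc_eq abs_mult)
  also have "\<dots> \<le> (y - e) * 1"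
    using True assms by (intro mult_left_mono) auto
  also have "\<dots> \<le> y" using assms by simp
  finally show ?thesis .
qed (use assms in \<open>simp add: trunc_eq\<close>)

lemma trunc_tendsto:
  assumes e: "\<And>n. e n > 0" "e \<longlonglongrightarrow> 0" and y: "y \<longlonglongrightarrow> l" "l > 0"
  shows "(\<lambda>n. trunc (e n) (y n)) \<longlonglongrightarrow> l" "(\<lambda>n. trunc' (e n) (y n)) \<longlonglongrightarrow> 1"
proof -
  have d: "(\<lambda>n. y n - e n) \<longlonglongrightarrow> l - 0" by (intro tendsto_intros e y)
  then have ev: "\<forall>\<^sub>F n in sequentially. y n > e n"
    using order_tendstoD(1)[OF d, of 0] y(2) by (auto elim: eventually_mono)
  have q: "(\<lambda>n. e n / (y n - e n)) \<longlonglongrightarrow> 0 / (l - 0)"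
    by (intro tendsto_divide d e) (use y in simp)
  have "(\<lambda>n. (y n - e n) * exp (- (e n / (y n - e n)))) \<longlonglongrightarrow> (l - 0) * exp (- (0 / (l - 0)))"
    by (intro tendsto_mult tendsto_exp tendsto_minus d q)
  then have "(\<lambda>n. (y n - e n) * exp (- (e n / (y n - e n)))) \<longlonglongrightarrow> l" by simp
  then show "(\<lambda>n. trunc (e n) (y n)) \<longlonglongrightarrow> l"
    by (rule Lim_transform_eventually) (use ev in \<open>eventually_elim, simp add: trunc_eq e\<close>)
  have "(\<lambda>n. exp (- (e n / (y n - e n))) * (1 + e n / (y n - e n))) \<longlonglongrightarrow> exp (- (0 / (l - 0))) * (1 + 0 / (l - 0))"
    by (intro tendsto_mult tendsto_add tendsto_const tendsto_exp tendsto_minus q)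
  then have "(\<lambda>n. exp (- (e n / (y n - e n))) * (1 + e n / (y n - e n))) \<longlonglongrightarrow> 1" by simp
  then show "(\<lambda>n. trunc' (e n) (y n)) \<longlonglongrightarrow> 1"
    by (rule Lim_transform_eventually) (use ev in \<open>eventually_elim, simp add: trunc'_def\<close>)
qed

text \<open>The function is arbitrary at the origin, so its value there is split off as a multiple
  of the indicator of a point.\<close>

lemma set_borel_measurable_punctured_ball:
  fixes h :: "'a::euclidean_space \<Rightarrow> 'b::euclidean_space"
  assumes "continuous_on (ball 0 1 - {0}) h"
  shows "set_borel_measurable lebesgue (ball 0 1) h"
proof -
  have "(\<lambda>x. indicator (ball 0 1 - {0}) x *\<^sub>R h x) \<in> borel_measurable borel"
    by (rule borel_measurable_continuous_on_indicator) (use assms in auto)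
  moreover have "(\<lambda>x::'a. indicator {0} x *\<^sub>R h 0) \<in> borel_measurable borel"
    by (intro borel_measurable_scaleR borel_measurable_indicator borel_measurable_const) auto
  ultimately have "(\<lambda>x::'a. indicator (ball 0 1 - {0}) x *\<^sub>R h x + indicator {0} x *\<^sub>R h 0) \<in> borel_measurable borel"
    by (rule borel_measurable_add)
  also have "(\<lambda>x. indicator (ball 0 1 - {0}) x *\<^sub>R h x + indicator {0} x *\<^sub>R h 0) = (\<lambda>x. indicator (ball 0 1) x *\<^sub>R h x)"
    by (auto simp: indicator_def)
  finally show ?thesis by (simp add: set_borel_measurable_def measurable_completion)
qed

text \<open>Here \<open>p r\<close> is - r U'(r). In the variable t = r^2 the function has
  derivative - p / (2 t), so it is approached by antiderivatives of - s_n^2, where s_n^2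
  approximates a regularization of p / (2 t). Composed with |x|^2, these polynomials are smooth at
  the origin, where U may be singular.\<close>

lemma H10_radial:
  fixes U p :: "real \<Rightarrow> real"
  assumes dim: "DIM('a::euclidean_space) \<ge> 3"
    and der: "\<And>r. 0 < r \<Longrightarrow> r < 1 \<Longrightarrow> (U has_real_derivative - p r / r) (at r)"
    and contU: "continuous_on {0<..1} U" and U1: "U 1 = 0"
    and Upos: "\<And>r. 0 < r \<Longrightarrow> r < 1 \<Longrightarrow> U r > 0"
    and contp: "continuous_on {0..1} p" and ppos: "\<And>r. r \<in> {0..1} \<Longrightarrow> p r \<ge> 0"
  shows "(\<lambda>x::'a. U (norm x)) \<in> H10 (ball 0 1)"
proof -
  obtain C where "\<forall>y\<in>p ` {0..1}. norm y \<le> C"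
    using compact_imp_bounded[OF compact_continuous_image[OF contp compact_Icc]]
    by (auto simp: bounded_iff)
  then have C: "p r \<le> C" if "r \<in> {0..1}" for r using that by (metis abs_le_D1 image_eqI real_norm_def)
  have C0: "C \<ge> 0" using C[of 0] ppos[of 0] by simp
  define e where "e = (\<lambda>n. inverse (real (Suc n)))"
  have e: "0 < e n" "e n \<le> 1" for n by (auto simp: e_def field_simps)
  have e0: "e \<longlonglongrightarrow> 0" unfolding e_def by (rule LIMSEQ_inverse_real_of_nat)
  \<comment> \<open>Replacing t by \<open>t + e n\<close> in the denominator makes the density
    continuous on [0,1], as polynomial approximation requires.\<close>
  define k where "k = (\<lambda>n t. p (sqrt t) / (2 * (t + e n)))"
  have "\<exists>s. real_polynomial_function s \<and> (\<forall>t\<in>{0..1}. \<bar>(s t)\<^sup>2 - k n t\<bar> < e n)" for n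
  proof (rule approximate_by_polynomial_square)
    have "2 * (t + e n) \<noteq> 0" if "t \<in> {0..1}" for t using that e(1)[of n] by auto
    then show "continuous_on {0..1} (k n)" unfolding k_def
      by (intro continuous_intros continuous_on_compose2[OF contp]) (auto simp del: mult_eq_0_iff)
    show "k n t \<ge> 0" if "t \<in> {0..1}" for t
      using that e(1)[of n] ppos[of "sqrt t"] by (simp add: k_def)
  qed (rule e)
  then obtain s where s: "\<And>n. real_polynomial_function (s n)"
    "\<And>n t. t \<in> {0..1} \<Longrightarrow> \<bar>(s n t)\<^sup>2 - k n t\<bar> < e n" by metis
  have "\<exists>P. real_polynomial_function P \<and> (\<forall>t. (P has_real_derivative - (s n t)\<^sup>2) (at t)) \<and> P 1 = 0" for n
  proof -
    have "real_polynomial_function (\<lambda>t. - (s n t)\<^sup>2)"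
      by (intro real_polynomial_function_minus real_polynomial_function_power s)
    then obtain F where F: "real_polynomial_function F" "\<forall>x. (F has_real_derivative - (s n x)\<^sup>2) (at x)"
      using polynomial_antiderivative by blast
    have "real_polynomial_function (\<lambda>t. F t - F 1)"
      by (intro real_polynomial_function_diff F real_polynomial_function.intros(2))
    moreover have "((\<lambda>t. F t - F 1) has_real_derivative - (s n t)\<^sup>2) (at t)" for t
      using F(2) by (auto intro!: derivative_eq_intros)
    ultimately show ?thesis by (intro exI[of _ "\<lambda>t. F t - F 1"]) auto
  qed
  then obtain P where P: "\<And>n. real_polynomial_function (P n)"
    "\<And>n t. (P n has_real_derivative - (s n t)\<^sup>2) (at t)" "\<And>n. P n 1 = 0" by metis
  have P_anti: "P n t \<ge> P n t'" if "t \<le> t'" for n t t'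
    by (rule DERIV_nonpos_imp_nonincreasing[OF that]) (use P(2) in fastforce)
  have s_le: "(s n t)\<^sup>2 \<le> C / (2 * t) + 1" if "t \<in> {0<..1}" for n t
  proof -
    have "k n t \<le> C / (2 * t)"
      unfolding k_def using that e(1)[of n] C[of "sqrt t"] C0 by (intro frac_le) auto
    then show ?thesis using s(2)[of t n] that e(2)[of n] by auto
  qed
  \<comment> \<open>P_n + (C / 2) ln t + t is nondecreasing and equals 1 at t = 1; then ln (1 / r)
    \<le> 1 / r turns the logarithmic bound into a power.\<close>
  have P_le: "P n (r\<^sup>2) \<le> (C + 2) / r" if r: "0 < r" "r < 1" for n r
  proof -
    define t0 where "t0 = r\<^sup>2"
    have t0: "0 < t0" "t0 \<le> 1" using r by (auto simp: t0_def power_le_one)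
    have "P n t0 + C / 2 * ln t0 + t0 \<le> P n 1 + C / 2 * ln 1 + 1"
    proof (rule DERIV_nonneg_imp_nondecreasing[OF t0(2)])
      fix t assume t: "t0 \<le> t" "t \<le> 1"
      then have "((\<lambda>t. P n t + C / 2 * ln t + t) has_real_derivative - (s n t)\<^sup>2 + C / 2 * (1 / t) + 1) (at t)"
        using t0 by (auto intro!: derivative_eq_intros P(2))
      moreover have "- (s n t)\<^sup>2 + C / 2 * (1 / t) + 1 \<ge> 0"
        using s_le[of t n] t t0 by (simp add: field_simps)
      ultimately show "\<exists>y. ((\<lambda>t. P n t + C / 2 * ln t + t) has_real_derivative y) (at t) \<and> 0 \<le> y" by blast
    qed
    moreover have "ln t0 = 2 * ln r" using r by (simp add: t0_def ln_realpow)
    ultimately have "P n t0 \<le> 1 - C * ln r" using P(3) t0(1) by simp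
    also have "\<dots> = 1 + C * ln (1 / r)" using r by (simp add: ln_div)
    also have "\<dots> \<le> 1 / r + C * (1 / r)"
      using r C0 ln_le_minus_one[of "1 / r"] by (intro add_mono mult_left_mono) auto
    also have "\<dots> \<le> (C + 2) / r" using r by (simp add: field_simps)
    finally show ?thesis by (simp add: t0_def)
  qed
  have s_lim: "(\<lambda>n. (s n (r\<^sup>2))\<^sup>2) \<longlonglongrightarrow> p r / (2 * r\<^sup>2)" if r: "0 < r" "r < 1" for r
  proof -
    have r2: "r\<^sup>2 \<in> {0..1}" using r by (auto simp: power_le_one)
    have "(\<lambda>n. (s n (r\<^sup>2))\<^sup>2 - k n (r\<^sup>2)) \<longlonglongrightarrow> 0"
      by (rule tendsto_rabs_zero_cancel, rule tendsto_sandwich[OF _ _ tendsto_const e0])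
        (use s(2)[OF r2] in \<open>auto intro!: always_eventually less_imp_le\<close>)
    moreover have "(\<lambda>n. k n (r\<^sup>2)) \<longlonglongrightarrow> p (sqrt (r\<^sup>2)) / (2 * (r\<^sup>2 + 0))"
      unfolding k_def by (intro tendsto_intros e0) (use r in auto)
    ultimately show ?thesis using tendsto_add r by fastforce
  qed
  \<comment> \<open>Both functions vanish at radius 1, so the mean value theorem reduces the claim
    to a bound of order \<open>e n\<close> for the derivative of their difference between r and
    1.\<close>
  have P_lim: "(\<lambda>n. P n (r\<^sup>2)) \<longlonglongrightarrow> U r" if r: "0 < r" "r < 1" for r
  proof -
    have "\<bar>P n (r\<^sup>2) - U r\<bar> \<le> (2 + C / r ^ 3) * e n" for n
    proof -
      have "\<exists>l z. r < z \<and> z < 1 \<and> ((\<lambda>\<rho>. P n (\<rho>\<^sup>2) - U \<rho>) has_real_derivative l) (at z) \<and>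
          (P n (1\<^sup>2) - U 1) - (P n (r\<^sup>2) - U r) = (1 - r) * l"
      proof (rule MVT[OF r(2)])
        have "continuous_on UNIV (P n)" using P(2)
          by (meson DERIV_isCont continuous_at_imp_continuous_on)
        then have "continuous_on {r..1} (\<lambda>\<rho>. P n (\<rho>\<^sup>2))"
          by (rule continuous_on_compose2) (auto intro: continuous_intros)
        moreover have "continuous_on {r..1} U"
          by (rule continuous_on_subset[OF contU]) (use r in auto)
        ultimately show "continuous_on {r..1} (\<lambda>\<rho>. P n (\<rho>\<^sup>2) - U \<rho>)"
          by (rule continuous_on_diff)
        show "(\<lambda>\<rho>. P n (\<rho>\<^sup>2) - U \<rho>) differentiable at z" if "r < z" "z < 1" for z
        proof -
          have "((\<lambda>\<rho>. P n (\<rho>\<^sup>2) - U \<rho>) has_real_derivative - (s n (z\<^sup>2))\<^sup>2 * (2 * z) - (- p z / z)) (at z)"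
            using that r by (auto intro!: derivative_eq_intros DERIV_chain2[OF P(2)] der)
          then show ?thesis using real_differentiable_def by blast
        qed
      qed
      then obtain l z where z: "r < z" "z < 1" "((\<lambda>\<rho>. P n (\<rho>\<^sup>2) - U \<rho>) has_real_derivative l) (at z)"
        "(P n (1\<^sup>2) - U 1) - (P n (r\<^sup>2) - U r) = (1 - r) * l" by blast
      have "((\<lambda>\<rho>. P n (\<rho>\<^sup>2) - U \<rho>) has_real_derivative - (s n (z\<^sup>2))\<^sup>2 * (2 * z) - (- p z / z)) (at z)"
        using z r by (auto intro!: derivative_eq_intros DERIV_chain2[OF P(2)] der)
      then have l: "l = p z / z - 2 * z * (s n (z\<^sup>2))\<^sup>2"
        using DERIV_unique[OF z(3)] by fastforce
      have z2: "z\<^sup>2 \<in> {0..1}" and z0: "z > 0" using z r by (auto simp: power_le_one)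
      have "2 * z * k n (z\<^sup>2) = 2 * (z * p z) / (2 * (z\<^sup>2 + e n))" using z0 by (simp add: k_def mult.assoc)
      also have "\<dots> = z * p z / (z\<^sup>2 + e n)" by (rule mult_divide_mult_cancel_left) simp
      finally have "2 * z * k n (z\<^sup>2) = z * p z / (z\<^sup>2 + e n)" .
      \<comment> \<open>The exact error of the regularized density; for z > r it is at most C e_n /
        r^3.\<close>
      moreover have "p z / z - z * p z / (z\<^sup>2 + e n) = p z * e n / (z * (z\<^sup>2 + e n))"
      proof -
        have "z\<^sup>2 + e n \<noteq> 0" using z0 e(1)[of n] by (simp add: add_pos_pos pos_add_strict less_imp_neq[symmetric])
        then show ?thesis using z0 by (simp add: field_simps power2_eq_square)
      qed
      ultimately have "l = p z * e n / (z * (z\<^sup>2 + e n)) - 2 * z * ((s n (z\<^sup>2))\<^sup>2 - k n (z\<^sup>2))"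
        unfolding l right_diff_distrib by linarith
      then have "\<bar>l\<bar> \<le> \<bar>p z * e n / (z * (z\<^sup>2 + e n))\<bar> + \<bar>2 * z * ((s n (z\<^sup>2))\<^sup>2 - k n (z\<^sup>2))\<bar>"
        by (simp only: abs_triangle_ineq4)
      also have "\<bar>p z * e n / (z * (z\<^sup>2 + e n))\<bar> \<le> C * e n / r ^ 3"
      proof -
        have "r ^ 3 \<le> z ^ 3" using z r by (intro power_mono) auto
        also have "\<dots> = z * z\<^sup>2" by (simp add: power2_eq_square power3_eq_cube)
        also have "\<dots> \<le> z * (z\<^sup>2 + e n)" using z0 e(1)[of n] by (intro mult_left_mono) auto
        finally have "p z * e n / (z * (z\<^sup>2 + e n)) \<le> C * e n / r ^ 3"
          using z r e(1)[of n] C[of z] C0 by (intro frac_le mult_right_mono) auto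
        then show ?thesis using ppos[of z] z r e(1)[of n] by simp
      qed
      also have "\<bar>2 * z * ((s n (z\<^sup>2))\<^sup>2 - k n (z\<^sup>2))\<bar> \<le> 2 * e n"
      proof -
        have "\<bar>2 * z * ((s n (z\<^sup>2))\<^sup>2 - k n (z\<^sup>2))\<bar> = 2 * z * \<bar>(s n (z\<^sup>2))\<^sup>2 - k n (z\<^sup>2)\<bar>"
          using z0 by (simp add: abs_mult)
        also have "\<dots> \<le> 2 * e n"
          using z0 z s(2)[OF z2, of n] by (intro mult_mono) auto
        finally show ?thesis .
      qed
      finally have "\<bar>l\<bar> \<le> (2 + C / r ^ 3) * e n" by (simp add: algebra_simps)
      moreover have "\<bar>P n (r\<^sup>2) - U r\<bar> = (1 - r) * \<bar>l\<bar>"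
      proof -
        have "P n (r\<^sup>2) - U r = - ((1 - r) * l)" using z(4) P(3)[of n] U1 by simp
        then show ?thesis using r by (simp add: abs_mult)
      qed
      moreover have "(1 - r) * \<bar>l\<bar> \<le> 1 * \<bar>l\<bar>" using r by (intro mult_right_mono) auto
      ultimately show ?thesis by linarith
    qed
    then have "(\<lambda>n. P n (r\<^sup>2) - U r) \<longlonglongrightarrow> 0"
      by (intro Lim_null_comparison[OF _ tendsto_mult_right_zero[OF e0, of "2 + C / r ^ 3"]]
          always_eventually allI) simp
    then show ?thesis by (simp add: LIM_zero_iff)
  qed
  define \<phi> where "\<phi> = (\<lambda>n (x::'a). trunc (e n) (P n ((norm x)\<^sup>2)))"
  have dphi: "(\<phi> n has_derivative (\<lambda>h. trunc' (e n) (P n ((norm x)\<^sup>2)) * (- (s n ((norm x)\<^sup>2))\<^sup>2) * (2 * (x \<bullet> h)))) (at x)" for n x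
  proof -
    have 1: "((\<lambda>y::'a. (norm y)\<^sup>2) has_derivative (\<lambda>h. 2 * (x \<bullet> h))) (at x)"
      unfolding power2_norm_eq_inner by (auto intro!: derivative_eq_intros simp: inner_commute)
    have 2: "((\<lambda>t. trunc (e n) (P n t)) has_real_derivative trunc' (e n) (P n t) * (- (s n t)\<^sup>2)) (at t)" for t
      by (rule DERIV_chain2[OF trunc_derivative[OF e(1)] P(2)])
    show ?thesis
      using has_derivative_compose[OF 1 2[unfolded has_field_derivative_def]] by (simp add: \<phi>_def)
  qed
  have gradphi: "grad (\<phi> n) x = (- 2 * trunc' (e n) (P n ((norm x)\<^sup>2)) * (s n ((norm x)\<^sup>2))\<^sup>2) *\<^sub>R x" for n x
  proof -
    have "grad (\<phi> n) x = (\<Sum>i\<in>Basis. ((- 2 * trunc' (e n) (P n ((norm x)\<^sup>2)) * (s n ((norm x)\<^sup>2))\<^sup>2) * (x \<bullet> i)) *\<^sub>R i)"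
      unfolding grad_def frechet_derivative_at[OF dphi, symmetric] by (simp add: mult.assoc mult.left_commute)
    also have "\<dots> = (- 2 * trunc' (e n) (P n ((norm x)\<^sup>2)) * (s n ((norm x)\<^sup>2))\<^sup>2) *\<^sub>R (\<Sum>i\<in>Basis. (x \<bullet> i) *\<^sub>R i)"
      by (simp only: scaleR_sum_right scaleR_scaleR)
    finally show ?thesis by (simp add: euclidean_representation)
  qed
  have test: "test_function (ball 0 1) (\<phi> n)" for n
    unfolding test_function_def
  proof (intro conjI allI)
    fix j
    have pol: "Ck_closure j UNIV (\<lambda>x::'a. P n ((norm x)\<^sup>2) - e n)"
      by (rule Ck_closure_UNIV_polynomial[of "\<lambda>t. P n t - e n"])
        (intro real_polynomial_function_diff P real_polynomial_function.intros(2) Ck_closure_UNIV_norm_squared)+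
    have sc: "Ck_closure j UNIV (\<lambda>x::'a. (P n ((norm x)\<^sup>2) - e n) * inverse (e n))"
      by (rule Ck_closure_UNIV_mult[OF pol Ck_closure_UNIV_const])
    have "Ck_closure j UNIV (\<lambda>x::'a. (P n ((norm x)\<^sup>2) - e n) * flat (\<lambda>_. 1) ((P n ((norm x)\<^sup>2) - e n) * inverse (e n)))"
      by (rule Ck_closure_UNIV_mult[OF pol Ck_closure_UNIV_flat[OF real_polynomial_function.intros(2) sc]])
    then show "Ck_closure j UNIV (\<phi> n)"
      by (simp add: \<phi>_def trunc_def divide_inverse)
  next
    let ?K = "{x::'a. P n ((norm x)\<^sup>2) \<ge> e n}"
    have cP: "continuous_on UNIV (\<lambda>x::'a. P n ((norm x)\<^sup>2))"
      by (rule continuous_on_compose2[of UNIV "P n"])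
        (use P(2) in \<open>auto intro!: continuous_intros continuous_at_imp_continuous_on DERIV_isCont\<close>)
    have "closed ?K" using closed_Collect_le[OF continuous_on_const cP] .
    moreover have "{x. \<phi> n x \<noteq> 0} \<subseteq> ?K" by (auto simp: \<phi>_def trunc_eq e(1))
    ultimately have sub: "closure {x. \<phi> n x \<noteq> 0} \<subseteq> ?K" by (simp add: closure_minimal)
    \<comment> \<open>\<open>P n\<close> is nonincreasing and vanishes at 1, so values as large as
      \<open>e n\<close> occur only inside the unit ball. Cutting off below \<open>e n\<close> thus
      produces compact support in the ball.\<close>
    have KB: "?K \<subseteq> ball 0 1"
    proof
      fix x assume "x \<in> ?K"
      then have "P n ((norm x)\<^sup>2) > P n 1" using e(1)[of n] P(3)[of n] by simp
      then have "\<not> 1 \<le> (norm x)\<^sup>2" using P_anti[of 1 "(norm x)\<^sup>2" n] by auto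
      then have "(norm x)\<^sup>2 < 1\<^sup>2" by simp
      then have "norm x < 1" by (rule power_less_imp_less_base) simp
      then show "x \<in> ball 0 1" by simp
    qed
    show "closure {x. \<phi> n x \<noteq> 0} \<subseteq> ball 0 1" using sub KB by (rule subset_trans)
    then have "bounded (closure {x. \<phi> n x \<noteq> 0})" using bounded_ball bounded_subset by blast
    then show "compact (closure {x. \<phi> n x \<noteq> 0})" by (simp add: compact_eq_bounded_closed)
  qed
  \<comment> \<open>Dominates the functions by \<open>P_le\<close> and the gradients by
    \<open>s_le\<close>. Its square is integrable because the dimension is at least 3.\<close>
  define D where "D = (\<lambda>x::'a. (C + 2) / norm x)"
  have int2: "set_integrable lebesgue (ball 0 1) (\<lambda>x::'a. (D x)\<^sup>2)"
    using set_integrable_mult_right[OF set_integrable_inverse_norm_squared[OF dim], of "(C + 2)\<^sup>2"]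
    by (simp add: D_def power_divide)
  have int1: "set_integrable lebesgue (ball 0 1) D"
  proof (rule set_integrable_bound)
    show "set_integrable lebesgue (ball 0 1) (\<lambda>x::'a. (C + 2) * (1 / (norm x)\<^sup>2))"
      by (rule set_integrable_mult_right[OF set_integrable_inverse_norm_squared[OF dim]])
    show "set_borel_measurable lebesgue (ball 0 1) D"
      by (rule set_borel_measurable_punctured_ball) (auto simp: D_def intro!: continuous_intros)
    have "norm (D x) \<le> norm ((C + 2) * (1 / (norm x)\<^sup>2))" if "x \<in> ball 0 1" for x
    proof (cases "x = 0")
      case False
      have "norm x * norm x \<le> norm x * 1" using that by (intro mult_left_mono) auto
      then have "(C + 2) / norm x \<le> (C + 2) / (norm x)\<^sup>2"
        using False C0 by (intro divide_left_mono) (auto simp: power2_eq_square)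
      then show ?thesis using C0 by (simp add: D_def)
    qed (simp add: D_def)
    then show "AE x in lebesgue. x \<in> ball 0 1 \<longrightarrow> norm (D x) \<le> norm ((C + 2) * (1 / (norm x)\<^sup>2))"
      by simp
  qed
  have *: "0 < norm x" "norm x < 1" "(norm x)\<^sup>2 \<in> {0<..1}" "0 \<le> P n ((norm x)\<^sup>2)" if "x \<in> ball 0 1 - {0}" for x :: 'a and n
    using that P_anti[of "(norm x)\<^sup>2" 1 n] P(3) by (auto simp: power_le_one)
  show ?thesis
  proof (rule H10_dominated_limit[where Z="{0}" and D=D and \<phi>=\<phi> and g="\<lambda>x. (- (p (norm x) / (norm x)\<^sup>2)) *\<^sub>R x"])
    show "ball 0 1 \<in> sets (lebesgue :: 'a measure)" by simp
    show "{0} \<in> null_sets (lebesgue :: 'a measure)" by (simp add: negligible_iff_null_sets[symmetric])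
    show "set_borel_measurable lebesgue (ball 0 1) (\<lambda>x::'a. U (norm x))"
      by (intro set_borel_measurable_punctured_ball continuous_on_compose2[OF contU] continuous_intros) auto
    show "set_borel_measurable lebesgue (ball 0 1) (\<lambda>x::'a. (- (p (norm x) / (norm x)\<^sup>2)) *\<^sub>R x)"
      by (intro set_borel_measurable_punctured_ball continuous_intros continuous_on_compose2[OF contp]) auto
    fix x :: 'a assume x: "x \<in> ball 0 1 - {0}"
    note x' = *[OF x]
    show "\<bar>\<phi> n x\<bar> \<le> D x" for n
      using trunc_bounds[OF e(1) x'(4), of n n] P_le[OF x'(1,2), of n] by (simp add: \<phi>_def D_def)
    show "norm (grad (\<phi> n) x) \<le> D x" for n
    proof -
      have "norm (grad (\<phi> n) x) = 2 * (trunc' (e n) (P n ((norm x)\<^sup>2)) * (s n ((norm x)\<^sup>2))\<^sup>2) * norm x"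
        using trunc'_bounds(1)[OF e(1)] by (simp add: gradphi abs_mult)
      also have "\<dots> \<le> 2 * (1 * (C / (2 * (norm x)\<^sup>2) + 1)) * norm x"
        using s_le[OF x'(3), of n] trunc'_bounds[OF e(1)] by (intro mult_right_mono mult_left_mono mult_mono) auto
      also have "\<dots> = C / norm x + 2 * norm x"
        using x'(1) by (simp add: field_simps power2_eq_square)
      also have "\<dots> \<le> D x"
      proof -
        have "norm x * norm x \<le> 1" using x'(3) by (simp add: power2_eq_square)
        then show ?thesis using x'(1) by (simp add: D_def field_simps)
      qed
      finally show ?thesis .
    qed
    have Ux: "U (norm x) > 0" using x' Upos by simp
    show "(\<lambda>n. \<phi> n x) \<longlonglongrightarrow> U (norm x)"
      unfolding \<phi>_def by (rule trunc_tendsto(1)[OF e(1) e0 P_lim[OF x'(1,2)] Ux])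
    have "(\<lambda>n. grad (\<phi> n) x) \<longlonglongrightarrow> (- 2 * 1 * (p (norm x) / (2 * (norm x)\<^sup>2))) *\<^sub>R x"
      unfolding gradphi by (intro tendsto_intros trunc_tendsto(2)[OF e(1) e0 P_lim[OF x'(1,2)] Ux] s_lim x')
    then show "(\<lambda>n. grad (\<phi> n) x) \<longlonglongrightarrow> (- (p (norm x) / (norm x)\<^sup>2)) *\<^sub>R x"
      by simp
  qed (use test int1 int2 in auto)
qed

subsection \<open>Calculus on \<open>(0,1]\<close>\<close>

text \<open>The differential inequalities for radial solutions are integrated in this form: a
  combination whose derivative has a sign is compared at two radii. Derivatives relative to (0,1]
  admit the end point 1, where they are one-sided.\<close>

lemma nondecreasing_from_derivative:
  fixes f :: "real \<Rightarrow> real"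
  assumes der: "\<And>r. r \<in> {0<..1} \<Longrightarrow> (f has_real_derivative f' r) (at r within {0<..1})"
    and nonneg: "\<And>r. s < r \<Longrightarrow> r < t \<Longrightarrow> f' r \<ge> 0"
    and st: "0 < s" "s \<le> t" "t \<le> 1"
  shows "f s \<le> f t"
proof (cases "s = t")
  case False
  then have "s < t" using st by simp
  have int: "(f has_real_derivative f' r) (at r)" if "s < r" "r < t" for r
    using der[of r] that st at_within_open_subset[of r "{0<..<1}" "{0<..1}"] by force
  have "continuous_on {0<..1} f"
    using der by (rule DERIV_continuous_on)
  then have "continuous_on {s..t} f" using st by (elim continuous_on_subset) auto
  moreover have "f differentiable (at r)" if "s < r" "r < t" for r
    using int[OF that] real_differentiable_def by blast
  ultimately obtain l z where z: "s < z" "z < t" "(f has_real_derivative l) (at z)" "f t - f s = (t - s) * l"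
    using MVT[OF \<open>s < t\<close>] by metis
  have "l = f' z" using DERIV_unique[OF z(3) int[OF z(1,2)]] .
  then have "(t - s) * l \<ge> 0" using nonneg z st by simp
  then show ?thesis using z(4) by linarith
qed simp

lemma le_of_tendsto_at_right:
  fixes f :: "real \<Rightarrow> real"
  assumes "(f \<longlongrightarrow> l) (at_right 0)" "\<And>s. 0 < s \<Longrightarrow> s < t \<Longrightarrow> f s \<le> c" "0 < t"
  shows "l \<le> c"
  using assms(1)
proof (rule tendsto_upperbound)
  show "\<forall>\<^sub>F s in at_right 0. f s \<le> c"
    using eventually_at_right_real[OF assms(3)] by eventually_elim (use assms(2) in auto)
qed simp

lemma ge_of_tendsto_at_right:
  fixes f :: "real \<Rightarrow> real"
  assumes "(f \<longlongrightarrow> l) (at_right 0)" "\<And>s. 0 < s \<Longrightarrow> s < t \<Longrightarrow> c \<le> f s" "0 < t"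
  shows "c \<le> l"
  using assms(1)
proof (rule tendsto_lowerbound)
  show "\<forall>\<^sub>F s in at_right 0. c \<le> f s"
    using eventually_at_right_real[OF assms(3)] by eventually_elim (use assms(2) in auto)
qed simp

lemma power_tendsto_0_at_right: "n > 0 \<Longrightarrow> ((\<lambda>t::real. c * t ^ n) \<longlongrightarrow> 0) (at_right 0)"
  by (auto intro!: tendsto_eq_intros)

text \<open>With w = exp (h / 2) the bound h / 2 \<le> w - 1 gives e^h - 1 - h \<ge> (w - 1)^2, and
  (w + 1)^2 \<le> 2 w^2 + 2 does the rest. Together with the next lemma this compares the potential
  energy with (e^h - 1)^2.\<close>

lemma exp_minus_id_lower: "(exp h - 1)\<^sup>2 / (2 * exp h + 2) \<le> exp h - 1 - h" for h :: real
proof -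
  define w where "w = exp (h / 2)"
  have w: "w > 0" "exp h = w\<^sup>2" by (auto simp: w_def exp_double[symmetric])
  have "h / 2 \<le> w - 1" using exp_ge_add_one_self[of "h / 2"] unfolding w_def by linarith
  then have "(w - 1)\<^sup>2 \<le> exp h - 1 - h" unfolding w(2) by (simp add: power2_eq_square algebra_simps)
  moreover have "(exp h - 1)\<^sup>2 / (2 * exp h + 2) \<le> (w - 1)\<^sup>2"
  proof -
    have "(w\<^sup>2 - 1)\<^sup>2 = (w - 1)\<^sup>2 * (w + 1)\<^sup>2" by (simp add: power2_eq_square algebra_simps)
    also have "\<dots> \<le> (w - 1)\<^sup>2 * (2 * w\<^sup>2 + 2)"
      using zero_le_power2[of "w - 1"] by (intro mult_left_mono) (auto simp: power2_eq_square algebra_simps)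
    finally show ?thesis unfolding w(2) using w(1) by (simp add: divide_le_eq add_nonneg_pos)
  qed
  ultimately show ?thesis by linarith
qed

lemma exp_minus_id_upper: "exp h - 1 - h \<le> (exp h - 1)\<^sup>2 / exp h" for h :: real
proof -
  have "- h \<le> exp (- h) - 1" using exp_ge_add_one_self[of "- h"] by simp
  moreover have "(exp h - 1)\<^sup>2 / exp h = exp h - 2 + exp (- h)"
    by (simp add: exp_minus power2_eq_square field_simps)
  ultimately show ?thesis by linarith
qed

lemma two_mult_le_squares: "\<bar>p * y\<bar> \<le> (p\<^sup>2 + y\<^sup>2) / 2" for p y :: real
  using zero_le_power2[of "\<bar>p\<bar> - \<bar>y\<bar>"] by (simp add: power2_eq_square algebra_simps abs_mult)

lemma powr_pred: "r > 0 \<Longrightarrow> r powr (c - 1) = r powr c / r" for r c :: real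
  by (simp add: powr_diff)

section \<open>Uniform limits and one-sided derivatives\<close>

text \<open>The limit is taken along the integers and does not involve \<open>\<delta>\<close>, so a
  single \<open>g\<close> serves all the intervals.\<close>

lemma uniform_limit_Cauchy_at_top:
  fixes f :: "real \<Rightarrow> real \<Rightarrow> real"
  assumes "\<And>\<delta>. 0 < \<delta> \<Longrightarrow> \<delta> \<le> 1 \<Longrightarrow> \<exists>D \<beta>0. (D \<longlongrightarrow> 0) at_top \<and>
     (\<forall>\<beta>1\<ge>\<beta>0. \<forall>\<beta>2\<ge>\<beta>1. \<forall>r\<in>{\<delta>..1}. \<bar>f \<beta>1 r - f \<beta>2 r\<bar> \<le> D \<beta>1)"
  shows "\<exists>g. \<forall>\<delta>. 0 < \<delta> \<longrightarrow> \<delta> \<le> 1 \<longrightarrow> uniform_limit {\<delta>..1} f g at_top"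
proof (intro exI allI impI)
  fix \<delta> :: real assume \<delta>: "0 < \<delta>" "\<delta> \<le> 1"
  obtain D \<beta>0 where D: "(D \<longlongrightarrow> 0) at_top"
    "\<And>\<beta>1 \<beta>2 r. \<beta>0 \<le> \<beta>1 \<Longrightarrow> \<beta>1 \<le> \<beta>2 \<Longrightarrow> r \<in> {\<delta>..1} \<Longrightarrow> \<bar>f \<beta>1 r - f \<beta>2 r\<bar> \<le> D \<beta>1"
    using assms[OF \<delta>] by blast
  let ?g = "\<lambda>r. lim (\<lambda>n. f (real n) r)"
  have conv: "(\<lambda>n. f (real n) r) \<longlonglongrightarrow> ?g r" if r: "r \<in> {\<delta>..1}" for r
  proof -
    have "Cauchy (\<lambda>n. f (real n) r)"
    proof (rule metric_CauchyI)
      fix e :: real assume "e > 0"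
      then have "\<forall>\<^sub>F \<beta> in at_top. dist (D \<beta>) 0 < e / 2 \<and> \<beta> \<ge> \<beta>0"
        by (intro eventually_conj tendstoD[OF D(1)] eventually_ge_at_top) simp
      then obtain b where b: "\<And>\<beta>. \<beta> \<ge> b \<Longrightarrow> dist (D \<beta>) 0 < e / 2 \<and> \<beta> \<ge> \<beta>0"
        by (auto simp: eventually_at_top_linorder)
      obtain n0 where n0: "b \<le> real n0" using real_arch_simple by blast
      show "\<exists>M. \<forall>m\<ge>M. \<forall>n\<ge>M. dist (f (real m) r) (f (real n) r) < e"
      proof (intro exI[of _ n0] allI impI)
        fix m n assume mn: "n0 \<le> m" "n0 \<le> n"
        have "\<bar>f (real n0) r - f (real k) r\<bar> < e / 2" if "n0 \<le> k" for k
          using D(2)[of "real n0" "real k" r] b[OF n0] that r by (auto simp: dist_real_def)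
        from this[OF mn(1)] this[OF mn(2)] show "dist (f (real m) r) (f (real n) r) < e"
          unfolding dist_real_def by argo
      qed
    qed
    then show ?thesis by (simp add: Cauchy_convergent_iff convergent_LIMSEQ_iff)
  qed
  have le: "\<bar>f \<beta> r - ?g r\<bar> \<le> D \<beta>" if "\<beta> \<ge> \<beta>0" "r \<in> {\<delta>..1}" for \<beta> r
  proof (rule LIMSEQ_le_const2)
    show "(\<lambda>n. \<bar>f \<beta> r - f (real n) r\<bar>) \<longlonglongrightarrow> \<bar>f \<beta> r - ?g r\<bar>"
      by (intro tendsto_intros conv that)
    obtain n0 where n0: "\<beta> \<le> real n0" using real_arch_simple by blast
    then show "\<exists>n0. \<forall>n\<ge>n0. \<bar>f \<beta> r - f (real n) r\<bar> \<le> D \<beta>"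
      using D(2)[of \<beta> _ r] that by (intro exI[of _ n0]) auto
  qed
  show "uniform_limit {\<delta>..1} f ?g at_top"
  proof (rule uniform_limitI)
    fix e :: real assume "e > 0"
    then have "\<forall>\<^sub>F \<beta> in at_top. dist (D \<beta>) 0 < e \<and> \<beta> \<ge> \<beta>0"
      by (intro eventually_conj tendstoD[OF D(1)] eventually_ge_at_top)
    then show "\<forall>\<^sub>F \<beta> in at_top. \<forall>r\<in>{\<delta>..1}. dist (f \<beta> r) (?g r) < e"
      by eventually_elim (use le in \<open>force simp: dist_real_def\<close>)
  qed
qed

text \<open>The derivatives converge uniformly only away from 0, so termwise differentiation is
  carried out on the convex set [r / 2, 1], which coincides with (0,1] near
  \<open>r\<close>.\<close>

lemma derivative_uniform_limit:
  fixes f f' :: "nat \<Rightarrow> real \<Rightarrow> real"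
  assumes der: "\<And>n r. r \<in> {0<..1} \<Longrightarrow> (f n has_real_derivative f' n r) (at r within {0<..1})"
    and lim: "\<And>r. r \<in> {0<..1} \<Longrightarrow> (\<lambda>n. f n r) \<longlonglongrightarrow> g r"
    and lim': "\<And>\<delta>. 0 < \<delta> \<Longrightarrow> \<delta> \<le> 1 \<Longrightarrow> uniform_limit {\<delta>..1} f' g' sequentially"
    and r: "r \<in> {0<..1}"
  shows "(g has_real_derivative g' r) (at r within {0<..1})"
proof -
  let ?S = "{r / 2..1}"
  have sub: "?S \<subseteq> {0<..1}" using r by auto
  have "\<exists>h. \<forall>x\<in>?S. (\<lambda>n. f n x) \<longlonglongrightarrow> h x \<and> (h has_derivative (\<lambda>k. g' x * k)) (at x within ?S)"
  proof (rule has_derivative_sequence)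
    show "(f n has_derivative (\<lambda>k. f' n x * k)) (at x within ?S)" if "x \<in> ?S" for n x
      using DERIV_subset[OF der sub] that sub by (auto simp: has_field_derivative_def)
    show "\<forall>\<^sub>F n in sequentially. \<forall>x\<in>?S. \<forall>k. norm (f' n x * k - g' x * k) \<le> e * norm k" if "e > 0" for e
    proof -
      have "\<forall>\<^sub>F n in sequentially. \<forall>x\<in>?S. dist (f' n x) (g' x) < e"
        using lim'[of "r / 2"] r that by (auto simp: uniform_limit_iff)
      then show ?thesis
      proof eventually_elim
        case (elim n)
        have "\<bar>f' n x * k - g' x * k\<bar> \<le> e * \<bar>k\<bar>" if "x \<in> ?S" for x k
        proof -
          have "\<bar>f' n x - g' x\<bar> * \<bar>k\<bar> \<le> e * \<bar>k\<bar>"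
            using elim that by (intro mult_right_mono) (auto simp: dist_real_def less_imp_le)
          then show ?thesis by (simp add: abs_mult[symmetric] left_diff_distrib)
        qed
        then show ?case by simp
      qed
    qed
    show "r \<in> ?S" using r by auto
    show "(\<lambda>n. f n r) \<longlonglongrightarrow> g r" by (rule lim[OF r])
  qed simp
  then obtain h where h: "\<And>x. x \<in> ?S \<Longrightarrow> (\<lambda>n. f n x) \<longlonglongrightarrow> h x"
    "\<And>x. x \<in> ?S \<Longrightarrow> (h has_derivative (\<lambda>k. g' x * k)) (at x within ?S)" by blast
  have hg: "h x = g x" if "x \<in> ?S" for x
    using LIMSEQ_unique[OF h(1)[OF that] lim[of x]] that sub by blast
  have rS: "r \<in> ?S" using r by auto
  have "(h has_real_derivative g' r) (at r within ?S)"
    using h(2)[OF rS] by (simp add: has_field_derivative_def)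
  then have "(g has_real_derivative g' r) (at r within ?S)"
    unfolding has_field_derivative_def by (rule has_derivative_transform[OF rS, rotated]) (use hg in simp)
  moreover have "at r within ?S = at r within {0<..1}"
    by (rule at_within_nhd[of _ "{r/2<..}"]) (use r in auto)
  ultimately show ?thesis by simp
qed

lemma exp_Lipschitz:
  fixes u v C :: real
  assumes "exp u \<le> C" "exp v \<le> C"
  shows "\<bar>exp u - exp v\<bar> \<le> C * \<bar>u - v\<bar>"
proof -
  have wlog: "\<bar>exp u - exp v\<bar> \<le> C * \<bar>u - v\<bar>" if uC: "exp u \<le> C" and vu: "v < u" for u v
  proof -
    obtain t where t: "v < t" "t < u" "exp u - exp v = (u - v) * exp t"
      using MVT2[OF vu, of exp exp] DERIV_exp by blast
    have "exp t \<le> exp u" using t by simp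
    also have "\<dots> \<le> C" by (rule uC)
    finally have "exp t * \<bar>u - v\<bar> \<le> C * \<bar>u - v\<bar>" by (rule mult_right_mono) simp
    then show ?thesis unfolding t(3) by (simp add: abs_mult mult.commute)
  qed
  consider "v < u" | "u < v" | "u = v" by linarith
  then show ?thesis
  proof cases
    case 2
    then show ?thesis using wlog[OF assms(2) 2] by (simp only: abs_minus_commute)
  qed (use wlog assms in auto)
qed

lemma rderiv_eq:
  assumes "(f has_real_derivative d) (at r within S)" "at r within S \<noteq> bot"
  shows "rderiv S f r = d"
  using assms by (simp add: rderiv_def vector_derivative_within has_real_derivative_iff_has_vector_derivative)

lemma at_within_Icc_neq_bot: "r \<in> {0..1} \<Longrightarrow> at r within {0..1::real} \<noteq> bot"
  by (simp add: trivial_limit_within islimpt_Icc)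

lemma at_within_Ioc_neq_bot: "r \<in> {0<..1} \<Longrightarrow> at r within {0<..1::real} \<noteq> bot"
  by (simp add: trivial_limit_within islimpt_Ioc)

lemma differentiable_on_rderiv:
  assumes "f differentiable_on S" "r \<in> S" "at r within S \<noteq> bot"
  shows "(f has_real_derivative rderiv S f r) (at r within S)"
proof -
  have "f differentiable (at r within S)" using assms(1,2) by (simp add: differentiable_on_def)
  then have "(f has_vector_derivative vector_derivative f (at r within S)) (at r within S)"
    by (simp add: vector_derivative_works)
  then show ?thesis by (simp add: rderiv_def has_real_derivative_iff_has_vector_derivative)
qed

text \<open>\<open>rderiv S f\<close> agrees with \<open>f'\<close> on \<open>S\<close> only, so the
  second derivative has to be transferred along this equality.\<close>

lemma C2_onI:
  assumes "\<And>r. r \<in> S \<Longrightarrow> at r within S \<noteq> bot"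
    and "\<And>r. r \<in> S \<Longrightarrow> (f has_real_derivative f' r) (at r within S)"
    and "\<And>r. r \<in> S \<Longrightarrow> (f' has_real_derivative f'' r) (at r within S)"
    and "continuous_on S f''"
  shows "C2_on S f" "\<And>r. r \<in> S \<Longrightarrow> rderiv S f r = f' r" "\<And>r. r \<in> S \<Longrightarrow> rderiv S (rderiv S f) r = f'' r"
proof -
  show 1: "rderiv S f r = f' r" if "r \<in> S" for r using rderiv_eq assms that by blast
  have 2: "(rderiv S f has_real_derivative f'' r) (at r within S)" if "r \<in> S" for r
    unfolding has_field_derivative_def
    by (rule has_derivative_transform[OF that _ assms(3)[OF that, unfolded has_field_derivative_def]]) (rule 1)
  show 3: "rderiv S (rderiv S f) r = f'' r" if "r \<in> S" for r
    using rderiv_eq[OF 2 assms(1)] that by blast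
  have "f differentiable_on S" "rderiv S f differentiable_on S"
    unfolding differentiable_on_def using assms(2) 2 real_differentiable_def
    by (meson differentiable_def has_field_derivative_imp_has_derivative)+
  moreover have "continuous_on S (rderiv S (rderiv S f))"
    using assms(4) by (rule continuous_on_eq) (simp add: 3)
  ultimately show "C2_on S f" by (simp add: C2_on_def)
qed

subsection \<open>Radial solutions in Emden-Fowler variables\<close>

text \<open>What is retained of the regularity of \<open>a\<close>: continuity, two positive bounds
  and |a - 1| \<le> L r. The last one makes the system an O(r) perturbation of the autonomous
  one.\<close>

locale radial_weight =
  fixes N :: nat and a :: "real \<Rightarrow> real" and a0 A L :: real
  assumes N3: "3 \<le> N" and cont_a: "continuous_on {0..1} a"
    and a0_pos: "0 < a0" and a0_le: "r \<in> {0..1} \<Longrightarrow> a0 \<le> a r"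
    and a_le: "r \<in> {0..1} \<Longrightarrow> a r \<le> A"
    and L_nonneg: "0 \<le> L" and lip: "r \<in> {0..1} \<Longrightarrow> \<bar>a r - 1\<bar> \<le> L * r"
begin

definition m :: real where "m = real N - 2"

lemma m_ge_1: "m \<ge> 1" using N3 by (simp add: m_def)

lemma m_neq_0 [simp]: "m \<noteq> 0" using m_ge_1 by linarith

lemma A_pos: "A > 0" using a0_pos a0_le[of 0] a_le[of 0] by simp

text \<open>Regular and singular solutions both take this form: V = U + ln l absorbs the parameter
  into the solution. As a first order system for the pair, the equation passes to limits of V and
  W.\<close>

definition profile :: "(real \<Rightarrow> real) \<Rightarrow> (real \<Rightarrow> real) \<Rightarrow> bool" where
  "profile V W \<longleftrightarrow> (\<forall>r\<in>{0<..1}.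
     (V has_real_derivative W r) (at r within {0<..1}) \<and>
     (W has_real_derivative - (a r * exp (V r)) - (real N - 1) / r * W r) (at r within {0<..1}))"

text \<open>Absence of a point source at the origin; it excludes the behaviour r^(2-N) of the
  fundamental solution.\<close>

definition no_flux :: "(real \<Rightarrow> real) \<Rightarrow> bool" where
  "no_flux W \<longleftrightarrow> ((\<lambda>r. r ^ (N - 1) * W r) \<longlongrightarrow> 0) (at_right 0)"

lemma profileD:
  assumes "profile V W" "r \<in> {0<..1}"
  shows "(V has_real_derivative W r) (at r within {0<..1})"
    "(W has_real_derivative - (a r * exp (V r)) - (real N - 1) / r * W r) (at r within {0<..1})"
  using assms by (auto simp: profile_def)

lemma power_N_minus_1: "r ^ (N - 1) = r * r ^ (N - 2)" and power_N: "r ^ N = r * r ^ (N - 1)" for r :: real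
  using N3 by (simp_all add: power_Suc[symmetric] Suc_diff_Suc numeral_2_eq_2)

lemma power_N_minus_1_derivative:
  "((\<lambda>r. r ^ (N - 1)) has_real_derivative (real N - 1) * r ^ (N - 2)) (at r within S)"
  using N3 by (auto intro!: derivative_eq_intros simp: numeral_2_eq_2 of_nat_diff)

lemma flux_derivative:
  assumes "profile V W" "r \<in> {0<..1}"
  shows "((\<lambda>r. r ^ (N - 1) * W r) has_real_derivative - (r ^ (N - 1) * (a r * exp (V r)))) (at r within {0<..1})"
proof -
  have r: "r > 0" using assms(2) by simp
  have "((\<lambda>r. r ^ (N - 1) * W r) has_real_derivative
     (real N - 1) * r ^ (N - 2) * W r + (- (a r * exp (V r)) - (real N - 1) / r * W r) * r ^ (N - 1)) (at r within {0<..1})"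
    by (rule DERIV_mult[OF power_N_minus_1_derivative profileD(2)[OF assms]])
  moreover have "(real N - 1) * r ^ (N - 2) * W r + (- (a r * exp (V r)) - (real N - 1) / r * W r) * r ^ (N - 1)
     = - (r ^ (N - 1) * (a r * exp (V r)))"
    using r unfolding power_N_minus_1 by (simp add: field_simps)
  ultimately show ?thesis by simp
qed

lemma flux_antimono:
  assumes pr: "profile V W" and st: "0 < s" "s \<le> t" "t \<le> 1"
  shows "t ^ (N - 1) * W t \<le> s ^ (N - 1) * W s"
proof -
  have "- (s ^ (N - 1) * W s) \<le> - (t ^ (N - 1) * W t)"
  proof (rule nondecreasing_from_derivative[where f="\<lambda>r. - (r ^ (N - 1) * W r)"])
    show "((\<lambda>r. - (r ^ (N - 1) * W r)) has_real_derivative - (- (r ^ (N - 1) * (a r * exp (V r))))) (at r within {0<..1})"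
      if "r \<in> {0<..1}" for r
      by (rule DERIV_minus[OF flux_derivative[OF pr that]])
    show "- (- (r ^ (N - 1) * (a r * exp (V r)))) \<ge> 0" if "s < r" "r < t" for r
      using that st a0_pos a0_le[of r] by simp
  qed (use st in auto)
  then show ?thesis by simp
qed

lemma flux_nonpos:
  assumes "profile V W" "no_flux W" "r \<in> {0<..1}"
  shows "W r \<le> 0"
proof -
  have "r ^ (N - 1) * W r \<le> 0"
    by (rule ge_of_tendsto_at_right[OF assms(2)[unfolded no_flux_def], of r], rule flux_antimono[OF assms(1)])
      (use assms(3) in auto)
  moreover have "r ^ (N - 1) > 0" using assms(3) by simp
  ultimately show ?thesis by (meson mult_le_0_iff not_le)
qed

lemma profile_decreasing:
  assumes "profile V W" "\<And>r. s < r \<Longrightarrow> r < t \<Longrightarrow> W r \<le> 0" "0 < s" "s \<le> t" "t \<le> 1"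
  shows "V t \<le> V s"
proof -
  have "- V s \<le> - V t"
    by (rule nondecreasing_from_derivative[where f="\<lambda>r. - V r" and f'="\<lambda>r. - W r"])
      (use assms in \<open>auto intro!: DERIV_minus profileD(1)\<close>)
  then show ?thesis by simp
qed

definition M :: real where "M = 2 * real N / a0"

lemma M_pos: "M > 0" using a0_pos N3 by (simp add: M_def)

text \<open>V decreases, so the source on (0,r) is at least a0 e^V(r), and the flux identity is
  integrated with this constant. The sign of W is assumed instead of \<open>no_flux\<close> because
  the bound is used while \<open>no_flux\<close> is still being proved for singular
  solutions.\<close>

lemma derivative_upper_bound:
  assumes pr: "profile V W" and neg: "\<And>r. r \<in> {0<..1} \<Longrightarrow> W r \<le> 0" and r: "r \<in> {0<..1}"
  shows "W r \<le> - (exp (V r) * a0 / real N * r)"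
proof -
  define H where "H = (\<lambda>t. t ^ (N - 1) * W t + exp (V r) * a0 / real N * t ^ N)"
  have dH: "(H has_real_derivative - (t ^ (N - 1) * (a t * exp (V t))) + exp (V r) * a0 * t ^ (N - 1)) (at t within {0<..1})"
    if "t \<in> {0<..1}" for t
  proof -
    have "((\<lambda>t. exp (V r) * a0 / real N * t ^ N) has_real_derivative exp (V r) * a0 * t ^ (N - 1)) (at t within {0<..1})"
      using N3 by (auto intro!: derivative_eq_intros)
    then show ?thesis unfolding H_def by (intro DERIV_add flux_derivative[OF pr that])
  qed
  have "- H s \<le> - H r" if s: "0 < s" "s < r" for s
  proof (rule nondecreasing_from_derivative[where f="\<lambda>t. - H t"])
    show "((\<lambda>t. - H t) has_real_derivative - (- (t ^ (N - 1) * (a t * exp (V t))) + exp (V r) * a0 * t ^ (N - 1))) (at t within {0<..1})"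
      if "t \<in> {0<..1}" for t
      by (rule DERIV_minus[OF dH[OF that]])
    show "- (- (t ^ (N - 1) * (a t * exp (V t))) + exp (V r) * a0 * t ^ (N - 1)) \<ge> 0" if t: "s < t" "t < r" for t
    proof -
      have "V r \<le> V t"
        by (rule profile_decreasing[OF pr]) (use neg t s r in auto)
      then have "a0 * exp (V r) \<le> a t * exp (V t)"
        using a0_le[of t] a0_pos t s r by (intro mult_mono) auto
      then have "t ^ (N - 1) * (a0 * exp (V r)) \<le> t ^ (N - 1) * (a t * exp (V t))"
        using t s by (intro mult_left_mono) auto
      then show ?thesis by (simp add: mult_ac)
    qed
  qed (use s r in auto)
  then have Hs: "H r \<le> exp (V r) * a0 / real N * s ^ N" if s: "0 < s" "s < r" for s
  proof -
    have "H r \<le> H s" using \<open>\<And>s. 0 < s \<Longrightarrow> s < r \<Longrightarrow> - H s \<le> - H r\<close>[OF s] by simp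
    moreover have "s ^ (N - 1) * W s \<le> 0"
      using s r neg[of s] by (auto intro!: mult_nonneg_nonpos)
    ultimately show ?thesis by (simp add: H_def)
  qed
  have "H r \<le> 0"
    by (rule ge_of_tendsto_at_right[OF power_tendsto_0_at_right Hs]) (use N3 r in auto)
  then have "r ^ (N - 1) * (W r + exp (V r) * a0 / real N * r) \<le> 0"
    unfolding H_def power_N by (simp add: algebra_simps)
  moreover have "r ^ (N - 1) > 0" using r by simp
  ultimately have "W r + exp (V r) * a0 / real N * r \<le> 0"
    by (meson mult_le_0_iff not_le)
  then show ?thesis by simp
qed

text \<open>By the preceding bound (e^(-V))' \<ge> a0 r / N, hence e^(-V) \<ge> a0 r^2 / (2 N),
  whatever happens at the origin.\<close>

lemma exp_upper_bound:
  assumes pr: "profile V W" and neg: "\<And>r. r \<in> {0<..1} \<Longrightarrow> W r \<le> 0" and r: "r \<in> {0<..1}"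
  shows "r\<^sup>2 * exp (V r) \<le> M"
proof -
  define K where "K = (\<lambda>t. exp (- V t) - a0 / (2 * real N) * t ^ 2)"
  have dK: "(K has_real_derivative exp (- V t) * (- W t) - a0 / real N * t) (at t within {0<..1})"
    if "t \<in> {0<..1}" for t
    unfolding K_def by (rule derivative_eq_intros profileD(1)[OF pr that] refl | simp)+
  have "K s \<le> K r" if s: "0 < s" "s < r" for s
  proof (rule nondecreasing_from_derivative[OF dK])
    fix t assume t: "s < t" "t < r"
    have "exp (- V t) * (exp (V t) * a0 / real N * t) \<le> exp (- V t) * (- W t)"
      using derivative_upper_bound[OF pr neg, of t] t s r by (intro mult_left_mono) auto
    moreover have "exp (- V t) * (exp (V t) * a0 / real N * t) = a0 / real N * t"
    proof -
      have "exp (- V t) * (exp (V t) * a0 / real N * t) = (exp (- V t) * exp (V t)) * (a0 / real N * t)"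
        by simp
      then show ?thesis by (simp add: exp_minus)
    qed
    ultimately show "exp (- V t) * (- W t) - a0 / real N * t \<ge> 0" by linarith
  qed (use s r in auto)
  then have Ks: "(- (a0 / (2 * real N))) * s ^ 2 \<le> K r" if "0 < s" "s < r" for s
    using that exp_gt_zero[of "- V s"] unfolding K_def by (smt (verit, best) mult_minus_left)
  have "0 \<le> K r"
    by (rule le_of_tendsto_at_right[OF power_tendsto_0_at_right Ks]) (use r in auto)
  then have "a0 / (2 * real N) * r ^ 2 \<le> exp (- V r)" by (simp add: K_def)
  then have "a0 / (2 * real N) * r ^ 2 * exp (V r) \<le> 1"
    by (simp add: exp_minus field_simps)
  then show ?thesis using a0_pos N3 by (simp add: M_def field_simps)
qed

text \<open>The source a e^V is at most A b / t^2, so the flux at r is at most A b times the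
  integral of t^(N-3) over (0,r), which is r^(N-2) / m. The bound \<open>b\<close> is first taken to
  be \<open>M\<close>; \<open>singular_bounded_energy\<close> inserts smaller ones.\<close>

lemma derivative_lower_bound:
  assumes pr: "profile V W" "no_flux W" and R: "R \<le> 1" and b: "\<And>t. 0 < t \<Longrightarrow> t \<le> R \<Longrightarrow> t\<^sup>2 * exp (V t) \<le> b"
    and r: "0 < r" "r \<le> R"
  shows "- r * W r \<le> A * b / m"
proof -
  have e: "t ^ (N - 2) = t * t ^ (N - 3)" "t ^ (N - 1) = t\<^sup>2 * t ^ (N - 3)" for t :: real
  proof -
    obtain k where "N = k + 3" using N3 by (metis le_add_diff_inverse2)
    then show "t ^ (N - 2) = t * t ^ (N - 3)" "t ^ (N - 1) = t\<^sup>2 * t ^ (N - 3)"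
      by (simp_all add: power_add eval_nat_numeral)
  qed
  define G where "G = (\<lambda>t. t ^ (N - 1) * W t + A * b / m * t ^ (N - 2))"
  have dG: "(G has_real_derivative - (t ^ (N - 1) * (a t * exp (V t))) + A * b * t ^ (N - 3)) (at t within {0<..1})"
    if "t \<in> {0<..1}" for t
  proof -
    have "((\<lambda>t. A * b / m * t ^ (N - 2)) has_real_derivative A * b / m * (real (N - 2) * t ^ (N - 3))) (at t within {0<..1})"
      by (auto intro!: derivative_eq_intros simp: numeral_3_eq_3 numeral_2_eq_2)
    moreover have "real (N - 2) = m" using N3 by (simp add: m_def of_nat_diff)
    ultimately have "((\<lambda>t. A * b / m * t ^ (N - 2)) has_real_derivative A * b * t ^ (N - 3)) (at t within {0<..1})"
      by (simp add: mult.assoc)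
    then show ?thesis unfolding G_def by (intro DERIV_add flux_derivative[OF pr(1) that])
  qed
  have "G s \<le> G r" if s: "0 < s" "s < r" for s
  proof (rule nondecreasing_from_derivative[OF dG])
    fix t assume t: "s < t" "t < r"
    have "a t * (t\<^sup>2 * exp (V t)) \<le> A * b"
      using a_le[of t] b[of t] A_pos t s r R by (intro mult_mono) auto
    then have "t ^ (N - 3) * (a t * (t\<^sup>2 * exp (V t))) \<le> t ^ (N - 3) * (A * b)"
      using t s by (intro mult_left_mono) auto
    then show "- (t ^ (N - 1) * (a t * exp (V t))) + A * b * t ^ (N - 3) \<ge> 0"
      unfolding e by (simp add: mult_ac)
  qed (use s r R in auto)
  moreover have "(G \<longlongrightarrow> 0 + 0) (at_right 0)"
    unfolding G_def using pr(2)[unfolded no_flux_def] N3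
    by (intro tendsto_add power_tendsto_0_at_right) auto
  ultimately have "0 \<le> G r"
    using le_of_tendsto_at_right[of G 0 r "G r"] r by simp
  then have "0 \<le> r ^ (N - 2) * (r * W r + A * b / m)"
    unfolding G_def e by (simp add: algebra_simps power2_eq_square)
  moreover have "r ^ (N - 2) > 0" using r by simp
  ultimately have "0 \<le> r * W r + A * b / m"
    by (meson zero_le_mult_iff not_le)
  then show ?thesis by simp
qed

text \<open>
  Along a solution \<open>V\<close> put \<open>s = ln r\<close>. Then \<open>eta\<close> is the deviation of \<open>V\<close> from the explicit singular
  solution \<open>- 2 ln r + ln (2 (N - 2))\<close> of the equation with \<open>a = 1\<close>, and \<open>slope\<close> is \<open>- d eta / ds\<close>.
\<close>

definition eta :: "(real \<Rightarrow> real) \<Rightarrow> real \<Rightarrow> real" where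
  "eta V r = V r + 2 * ln r - ln (2 * m)"

definition slope :: "(real \<Rightarrow> real) \<Rightarrow> real \<Rightarrow> real" where
  "slope W r = - r * W r - 2"

lemma exp_eta: "r > 0 \<Longrightarrow> 2 * m * exp (eta V r) = r\<^sup>2 * exp (V r)"
  using m_ge_1 by (simp add: eta_def exp_add exp_diff exp_double)

lemma eta_derivative:
  assumes "profile V W" "r \<in> {0<..1}"
  shows "(eta V has_real_derivative - slope W r / r) (at r within {0<..1})"
proof -
  have "((\<lambda>r. V r + 2 * ln r - ln (2 * m)) has_real_derivative W r + 2 * (1 / r)) (at r within {0<..1})"
    using assms(2) by (auto intro!: derivative_eq_intros profileD(1)[OF assms])
  moreover have "W r + 2 * (1 / r) = - slope W r / r"
    using assms(2) by (simp add: slope_def field_simps)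
  ultimately show ?thesis by (simp add: eta_def[abs_def])
qed

lemma slope_derivative:
  assumes "profile V W" "r \<in> {0<..1}"
  shows "(slope W has_real_derivative (- m * slope W r + 2 * m * (a r * exp (eta V r) - 1)) / r) (at r within {0<..1})"
proof -
  have r: "r > 0" using assms(2) by simp
  have "((\<lambda>r. - r * W r - 2) has_real_derivative
     - W r - r * (- (a r * exp (V r)) - (real N - 1) / r * W r)) (at r within {0<..1})"
    by (rule derivative_eq_intros profileD(2)[OF assms] refl | simp)+
  moreover have "- W r - r * (- (a r * exp (V r)) - (real N - 1) / r * W r) =
     (- m * slope W r + a r * (2 * m * exp (eta V r)) - 2 * m) / r"
    unfolding exp_eta[OF r] using r by (simp add: slope_def m_def field_simps power2_eq_square)
  ultimately show ?thesis by (simp add: slope_def[abs_def] algebra_simps)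
qed

text \<open>\<open>X\<close> bounds exp (eta) and \<open>B\<close> bounds |slope|, for all profiles
  without flux at once.\<close>

definition B :: real where "B = A * M / m + 2"
definition X :: real where "X = M / (2 * m)"

lemma B_pos: "B > 0" using A_pos M_pos m_ge_1 by (simp add: B_def add_pos_pos)
lemma X_pos: "X > 0" using M_pos m_ge_1 by (simp add: X_def)

lemma a_priori:
  assumes pr: "profile V W" "no_flux W" and r: "r \<in> {0<..1}"
  shows "exp (eta V r) \<le> X" "\<bar>slope W r\<bar> \<le> B"
proof -
  note neg = flux_nonpos[OF pr]
  have "2 * m * exp (eta V r) \<le> M"
    using exp_upper_bound[OF pr(1) neg r] exp_eta[of r V] r by simp
  then show "exp (eta V r) \<le> X"
    using m_ge_1 by (simp add: X_def field_simps)
  have "- r * W r \<le> A * M / m"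
    by (rule derivative_lower_bound[OF pr order_refl]) (use exp_upper_bound[OF pr(1) neg] r in auto)
  moreover have "r * W r \<le> 0" using neg[OF r] r by (simp add: mult_nonneg_nonpos)
  moreover have "A * M / m \<ge> 0" using A_pos M_pos m_ge_1 by simp
  ultimately show "\<bar>slope W r\<bar> \<le> B"
    unfolding slope_def B_def by linarith
qed

section \<open>The energy and its growth\<close>

definition energy :: "(real \<Rightarrow> real) \<Rightarrow> (real \<Rightarrow> real) \<Rightarrow> real \<Rightarrow> real" where
  "energy V W r = (slope W r)\<^sup>2 / 2 + 2 * m * (exp (eta V r) - 1 - eta V r)"

lemma energy_derivative:
  assumes pr: "profile V W" and r: "r \<in> {0<..1}"
  shows "(energy V W has_real_derivative
    (- m * (slope W r)\<^sup>2 + 2 * m * (a r - 1) * exp (eta V r) * slope W r) / r) (at r within {0<..1})"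
proof -
  have "(energy V W has_real_derivative
     slope W r * ((- m * slope W r + 2 * m * (a r * exp (eta V r) - 1)) / r)
     + 2 * m * (exp (eta V r) * (- slope W r / r) - (- slope W r / r))) (at r within {0<..1})"
    unfolding energy_def[abs_def]
    by (rule derivative_eq_intros slope_derivative[OF pr r] eta_derivative[OF pr r] refl | simp)+
  moreover have "slope W r * ((- m * slope W r + 2 * m * (a r * exp (eta V r) - 1)) / r)
     + 2 * m * (exp (eta V r) * (- slope W r / r) - (- slope W r / r))
     = (- m * (slope W r)\<^sup>2 + 2 * m * (a r - 1) * exp (eta V r) * slope W r) / r"
    using r by (simp add: field_simps power2_eq_square)
  ultimately show ?thesis by simp
qed

lemma perturbation_bound:
  assumes "r \<in> {0<..1}" "exp h \<le> X" "\<bar>s\<bar> \<le> b"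
  shows "\<bar>2 * m * (a r - 1) * exp h * s\<bar> \<le> M * L * b * r"
proof -
  have b: "b \<ge> 0" using assms(3) by simp
  have "2 * m * exp h \<le> M" using assms(2) m_ge_1 by (simp add: X_def field_simps)
  then have "(2 * m * exp h) * \<bar>a r - 1\<bar> * \<bar>s\<bar> \<le> M * (L * r) * b"
    using lip[of r] assms M_pos L_nonneg m_ge_1 by (intro mult_mono) auto
  moreover have "\<bar>2 * m * (a r - 1) * exp h * s\<bar> = (2 * m * exp h) * \<bar>a r - 1\<bar> * \<bar>s\<bar>"
    using m_ge_1 by (simp add: abs_mult)
  ultimately show ?thesis by (simp add: mult_ac)
qed

definition C1 :: real where "C1 = M * L * B"

lemma C1_nonneg: "C1 \<ge> 0" using M_pos L_nonneg B_pos by (simp add: C1_def)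

text \<open>The perturbation raises the energy by at most \<open>C1\<close> r per unit of ln r,
  hence by at most \<open>C1\<close> on all of (0,1]. Energy bounds therefore propagate outwards
  from any radius.\<close>

lemma energy_growth:
  assumes pr: "profile V W" "no_flux W" and st: "0 < s" "s \<le> t" "t \<le> 1"
  shows "energy V W t \<le> energy V W s + C1"
proof -
  have "C1 * s - energy V W s \<le> C1 * t - energy V W t"
  proof (rule nondecreasing_from_derivative[OF _ _ st, where f="\<lambda>r. C1 * r - energy V W r"])
    show "((\<lambda>r. C1 * r - energy V W r) has_real_derivative C1 -
      (- m * (slope W r)\<^sup>2 + 2 * m * (a r - 1) * exp (eta V r) * slope W r) / r) (at r within {0<..1})"
      if "r \<in> {0<..1}" for r
      by (rule derivative_eq_intros energy_derivative[OF pr(1) that] refl | simp)+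
    fix r assume "s < r" "r < t"
    then have r: "r \<in> {0<..1}" using st by auto
    have "2 * m * (a r - 1) * exp (eta V r) * slope W r \<le> C1 * r"
      using perturbation_bound[OF r a_priori[OF pr r]] by (simp add: C1_def)
    moreover have "m * (slope W r)\<^sup>2 \<ge> 0" using m_ge_1 by simp
    ultimately have "(- m * (slope W r)\<^sup>2 + 2 * m * (a r - 1) * exp (eta V r) * slope W r) / r \<le> (C1 * r) / r"
      using r by (intro divide_right_mono) auto
    then show "C1 - (- m * (slope W r)\<^sup>2 + 2 * m * (a r - 1) * exp (eta V r) * slope W r) / r \<ge> 0"
      using r by simp
  qed
  moreover have "C1 * t \<le> C1 * 1" "0 \<le> C1 * s" using C1_nonneg st by (intro mult_left_mono mult_nonneg_nonneg; simp)+
  ultimately show ?thesis by linarith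
qed

subsection \<open>Decay and contraction\<close>

text \<open>Small enough for \<open>\<kappa> * X\<close> \<le> 1/4: differentiating the cross term
  produces \<kappa> e^eta slope^2 with the wrong sign, which the damping must absorb.\<close>

definition \<kappa> :: real where "\<kappa> = 1 / (4 * (X + 1))"

lemma kappa_pos: "\<kappa> > 0" and kappa_le: "\<kappa> \<le> 1 / 4" "\<kappa> * X \<le> 1 / 4"
  using X_pos by (auto simp: \<kappa>_def field_simps)

definition lyap :: "(real \<Rightarrow> real) \<Rightarrow> (real \<Rightarrow> real) \<Rightarrow> real \<Rightarrow> real" where
  "lyap V W r = energy V W r - \<kappa> * (slope W r * (exp (eta V r) - 1))"

definition dist2 :: "(real \<Rightarrow> real) \<Rightarrow> (real \<Rightarrow> real) \<Rightarrow> real \<Rightarrow> real" where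
  "dist2 V W r = (slope W r)\<^sup>2 + (exp (eta V r) - 1)\<^sup>2"

lemma lyap_derivative:
  assumes pr: "profile V W" and r: "r \<in> {0<..1}"
  shows "(lyap V W has_real_derivative
     ((- m * (slope W r)\<^sup>2 + \<kappa> * exp (eta V r) * (slope W r)\<^sup>2 + \<kappa> * m * (slope W r * (exp (eta V r) - 1))
        - 2 * m * \<kappa> * (exp (eta V r) - 1)\<^sup>2)
      + 2 * m * (a r - 1) * exp (eta V r) * (slope W r - \<kappa> * (exp (eta V r) - 1))) / r) (at r within {0<..1})"
proof -
  have "(lyap V W has_real_derivative
     (- m * (slope W r)\<^sup>2 + 2 * m * (a r - 1) * exp (eta V r) * slope W r) / r
     - \<kappa> * (slope W r * (exp (eta V r) * (- slope W r / r))
       + (- m * slope W r + 2 * m * (a r * exp (eta V r) - 1)) / r * (exp (eta V r) - 1))) (at r within {0<..1})"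
    unfolding lyap_def[abs_def]
    by (rule derivative_eq_intros energy_derivative[OF pr r] slope_derivative[OF pr r] eta_derivative[OF pr r] refl | simp)+
  moreover have "(- m * p\<^sup>2 + 2 * m * (a r - 1) * x * p) / r
     - \<kappa> * (p * (x * (- p / r)) + (- m * p + 2 * m * (a r * x - 1)) / r * (x - 1))
    = ((- m * p\<^sup>2 + \<kappa> * x * p\<^sup>2 + \<kappa> * m * (p * (x - 1)) - 2 * m * \<kappa> * (x - 1)\<^sup>2)
      + 2 * m * (a r - 1) * x * (p - \<kappa> * (x - 1))) / r" for p x
    using r by (simp add: field_simps power2_eq_square)
  ultimately show ?thesis by simp
qed

text \<open>The good terms are - m p^2 and, from the cross term, - 2 m \<kappa> y^2. Half of each
  pays for the two remaining terms, because \<kappa> X \<le> 1/4, \<kappa> \<le> 1/4 and m \<ge>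
  1.\<close>

lemma dissipation:
  assumes "x \<le> X"
  shows "- m * p\<^sup>2 + \<kappa> * x * p\<^sup>2 + \<kappa> * m * (p * y) - 2 * m * \<kappa> * y\<^sup>2 \<le> - (m / 2 * p\<^sup>2 + m * \<kappa> * y\<^sup>2)"
proof -
  have "p * y \<le> (p\<^sup>2 + y\<^sup>2) / 2" using two_mult_le_squares[of p y] by linarith
  then have "\<kappa> * m * (p * y) \<le> \<kappa> * m * ((p\<^sup>2 + y\<^sup>2) / 2)"
    using kappa_pos m_ge_1 by (intro mult_left_mono) auto
  moreover have "\<kappa> * x * p\<^sup>2 \<le> 1 / 4 * p\<^sup>2"
  proof (intro mult_right_mono)
    have "\<kappa> * x \<le> \<kappa> * X" using assms kappa_pos by (intro mult_left_mono) auto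
    then show "\<kappa> * x \<le> 1 / 4" using kappa_le(2) by linarith
  qed simp
  moreover have "\<kappa> * m / 2 * p\<^sup>2 \<le> m / 8 * p\<^sup>2"
    using kappa_le(1) m_ge_1 mult_right_mono[of \<kappa> "1/4" m] by (intro mult_right_mono) auto
  moreover have "1 / 4 * p\<^sup>2 + m / 8 * p\<^sup>2 \<le> m / 2 * p\<^sup>2"
    using m_ge_1 mult_right_mono[of "1 / 4 + m / 8" "m / 2" "p\<^sup>2"] by (simp add: distrib_right)
  moreover have "0 \<le> \<kappa> * m * y\<^sup>2" using kappa_pos m_ge_1 by simp
  ultimately show ?thesis by (simp add: algebra_simps)
qed

text \<open>Since 2 X + 2 = 1 / (2 \<kappa>), the potential part is at least 4 \<kappa> y^2, which
  outweighs the cross term.\<close>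

lemma lyap_lower:
  assumes "exp (eta V r) \<le> X"
  shows "\<kappa> * dist2 V W r \<le> lyap V W r"
proof -
  define x p y where "x = exp (eta V r)" and "p = slope W r" and "y = exp (eta V r) - 1"
  have "y\<^sup>2 / (2 * X + 2) \<le> y\<^sup>2 / (2 * x + 2)"
    using assms by (intro frac_le) (auto simp: x_def add_pos_pos)
  then have "2 * m * (y\<^sup>2 / (2 * X + 2)) \<le> 2 * m * (y - eta V r)"
    using exp_minus_id_lower[of "eta V r"] m_ge_1 by (intro mult_left_mono) (auto simp: x_def y_def)
  moreover have "2 * m * (y\<^sup>2 / (2 * X + 2)) = 4 * m * \<kappa> * y\<^sup>2"
    using X_pos by (simp add: \<kappa>_def field_simps)
  moreover have "4 * \<kappa> * y\<^sup>2 * 1 \<le> 4 * \<kappa> * y\<^sup>2 * m"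
    using m_ge_1 kappa_pos by (intro mult_left_mono) auto
  ultimately have "4 * (\<kappa> * y\<^sup>2) \<le> 2 * m * (y - eta V r)" by (simp add: mult_ac)
  moreover have "\<kappa> * (p * y) \<le> (\<kappa> * p\<^sup>2 + \<kappa> * y\<^sup>2) / 2"
  proof -
    have "\<kappa> * (p * y) \<le> \<kappa> * ((p\<^sup>2 + y\<^sup>2) / 2)"
      using two_mult_le_squares[of p y] kappa_pos by (intro mult_left_mono) auto
    then show ?thesis by (simp add: distrib_left)
  qed
  moreover have "\<kappa> * p\<^sup>2 \<le> 1 / 4 * p\<^sup>2" using kappa_le(1) by (intro mult_right_mono) auto
  moreover have "0 \<le> \<kappa> * y\<^sup>2" "0 \<le> p\<^sup>2" using kappa_pos by simp_all
  ultimately show ?thesis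
    unfolding lyap_def energy_def dist2_def y_def[symmetric] p_def[symmetric] distrib_left by argo
qed

text \<open>As eta tends to minus infinity the potential grows like |eta| while (e^eta - 1)^2 stays
  bounded, so a comparison from above needs a lower bound on eta. This is where the initial energy
  enters.\<close>

lemma lyap_upper:
  assumes "- h \<le> eta V r" 
  shows "lyap V W r \<le> (slope W r)\<^sup>2 + (2 * m * exp h + 1) * (exp (eta V r) - 1)\<^sup>2"
proof -
  define x p y where "x = exp (eta V r)" and "p = slope W r" and "y = exp (eta V r) - 1"
  have "exp (- h) \<le> x" using assms by (simp add: x_def)
  then have "1 / x \<le> exp h" by (simp add: exp_minus x_def field_simps)
  then have "y\<^sup>2 / x \<le> y\<^sup>2 * exp h"
    using mult_left_mono[of "1 / x" "exp h" "y\<^sup>2"] by simp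
  then have "2 * m * (y - eta V r) \<le> 2 * m * (y\<^sup>2 * exp h)"
    using exp_minus_id_upper[of "eta V r"] m_ge_1 by (intro mult_left_mono) (auto simp: x_def y_def)
  moreover have "\<bar>\<kappa> * (p * y)\<bar> \<le> 1 * ((p\<^sup>2 + y\<^sup>2) / 2)"
    unfolding abs_mult[of \<kappa>] using two_mult_le_squares[of p y] kappa_pos kappa_le(1) 
    by (intro mult_mono) auto
  moreover have "(2 * m * exp h + 1) * y\<^sup>2 = 2 * m * (y\<^sup>2 * exp h) + y\<^sup>2" by (simp add: algebra_simps)
  moreover have "0 \<le> p\<^sup>2" "0 \<le> y\<^sup>2" by simp_all
  ultimately show ?thesis
    unfolding lyap_def energy_def y_def[symmetric] p_def[symmetric] abs_le_iff by argo
qed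

lemma eta_lower:
  assumes pr: "profile V W" "no_flux W" and r0: "0 < r0" "r0 \<le> r" "r \<le> 1" and E: "energy V W r0 \<le> E0"
  shows "- ((E0 + C1) / (2 * m) + 1) \<le> eta V r"
proof -
  have "energy V W r \<le> E0 + C1" using energy_growth[OF pr r0] E by simp
  moreover have "2 * m * (- 1 - eta V r) \<le> 2 * m * (exp (eta V r) - 1 - eta V r)"
    using m_ge_1 by (intro mult_left_mono) auto
  ultimately have "2 * m * (- 1 - eta V r) \<le> E0 + C1"
    using zero_le_power2[of "slope W r"] unfolding energy_def by linarith
  then show ?thesis using m_ge_1 by (simp add: field_simps)
qed

text \<open>The dissipation is at least c \<open>lyap\<close>, so r^c \<open>lyap\<close> is
  nonincreasing up to the perturbation. The exponent depends on \<open>E0\<close> through the lower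
  bound of eta, but neither on the solution nor on \<open>r0\<close>.\<close>

lemma decay:
  "\<exists>c K. 0 < c \<and> c \<le> 1 \<and> 0 \<le> K \<and> (\<forall>V W r0 r. profile V W \<longrightarrow> no_flux W \<longrightarrow> 0 < r0 \<longrightarrow> r0 \<le> r \<longrightarrow> r \<le> 1 \<longrightarrow>
     energy V W r0 \<le> E0 \<longrightarrow>
     \<bar>slope W r\<bar> \<le> K * ((r0 / r) powr c + r powr c) \<and> \<bar>exp (eta V r) - 1\<bar> \<le> K * ((r0 / r) powr c + r powr c))"
proof -
  define h where "h = (E0 + C1) / (2 * m) + 1"
  \<comment> \<open>Chosen so that c times the bound of \<open>lyap_upper\<close> is at most the
    dissipation (m / 2) p^2 + m \<kappa> y^2; the two entries of the minimum serve the two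
    squares.\<close>
  define c where "c = min (1/2) (m * \<kappa> / (2 * m * exp h + 1))"
  have den: "2 * m * exp h + 1 > 0" using m_ge_1 by (simp add: add_pos_pos)
  have c: "0 < c" "c \<le> 1/2" "c * (2 * m * exp h + 1) \<le> m * \<kappa>"
  proof -
    show "0 < c" using kappa_pos m_ge_1 den by (auto simp: c_def)
    show "c \<le> 1/2" unfolding c_def by (rule min.cobounded1)
    have "c * (2 * m * exp h + 1) \<le> m * \<kappa> / (2 * m * exp h + 1) * (2 * m * exp h + 1)"
      using den by (intro mult_right_mono) (auto simp: c_def)
    then show "c * (2 * m * exp h + 1) \<le> m * \<kappa>" using den by simp
  qed
  define C2 where "C2 = M * L * (B + X + 1)"
  have C2: "C2 \<ge> 0" using M_pos L_nonneg B_pos X_pos by (simp add: C2_def)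
  define F0 where "F0 = \<bar>E0\<bar> + B * (X + 1)"
  define K1 where "K1 = (F0 + C2) / \<kappa>"
  have F0: "F0 \<ge> 0" using B_pos X_pos by (simp add: F0_def)
  have K1: "K1 \<ge> 0" using F0 C2 kappa_pos by (simp add: K1_def)
  have main: "dist2 V W r \<le> K1 * ((r0 / r) powr c + r powr c)"
    if pr: "profile V W" "no_flux W" and r0: "0 < r0" "r0 \<le> r" "r \<le> 1" and E: "energy V W r0 \<le> E0" for V W r0 r
  proof -
    \<comment> \<open>t^c is the integrating factor, and the term with \<open>C2\<close> absorbs the
      perturbation of size C2 t.\<close>
    define G where "G = (\<lambda>t. C2 * t powr (c + 1) - t powr c * lyap V W t)"
    define F' where "F' = (\<lambda>t. (((- m * (slope W t)\<^sup>2 + \<kappa> * exp (eta V t) * (slope W t)\<^sup>2 + \<kappa> * m * (slope W t * (exp (eta V t) - 1))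
        - 2 * m * \<kappa> * (exp (eta V t) - 1)\<^sup>2)
      + 2 * m * (a t - 1) * exp (eta V t) * (slope W t - \<kappa> * (exp (eta V t) - 1)))))"
    have dG: "(G has_real_derivative C2 * ((c + 1) * t powr c) - (t powr c * (F' t / t) + c * t powr (c - 1) * lyap V W t)) (at t within {0<..1})"
      if t: "t \<in> {0<..1}" for t
    proof -
      have d: "((\<lambda>t. t powr (c + 1)) has_real_derivative (c + 1) * t powr c) (at t within {0<..1})"
        "((\<lambda>t. t powr c) has_real_derivative c * t powr (c - 1)) (at t within {0<..1})"
        using t has_real_derivative_powr[of t "c + 1"] has_real_derivative_powr[of t c]
        by (auto intro: has_field_derivative_at_within)
      show ?thesis
        unfolding G_def F'_def
        by (intro DERIV_diff DERIV_cmult d(1) DERIV_mult'[OF d(2) lyap_derivative[OF pr(1) t]])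
    qed
    have "G r0 \<le> G r"
    proof (rule nondecreasing_from_derivative[OF dG])
      fix t assume t: "r0 < t" "t < r"
      then have t1: "t \<in> {0<..1}" using r0 by auto
      define x p where "x = exp (eta V t)" and "p = slope W t"
      have x: "0 < x" "x \<le> X" "\<bar>p\<bar> \<le> B" using a_priori[OF pr t1] by (auto simp: x_def p_def)
      have "\<bar>\<kappa> * (x - 1)\<bar> \<le> 1 * (X + 1)"
        unfolding abs_mult using kappa_pos kappa_le(1) x X_pos by (intro mult_mono) auto
      then have "\<bar>p - \<kappa> * (x - 1)\<bar> \<le> B + X + 1"
        using x(3) abs_triangle_ineq4[of p "\<kappa> * (x - 1)"] by simp
      then have "2 * m * (a t - 1) * x * (p - \<kappa> * (x - 1)) \<le> C2 * t"
        using perturbation_bound[OF t1, of "eta V t" "p - \<kappa> * (x - 1)" "B + X + 1"] x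
        by (simp add: x_def C2_def)
      then have "F' t \<le> - (m / 2 * p\<^sup>2 + m * \<kappa> * (x - 1)\<^sup>2) + C2 * t"
        using dissipation[OF x(2), of p "x - 1"] unfolding F'_def x_def[symmetric] p_def[symmetric] by linarith
      moreover have "c * lyap V W t \<le> m / 2 * p\<^sup>2 + m * \<kappa> * (x - 1)\<^sup>2"
      proof -
        have "- h \<le> eta V t" unfolding h_def
          by (rule eta_lower[OF pr r0(1) _ _ E]) (use t t1 in auto)
        then have "c * lyap V W t \<le> c * (p\<^sup>2 + (2 * m * exp h + 1) * (x - 1)\<^sup>2)"
          using lyap_upper[of h V t W] c(1) by (intro mult_left_mono) (auto simp: x_def p_def)
        also have "\<dots> = c * p\<^sup>2 + (c * (2 * m * exp h + 1)) * (x - 1)\<^sup>2" by (simp add: algebra_simps)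
        also have "\<dots> \<le> m / 2 * p\<^sup>2 + m * \<kappa> * (x - 1)\<^sup>2"
          using c m_ge_1 by (intro add_mono mult_right_mono) auto
        finally show ?thesis .
      qed
      ultimately have "F' t + c * lyap V W t \<le> C2 * t" by linarith
      moreover have "C2 * t \<le> C2 * ((c + 1) * t)"
        using C2 c t1 by (intro mult_left_mono) auto
      ultimately have "0 \<le> (t powr c / t) * (C2 * ((c + 1) * t) - (F' t + c * lyap V W t))"
        using t1 by (intro mult_nonneg_nonneg) auto
      also have "\<dots> = C2 * ((c + 1) * t powr c) - (t powr c * (F' t / t) + c * t powr (c - 1) * lyap V W t)"
        using t1 powr_pred[of t c] by (simp add: field_simps)
      finally show "0 \<le> C2 * ((c + 1) * t powr c) - (t powr c * (F' t / t) + c * t powr (c - 1) * lyap V W t)" .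
    qed (use r0 in auto)
    moreover have "0 \<le> C2 * r0 powr (c + 1)" using C2 by simp
    ultimately have G: "r powr c * lyap V W r \<le> C2 * r powr (c + 1) + r0 powr c * lyap V W r0"
      unfolding G_def by linarith
    have lyap0: "lyap V W r0 \<le> F0"
    proof -
      define x p where "x = exp (eta V r0)" and "p = slope W r0"
      have x: "0 < x" "x \<le> X" "\<bar>p\<bar> \<le> B" using a_priori[OF pr, of r0] r0 by (auto simp: x_def p_def)
      have "\<bar>\<kappa> * (p * (x - 1))\<bar> \<le> 1 * (B * (X + 1))"
        unfolding abs_mult using kappa_pos kappa_le(1) x X_pos B_pos by (intro mult_mono) auto
      then show ?thesis using E by (simp add: lyap_def F0_def x_def p_def)
    qed
    have rc: "r powr c > 0" using r0 by simp
    have "lyap V W r \<le> C2 * r + (r0 / r) powr c * lyap V W r0"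
    proof -
      have "r powr c * lyap V W r \<le> r powr c * (C2 * r + (r0 / r) powr c * lyap V W r0)"
        using G r0 by (simp add: powr_add powr_divide algebra_simps)
      then show ?thesis using rc by simp
    qed
    also have "\<dots> \<le> C2 * r powr c + (r0 / r) powr c * F0"
    proof (intro add_mono mult_left_mono)
      have "r powr 1 \<le> r powr c" using r0 c by (intro powr_mono') auto
      then show "r \<le> r powr c" using r0 by simp
    qed (use C2 lyap0 in auto)
    also have "\<dots> \<le> (F0 + C2) * ((r0 / r) powr c + r powr c)"
      using C2 F0 by (simp add: algebra_simps)
    finally have "\<kappa> * dist2 V W r \<le> (F0 + C2) * ((r0 / r) powr c + r powr c)"
      using lyap_lower[of V r W] a_priori[OF pr, of r] r0 by simp
    then show ?thesis using kappa_pos by (simp add: K1_def field_simps)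
  qed
  \<comment> \<open>\<open>dist2\<close> is a sum of squares; taking roots halves the exponent, so
    the rate finally supplied is \<open>c / 2\<close>.\<close>
  have root: "\<bar>s\<bar> \<le> sqrt K1 * (u powr (c / 2) + v powr (c / 2))"
    if "s\<^sup>2 \<le> K1 * (u powr c + v powr c)" "0 < u" "0 < v" for s u v :: real
  proof -
    have "u powr c = (u powr (c / 2))\<^sup>2" "v powr c = (v powr (c / 2))\<^sup>2"
      using that by (simp_all add: power2_eq_square powr_add[symmetric])
    then have "u powr c + v powr c \<le> (u powr (c / 2) + v powr (c / 2))\<^sup>2" by (simp add: power2_sum)
    then have "s\<^sup>2 \<le> K1 * (u powr (c / 2) + v powr (c / 2))\<^sup>2"
      using that(1) mult_left_mono[OF _ K1] by (meson order_trans)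
    also have "\<dots> = (sqrt K1 * (u powr (c / 2) + v powr (c / 2)))\<^sup>2"
      using K1 by (simp add: power_mult_distrib)
    finally show ?thesis using K1 by (simp add: abs_le_square_iff[symmetric] abs_mult)
  qed
  show ?thesis
  proof (rule exI[of _ "c / 2"], rule exI[of _ "sqrt K1"], intro conjI allI impI)
    fix V W r0 r
    assume pr: "profile V W" "no_flux W" and r0: "0 < r0" "r0 \<le> r" "r \<le> (1::real)" and E: "energy V W r0 \<le> E0"
    have "(slope W r)\<^sup>2 \<le> dist2 V W r" "(exp (eta V r) - 1)\<^sup>2 \<le> dist2 V W r" by (auto simp: dist2_def)
    with main[OF pr r0 E] have "(slope W r)\<^sup>2 \<le> K1 * ((r0 / r) powr c + r powr c)"
      "(exp (eta V r) - 1)\<^sup>2 \<le> K1 * ((r0 / r) powr c + r powr c)" by linarith+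
    then show "\<bar>slope W r\<bar> \<le> sqrt K1 * ((r0 / r) powr (c / 2) + r powr (c / 2))"
      "\<bar>exp (eta V r) - 1\<bar> \<le> sqrt K1 * ((r0 / r) powr (c / 2) + r powr (c / 2))"
      using r0 by (auto intro!: root)
  qed (use c K1 in auto)
qed

section \<open>The difference of two profiles\<close>

text \<open>For p' = - m p + 2 m z, z' = - p, with derivatives in ln r, the form p^2 / 2 + m z^2 has
  derivative - m p^2. Subtracting z p / 2 adds a damping of z, as the cross term does in
  \<open>lyap\<close>.\<close>

definition gap :: "(real \<Rightarrow> real) \<Rightarrow> (real \<Rightarrow> real) \<Rightarrow> (real \<Rightarrow> real) \<Rightarrow> (real \<Rightarrow> real) \<Rightarrow> real \<Rightarrow> real" where
  "gap V1 W1 V2 W2 r = (slope W1 r - slope W2 r)\<^sup>2 / 2 + m * (eta V1 r - eta V2 r)\<^sup>2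
     - (eta V1 r - eta V2 r) * (slope W1 r - slope W2 r) / 2"

lemma gap_lower: "(p\<^sup>2 + z\<^sup>2) / 4 \<le> p\<^sup>2 / 2 + m * z\<^sup>2 - z * p / 2"
proof -
  have "z * p \<le> (z\<^sup>2 + p\<^sup>2) / 2" using two_mult_le_squares[of z p] by linarith
  moreover have "1 * z\<^sup>2 \<le> m * z\<^sup>2" using m_ge_1 by (intro mult_right_mono) auto
  moreover have "0 \<le> z\<^sup>2" by simp
  ultimately show ?thesis by argo
qed

lemma gap_upper: "p\<^sup>2 / 2 + m * z\<^sup>2 - z * p / 2 \<le> 3 / 4 * p\<^sup>2 + (m + 1 / 4) * z\<^sup>2"
proof -
  have "- (z * p) \<le> (z\<^sup>2 + p\<^sup>2) / 2" using two_mult_le_squares[of z p] by linarith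
  moreover have "(m + 1 / 4) * z\<^sup>2 = m * z\<^sup>2 + z\<^sup>2 / 4" by (simp add: algebra_simps)
  ultimately show ?thesis by argo
qed

text \<open>By Young's inequality the quadratic part is at most - (3 m / 4 - 1 / 2) p^2 - (3 m / 4)
  z^2. Against \<open>gap_upper\<close> this yields the rate 1/3; at m = 1 the p^2 terms balance
  exactly. The remainder \<open>\<delta>\<close> costs at most 2 m times 4 D times the form.\<close>

lemma gap_dissipation:
  fixes p z \<delta> D :: real
  assumes "\<bar>\<delta>\<bar> \<le> D * \<bar>z\<bar>" "0 \<le> D"
  shows "- (m - 1 / 2) * p\<^sup>2 + m / 2 * (z * p) - m * z\<^sup>2 + 2 * m * (\<delta> * (p - z / 2))
    \<le> (8 * m * D - 1 / 3) * (p\<^sup>2 / 2 + m * z\<^sup>2 - z * p / 2)"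
proof -
  define Q where "Q = p\<^sup>2 / 2 + m * z\<^sup>2 - z * p / 2"
  have zp: "\<bar>z * p\<bar> \<le> (z\<^sup>2 + p\<^sup>2) / 2" by (rule two_mult_le_squares)
  have "\<bar>\<delta> * (p - z / 2)\<bar> \<le> (D * \<bar>z\<bar>) * (\<bar>p\<bar> + \<bar>z\<bar> / 2)"
    unfolding abs_mult using assms by (intro mult_mono) auto
  also have "\<dots> = D * (\<bar>z * p\<bar> + z\<^sup>2 / 2)"
    by (simp add: algebra_simps abs_mult power2_eq_square)
  also have "\<dots> \<le> D * (4 * Q)"
  proof (rule mult_left_mono)
    show "\<bar>z * p\<bar> + z\<^sup>2 / 2 \<le> 4 * Q"
      using zp gap_lower[of p z] zero_le_power2[of p] unfolding Q_def by argo
  qed fact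
  finally have "2 * m * (\<delta> * (p - z / 2)) \<le> 2 * m * (D * (4 * Q))"
    using m_ge_1 by (intro mult_left_mono) auto
  moreover have "m / 2 * (z * p) \<le> m / 2 * ((z\<^sup>2 + p\<^sup>2) / 2)"
    using zp m_ge_1 by (intro mult_left_mono) auto
  moreover have "Q \<le> 3 / 4 * p\<^sup>2 + (m + 1 / 4) * z\<^sup>2" unfolding Q_def by (rule gap_upper)
  moreover have "1 * p\<^sup>2 \<le> m * p\<^sup>2" "1 * z\<^sup>2 \<le> m * z\<^sup>2" using m_ge_1 by (intro mult_right_mono; simp)+
  moreover have "- (m - 1 / 2) * p\<^sup>2 = - (m * p\<^sup>2) + p\<^sup>2 / 2" "(m + 1 / 4) * z\<^sup>2 = m * z\<^sup>2 + z\<^sup>2 / 4"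
    "m / 2 * ((z\<^sup>2 + p\<^sup>2) / 2) = (m * z\<^sup>2 + m * p\<^sup>2) / 4" "2 * m * (D * (4 * Q)) = 8 * m * D * Q"
    "(8 * m * D - 1 / 3) * Q = 8 * m * D * Q - Q / 3"
    by (simp_all add: algebra_simps)
  moreover have "0 \<le> z\<^sup>2" by simp
  ultimately show ?thesis unfolding Q_def[symmetric] by argo
qed

lemma gap_derivative:
  assumes pr: "profile V1 W1" "profile V2 W2" and r: "r \<in> {0<..1}"
    and \<delta>: "\<delta> = a r * (exp (eta V1 r) - exp (eta V2 r)) - (eta V1 r - eta V2 r)"
    and p: "p = slope W1 r - slope W2 r" and z: "z = eta V1 r - eta V2 r"
  shows "(gap V1 W1 V2 W2 has_real_derivative
    (- (m - 1 / 2) * p\<^sup>2 + m / 2 * (z * p) - m * z\<^sup>2 + 2 * m * (\<delta> * (p - z / 2))) / r) (at r within {0<..1})"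
proof -
  have dp: "((\<lambda>r. slope W1 r - slope W2 r) has_real_derivative (- m * p + 2 * m * (z + \<delta>)) / r) (at r within {0<..1})"
  proof -
    have "(- m * slope W1 r + 2 * m * (a r * exp (eta V1 r) - 1)) / r - (- m * slope W2 r + 2 * m * (a r * exp (eta V2 r) - 1)) / r
      = (- m * p + 2 * m * (z + \<delta>)) / r"
      unfolding \<delta> p z using r by (simp add: field_simps)
    then show ?thesis
      using DERIV_diff[OF slope_derivative[OF pr(1) r] slope_derivative[OF pr(2) r]] by simp
  qed
  have dz: "((\<lambda>r. eta V1 r - eta V2 r) has_real_derivative - p / r) (at r within {0<..1})"
  proof -
    have "- slope W1 r / r - - slope W2 r / r = - p / r" unfolding p by (simp add: diff_divide_distrib)
    then show ?thesis
      using DERIV_diff[OF eta_derivative[OF pr(1) r] eta_derivative[OF pr(2) r]] by simp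
  qed
  show ?thesis
    unfolding gap_def[abs_def]
    by (rule DERIV_cong[OF DERIV_diff[OF DERIV_add[OF DERIV_cdivide[OF DERIV_power[OF dp, of 2]]
            DERIV_cmult[OF DERIV_power[OF dz, of 2]]] DERIV_cdivide[OF DERIV_mult'[OF dz dp]]]])
      (use r in \<open>simp add: p[symmetric] z[symmetric] field_simps power2_eq_square\<close>)
qed

text \<open>The mean value theorem gives the factor a e^t - 1, where e^t lies between e^u and e^v
  and therefore inherits both the distance \<open>e\<close> from 1 and the bound
  \<open>X\<close>.\<close>

lemma exp_difference:
  fixes u v x :: real
  assumes "\<bar>exp u - 1\<bar> \<le> e" "\<bar>exp v - 1\<bar> \<le> e" "exp u \<le> X" "exp v \<le> X" and r: "r \<in> {0<..1}"
  shows "\<bar>a r * (exp u - exp v) - (u - v)\<bar> \<le> (L * r * X + e) * \<bar>u - v\<bar>"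
proof -
  have wlog: "\<bar>a r * (exp u - exp v) - (u - v)\<bar> \<le> (L * r * X + e) * \<bar>u - v\<bar>"
    if uv: "v < u" "\<bar>exp u - 1\<bar> \<le> e" "\<bar>exp v - 1\<bar> \<le> e" "exp u \<le> X" for u v
  proof -
    obtain t where t: "v < t" "t < u" "exp u - exp v = (u - v) * exp t"
      using MVT2[OF uv(1), of exp exp] DERIV_exp by blast
    have et: "exp v \<le> exp t" "exp t \<le> exp u" using t by auto
    have "exp t \<le> X" using et(2) uv(4) by (rule order_trans)
    have "\<bar>exp t - 1\<bar> \<le> e" using et uv by argo
    moreover have "\<bar>(a r - 1) * exp t\<bar> \<le> L * r * X"
      unfolding abs_mult using lip[of r] \<open>exp t \<le> X\<close> r L_nonneg by (intro mult_mono) auto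
    moreover have "a r * exp t - 1 = (a r - 1) * exp t + (exp t - 1)" by (simp add: algebra_simps)
    ultimately have "\<bar>a r * exp t - 1\<bar> \<le> L * r * X + e" by argo
    then have "\<bar>a r * exp t - 1\<bar> * \<bar>u - v\<bar> \<le> (L * r * X + e) * \<bar>u - v\<bar>" by (rule mult_right_mono) simp
    moreover have "a r * (exp u - exp v) - (u - v) = (a r * exp t - 1) * (u - v)"
      unfolding t(3) by (simp add: algebra_simps)
    ultimately show ?thesis by (simp add: abs_mult)
  qed
  consider "v < u" | "u < v" | "u = v" by linarith
  then show ?thesis
  proof cases
    case 2
    have "a r * (exp u - exp v) - (u - v) = - (a r * (exp v - exp u) - (v - u))"
      by (simp add: algebra_simps)
    then show ?thesis
      using wlog[OF 2 assms(2,1,4)] by (simp only: abs_minus_cancel abs_minus_commute[of u v])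
  qed (use wlog assms in auto)
qed

text \<open>The gap decays at rate 1/3 up to an error rate 8 m D(t), where D(t) is a multiple of (r0
  / t)^c + t^c by \<open>decay\<close>. Its integral against dt / t is bounded independently of
  \<open>r0\<close>, so the error costs only a constant factor.\<close>

lemma contraction:
  "\<exists>K\<ge>0. \<forall>V1 W1 V2 W2 r0 r. profile V1 W1 \<longrightarrow> no_flux W1 \<longrightarrow> profile V2 W2 \<longrightarrow> no_flux W2 \<longrightarrow>
     0 < r0 \<longrightarrow> r0 \<le> r \<longrightarrow> r \<le> 1 \<longrightarrow> energy V1 W1 r0 \<le> E0 \<longrightarrow> energy V2 W2 r0 \<le> E0 \<longrightarrow>
     (V1 r - V2 r)\<^sup>2 + (r * (W1 r - W2 r))\<^sup>2 \<le> K * (r0 / r) powr (1 / 3)"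
proof -
  obtain c K where c: "0 < c" "c \<le> 1" and K: "0 \<le> K" and decay: "\<And>V W r0 r. profile V W \<Longrightarrow> no_flux W \<Longrightarrow> 0 < r0 \<Longrightarrow> r0 \<le> r \<Longrightarrow> r \<le> 1 \<Longrightarrow>
     energy V W r0 \<le> E0 \<Longrightarrow> \<bar>exp (eta V r) - 1\<bar> \<le> K * ((r0 / r) powr c + r powr c)"
    using decay[of E0] by blast
  define K2 where "K2 = L * X + K"
  have K2: "K2 \<ge> 0" using L_nonneg X_pos K by (simp add: K2_def)
  \<comment> \<open>Bounds |eta| at \<open>r0\<close>: from below by \<open>eta_lower\<close>, from
    above by eta \<le> e^eta \<le> X. Then \<open>Q0\<close> bounds the initial gap.\<close>
  define h where "h = \<bar>(E0 + C1) / (2 * m) + 1\<bar> + X"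
  define Q0 where "Q0 = 3 / 4 * (2 * B)\<^sup>2 + (m + 1 / 4) * (2 * h)\<^sup>2"
  define T where "T = 8 * m * K2 / c"
  have T: "T \<ge> 0" using K2 m_ge_1 c by (simp add: T_def)
  have Q0: "Q0 \<ge> 0" using m_ge_1 by (simp add: Q0_def)
  show ?thesis
  proof (rule exI[of _ "4 * (exp (2 * T) * Q0)"], intro conjI allI impI)
    show "0 \<le> 4 * (exp (2 * T) * Q0)" using Q0 by simp
    fix V1 W1 V2 W2 r0 r
    assume pr: "profile V1 W1" "no_flux W1" "profile V2 W2" "no_flux W2"
      and r0: "0 < r0" "r0 \<le> r" "r \<le> (1::real)" and E: "energy V1 W1 r0 \<le> E0" "energy V2 W2 r0 \<le> E0"
    define Q where "Q = gap V1 W1 V2 W2"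
    define \<delta> where "\<delta> = (\<lambda>r. a r * (exp (eta V1 r) - exp (eta V2 r)) - (eta V1 r - eta V2 r))"
    define p where "p = (\<lambda>r. slope W1 r - slope W2 r)"
    define z where "z = (\<lambda>r. eta V1 r - eta V2 r)"
    define Q' where "Q' = (\<lambda>t. - (m - 1 / 2) * (p t)\<^sup>2 + m / 2 * (z t * p t) - m * (z t)\<^sup>2 + 2 * m * (\<delta> t * (p t - z t / 2)))"
    have Qeq: "Q t = (p t)\<^sup>2 / 2 + m * (z t)\<^sup>2 - z t * p t / 2" for t
      by (simp add: Q_def gap_def p_def z_def)
    have Qnonneg: "Q t \<ge> 0" for t
      using gap_lower[of "p t" "z t"] zero_le_power2[of "p t"] zero_le_power2[of "z t"] unfolding Qeq by argo
    \<comment> \<open>An antiderivative of the error rate \<open>g\<close> with respect to dt / t.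
      It is at least - T at \<open>r0\<close> and at most T at \<open>r\<close>, whence the factor
      exp (2 T).\<close>
    define G where "G = (\<lambda>t. T * (t powr c - r0 powr c * t powr (- c)))"
    define g where "g = (\<lambda>t. 8 * m * K2 * ((r0 / t) powr c + t powr c))"
    have dG: "(G has_real_derivative g t / t) (at t within {0<..1})" if t: "t \<in> {0<..1}" for t
    proof -
      have d: "((\<lambda>t. t powr e) has_real_derivative e * t powr (e - 1)) (at t within {0<..1})" for e
        using t has_real_derivative_powr[of t e] by (auto intro: has_field_derivative_at_within)
      have "(G has_real_derivative T * (c * t powr (c - 1) - r0 powr c * (- c * t powr (- c - 1)))) (at t within {0<..1})"
        unfolding G_def by (intro DERIV_cmult DERIV_diff d)
      moreover have "T * (c * t powr (c - 1) - r0 powr c * (- c * t powr (- c - 1))) = g t / t"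
        using t r0 c powr_pred[of t c] powr_pred[of t "- c"]
        by (simp add: T_def g_def powr_divide powr_minus divide_simps) (simp add: algebra_simps)
      ultimately show ?thesis by simp
    qed
    define H where "H = (\<lambda>t. t powr (1 / 3) * (exp (- G t) * Q t))"
    have dH: "(H has_real_derivative t powr (1/3) * (exp (- G t) * (Q' t / t) + exp (- G t) * (- (g t / t)) * Q t)
       + (1/3) * t powr (1/3 - 1) * (exp (- G t) * Q t)) (at t within {0<..1})" if t: "t \<in> {0<..1}" for t
    proof -
      have d: "((\<lambda>t. t powr (1/3)) has_real_derivative (1/3) * t powr (1/3 - 1)) (at t within {0<..1})"
        using t has_real_derivative_powr[of t "1/3"] by (auto intro: has_field_derivative_at_within)
      have dQ: "(Q has_real_derivative Q' t / t) (at t within {0<..1})"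
        unfolding Q_def Q'_def by (rule gap_derivative[OF pr(1,3) t]) (simp_all add: \<delta>_def p_def z_def)
      have "((\<lambda>t. exp (- G t)) has_real_derivative exp (- G t) * (- (g t / t))) (at t within {0<..1})"
        by (rule DERIV_chain2[OF DERIV_exp DERIV_minus[OF dG[OF t]]])
      from DERIV_mult'[OF d DERIV_mult'[OF this dQ]] show ?thesis by (simp add: H_def)
    qed
    have "- H r0 \<le> - H r"
    proof (rule nondecreasing_from_derivative[where f="\<lambda>t. - H t"])
      show "((\<lambda>t. - H t) has_real_derivative - (t powr (1/3) * (exp (- G t) * (Q' t / t) + exp (- G t) * (- (g t / t)) * Q t)
       + (1/3) * t powr (1/3 - 1) * (exp (- G t) * Q t))) (at t within {0<..1})" if "t \<in> {0<..1}" for t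
        by (rule DERIV_minus[OF dH[OF that]])
      fix t assume t: "r0 < t" "t < r"
      then have t1: "t \<in> {0<..1}" and t2: "r0 \<le> t" "t \<le> 1" using r0 by auto
      define D where "D = K2 * ((r0 / t) powr c + t powr c)"
      have D: "D \<ge> 0" using K2 by (simp add: D_def)
      have "\<bar>\<delta> t\<bar> \<le> (L * t * X + K * ((r0 / t) powr c + t powr c)) * \<bar>z t\<bar>"
        unfolding \<delta>_def z_def
        by (rule exp_difference[OF decay[OF pr(1,2) r0(1) t2 E(1)] decay[OF pr(3,4) r0(1) t2 E(2)]
              a_priori(1)[OF pr(1,2) t1] a_priori(1)[OF pr(3,4) t1] t1])
      also have "\<dots> \<le> D * \<bar>z t\<bar>"
      proof (rule mult_right_mono)
        have "t powr 1 \<le> t powr c" using t1 c by (intro powr_mono') auto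
        then have "t \<le> (r0 / t) powr c + t powr c" using t1 by (simp add: add_increasing)
        then have "(L * X) * t \<le> (L * X) * ((r0 / t) powr c + t powr c)"
          using L_nonneg X_pos by (intro mult_left_mono) auto
        then show "L * t * X + K * ((r0 / t) powr c + t powr c) \<le> D"
          by (simp add: D_def K2_def algebra_simps)
      qed simp
      finally have "Q' t \<le> (8 * m * D - 1 / 3) * Q t"
        unfolding Q'_def Qeq using gap_dissipation D by blast
      then have "Q' t - g t * Q t + 1 / 3 * Q t \<le> 0"
        by (simp add: g_def D_def algebra_simps)
      then have "(t powr (1/3) / t * exp (- G t)) * (Q' t - g t * Q t + 1 / 3 * Q t) \<le> 0"
        using t1 by (intro mult_nonneg_nonpos) auto
      moreover have "t powr (1/3) * (exp (- G t) * (Q' t / t) + exp (- G t) * (- (g t / t)) * Q t)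
         + (1/3) * t powr (1/3 - 1) * (exp (- G t) * Q t)
        = (t powr (1/3) / t * exp (- G t)) * (Q' t - g t * Q t + 1 / 3 * Q t)"
        unfolding powr_pred[OF order.strict_trans[OF r0(1) t(1)]] using t1 by (simp add: field_simps)
      ultimately show "0 \<le> - (t powr (1/3) * (exp (- G t) * (Q' t / t) + exp (- G t) * (- (g t / t)) * Q t)
         + (1/3) * t powr (1/3 - 1) * (exp (- G t) * Q t))" by simp
    qed (use r0 in auto)
    then have "H r \<le> H r0" by simp
    have Gr: "G r \<le> T"
    proof -
      have "r powr c \<le> 1" using r0 c by (simp add: powr_le1)
      moreover have "0 \<le> r0 powr c * r powr (- c)" by simp
      ultimately have "r powr c - r0 powr c * r powr (- c) \<le> 1" by linarith
      then have "T * (r powr c - r0 powr c * r powr (- c)) \<le> T * 1"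
        using T by (rule mult_left_mono)
      then show ?thesis by (simp add: G_def)
    qed
    have Gr0: "- T \<le> G r0"
    proof -
      have "r0 powr c * r0 powr (- c) = 1" using r0 by (simp add: powr_minus)
      then have "G r0 = T * (r0 powr c - 1)" by (simp add: G_def)
      moreover have "T * (- 1) \<le> T * (r0 powr c - 1)" using T by (intro mult_left_mono) auto
      ultimately show ?thesis by simp
    qed
    have eta_bd: "\<bar>eta V r0\<bar> \<le> h" if "profile V W" "no_flux W" "energy V W r0 \<le> E0" for V W
    proof -
      have "- ((E0 + C1) / (2 * m) + 1) \<le> eta V r0" by (rule eta_lower[OF that(1,2) r0(1) order_refl _ that(3)]) (use r0 in simp)
      moreover have "exp (eta V r0) \<le> X" using a_priori(1)[OF that(1,2), of r0] r0 by simp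
      then have "eta V r0 \<le> X" using exp_ge_add_one_self[of "eta V r0"] by linarith
      ultimately show ?thesis using X_pos unfolding h_def by argo
    qed
    have "Q r0 \<le> Q0"
    proof -
      have "\<bar>p r0\<bar> \<le> 2 * B"
        using a_priori(2)[OF pr(1,2), of r0] a_priori(2)[OF pr(3,4), of r0] r0 by (simp add: p_def)
      then have "(p r0)\<^sup>2 \<le> (2 * B)\<^sup>2" by (rule abs_le_square_iff[THEN iffD1, OF order_trans]) simp
      moreover have "\<bar>z r0\<bar> \<le> 2 * h"
        using eta_bd[OF pr(1,2) E(1)] eta_bd[OF pr(3,4) E(2)] by (simp add: z_def)
      then have "(z r0)\<^sup>2 \<le> (2 * h)\<^sup>2" by (rule abs_le_square_iff[THEN iffD1, OF order_trans]) simp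
      then have "(m + 1 / 4) * (z r0)\<^sup>2 \<le> (m + 1 / 4) * (2 * h)\<^sup>2" using m_ge_1 by (intro mult_left_mono) auto
      ultimately show ?thesis using gap_upper[of "p r0" "z r0"] unfolding Qeq Q0_def by argo
    qed
    have "r powr (1/3) * (exp (- T) * Q r) \<le> H r"
      unfolding H_def using Gr Qnonneg by (intro mult_left_mono mult_right_mono) auto
    also have "\<dots> \<le> H r0" by fact
    also have "\<dots> \<le> r0 powr (1/3) * (exp T * Q0)"
      unfolding H_def using Gr0 Qnonneg \<open>Q r0 \<le> Q0\<close> by (intro mult_left_mono mult_mono) auto
    finally have h1: "exp T * (r powr (1/3) * (exp (- T) * Q r)) \<le> exp T * (r0 powr (1/3) * (exp T * Q0))"
      by (rule mult_left_mono) simp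
    have "r powr (1/3) * Q r = exp T * (r powr (1/3) * (exp (- T) * Q r))" by (simp add: exp_minus)
    also note h1
    also have "exp T * (r0 powr (1/3) * (exp T * Q0)) = r0 powr (1/3) * (exp (2 * T) * Q0)"
      by (simp add: exp_double power2_eq_square)
    finally have "r powr (1/3) * Q r \<le> r0 powr (1/3) * (exp (2 * T) * Q0)" .
    then have Qr: "Q r \<le> exp (2 * T) * Q0 * (r0 / r) powr (1/3)"
      using r0 by (simp add: powr_divide field_simps)
    have "V1 r - V2 r = z r" "(r * (W1 r - W2 r))\<^sup>2 = (p r)\<^sup>2"
      by (simp_all add: z_def p_def eta_def slope_def power2_eq_square algebra_simps)
    then show "(V1 r - V2 r)\<^sup>2 + (r * (W1 r - W2 r))\<^sup>2 \<le> 4 * (exp (2 * T) * Q0) * (r0 / r) powr (1 / 3)"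
      using order_trans[OF gap_lower[of "p r" "z r"] Qr[unfolded Qeq]] by (simp add: add.commute)
  qed
qed

subsection \<open>Singular and regular solutions\<close>

text \<open>Bounded energy at every radius allows \<open>r0\<close> \<rightarrow> 0 in
  \<open>decay\<close>, which leaves only the term K r^c.\<close>

lemma tendsto_slope_eta_0:
  assumes pr: "profile V W" "no_flux W" and E: "\<And>r. r \<in> {0<..1} \<Longrightarrow> energy V W r \<le> E0"
  shows "(slope W \<longlongrightarrow> 0) (at_right 0)" "(eta V \<longlongrightarrow> 0) (at_right 0)"
proof -
  obtain c K where c: "0 < c" "c \<le> 1" "0 \<le> K" and d: "\<And>r0 r. 0 < r0 \<Longrightarrow> r0 \<le> r \<Longrightarrow> r \<le> 1 \<Longrightarrow> energy V W r0 \<le> E0 \<Longrightarrow>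
     \<bar>slope W r\<bar> \<le> K * ((r0 / r) powr c + r powr c) \<and> \<bar>exp (eta V r) - 1\<bar> \<le> K * ((r0 / r) powr c + r powr c)"
    using decay[of E0] pr by blast
  have bd: "\<bar>slope W r\<bar> \<le> K * r powr c" "\<bar>exp (eta V r) - 1\<bar> \<le> K * r powr c" if r: "r \<in> {0<..1}" for r
  proof -
    have "((\<lambda>r0. K * ((r0 / r) powr c + r powr c)) \<longlongrightarrow> K * (0 + r powr c)) (at_right 0)"
    proof (intro tendsto_intros)
      have "((\<lambda>r0. r0 / r) \<longlongrightarrow> 0 / r) (at_right 0)" by (intro tendsto_intros) (use r in auto)
      then show "((\<lambda>r0. (r0 / r) powr c) \<longlongrightarrow> 0) (at_right 0)"
        using c r by (intro tendsto_zero_powrI[where b=c]) (auto simp: eventually_at_filter)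
    qed
    then have l: "((\<lambda>r0. K * ((r0 / r) powr c + r powr c)) \<longlongrightarrow> K * r powr c) (at_right 0)" by simp
    show "\<bar>slope W r\<bar> \<le> K * r powr c" "\<bar>exp (eta V r) - 1\<bar> \<le> K * r powr c"
      by (rule ge_of_tendsto_at_right[OF l, of r]; use d E r in auto)+
  qed
  have z: "((\<lambda>r. K * r powr c) \<longlongrightarrow> K * 0) (at_right 0)"
    using c by (intro tendsto_mult tendsto_const tendsto_zero_powrI[where b=c])
      (auto simp: eventually_at_filter tendsto_ident_at)
  have ev: "\<forall>\<^sub>F r in at_right 0. r \<in> {0<..<1::real}" by (rule eventually_at_right_real) simp
  show "(slope W \<longlongrightarrow> 0) (at_right 0)"
    by (rule Lim_null_comparison[OF eventually_mono[OF ev] z[simplified]]) (use bd in auto)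
  have "((\<lambda>r. exp (eta V r) - 1) \<longlongrightarrow> 0) (at_right 0)"
    by (rule Lim_null_comparison[OF eventually_mono[OF ev] z[simplified]]) (use bd in auto)
  then have "((\<lambda>r. exp (eta V r)) \<longlongrightarrow> 1) (at_right 0)" by (simp add: LIM_zero_iff)
  then have "((\<lambda>r. ln (exp (eta V r))) \<longlongrightarrow> ln 1) (at_right 0)" by (rule tendsto_ln) simp
  then show "(eta V \<longlongrightarrow> 0) (at_right 0)" by simp
qed

text \<open>Both energies are bounded at every radius, so the contraction may start from arbitrarily
  small \<open>r0\<close>.\<close>

lemma bounded_energy_unique:
  assumes pr: "profile V1 W1" "no_flux W1" "profile V2 W2" "no_flux W2"
    and E: "\<And>r. r \<in> {0<..1} \<Longrightarrow> energy V1 W1 r \<le> E1" "\<And>r. r \<in> {0<..1} \<Longrightarrow> energy V2 W2 r \<le> E2"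
    and r: "r \<in> {0<..1}"
  shows "V1 r = V2 r"
proof -
  obtain K where K: "K \<ge> 0" and c: "\<And>r0. 0 < r0 \<Longrightarrow> r0 \<le> r \<Longrightarrow> energy V1 W1 r0 \<le> max E1 E2 \<Longrightarrow> energy V2 W2 r0 \<le> max E1 E2 \<Longrightarrow>
     (V1 r - V2 r)\<^sup>2 + (r * (W1 r - W2 r))\<^sup>2 \<le> K * (r0 / r) powr (1 / 3)"
    using contraction[of "max E1 E2"] pr r by (metis greaterThanAtMost_iff)
  have "((\<lambda>r0. r0 / r) \<longlongrightarrow> 0 / r) (at_right 0)" by (intro tendsto_intros) (use r in auto)
  then have "((\<lambda>r0. (r0 / r) powr (1/3)) \<longlongrightarrow> 0) (at_right 0)"
    using r by (intro tendsto_zero_powrI[where b="1/3"]) (auto simp: eventually_at_filter)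
  then have l: "((\<lambda>r0. K * (r0 / r) powr (1/3)) \<longlongrightarrow> 0) (at_right 0)" by (rule tendsto_mult_right_zero)
  have "(V1 r - V2 r)\<^sup>2 \<le> 0"
  proof (rule ge_of_tendsto_at_right[OF l, of r])
    fix s assume s: "0 < s" "s < r"
    then have "energy V1 W1 s \<le> max E1 E2" "energy V2 W2 s \<le> max E1 E2"
      using E(1)[of s] E(2)[of s] r by auto
    then show "(V1 r - V2 r)\<^sup>2 \<le> K * (s / r) powr (1 / 3)"
      using c[of s] s zero_le_power2[of "r * (W1 r - W2 r)"] by linarith
  qed (use r in auto)
  then show ?thesis by simp
qed

section \<open>Flux and energy of singular solutions\<close>

lemma no_flux_if_bounded:
  assumes "\<And>r. r \<in> {0<..1} \<Longrightarrow> \<bar>r * W r\<bar> \<le> b"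
  shows "no_flux W"
  unfolding no_flux_def
proof (rule Lim_null_comparison)
  show "((\<lambda>r. b * r ^ (N - 2)) \<longlongrightarrow> 0) (at_right 0)"
    using N3 by (intro power_tendsto_0_at_right) auto
  have "\<bar>r ^ (N - 1) * W r\<bar> \<le> b * r ^ (N - 2)" if "r \<in> {0<..<1}" for r
  proof -
    have "\<bar>r ^ (N - 1) * W r\<bar> = r ^ (N - 2) * \<bar>r * W r\<bar>"
      unfolding power_N_minus_1 using that by (simp add: abs_mult)
    also have "\<dots> \<le> r ^ (N - 2) * b" using assms[of r] that by (intro mult_left_mono) auto
    finally show ?thesis by (simp add: mult.commute)
  qed
  then show "\<forall>\<^sub>F r in at_right 0. norm (r ^ (N - 1) * W r) \<le> b * r ^ (N - 2)"
    using eventually_at_right_real[of 0 1] by (auto elim: eventually_mono)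
qed

text \<open>W > 0 at one radius would persist down to the origin and make V increasing there. So W
  \<le> 0, and the monotone flux has a limit; a negative limit would force V' \<le> - e / r^2, hence
  V at least of order e / r, against the logarithmic bound from
  \<open>exp_upper_bound\<close>.\<close>

lemma singular_no_flux:
  assumes pr: "profile V W" and lim: "filterlim V at_top (at_right 0)"
  shows "no_flux W"
proof -
  have ev1: "\<forall>\<^sub>F t in at_right 0. 0 < t \<and> t < r" if "r > 0" for r :: real
    using eventually_at_right_real[OF that] by simp
  have neg: "W r \<le> 0" if r: "r \<in> {0<..1}" for r
  proof (rule ccontr)
    assume "\<not> W r \<le> 0"
    then have "r ^ (N - 1) * W r > 0" using r by simp
    then have Wpos: "W t > 0" if "0 < t" "t \<le> r" for t
      using flux_antimono[OF pr, of t r] that r by (smt (verit, best) greaterThanAtMost_iff zero_less_mult_pos zero_less_power)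
    have "V t \<le> V r" if "0 < t" "t < r" for t
    proof (rule nondecreasing_from_derivative[OF profileD(1)[OF pr]])
      show "0 \<le> W s" if "t < s" "s < r" for s
        using Wpos[of s] that \<open>0 < t\<close> by simp
    qed (use that r in auto)
    moreover have "\<forall>\<^sub>F t in at_right 0. V t > V r" using lim by (simp add: filterlim_at_top_dense)
    then have "\<forall>\<^sub>F t in at_right 0. V t > V r \<and> 0 < t \<and> t < r"
      using ev1[of r] r by (auto elim: eventually_elim2)
    then obtain t where "V t > V r" "0 < t" "t < r"
      using eventually_happens'[of "at_right (0::real)"] by auto
    ultimately show False by fastforce
  qed
  show ?thesis
    unfolding no_flux_def
  proof (rule tendstoI)
    fix e :: real assume e: "e > 0"
    have "\<exists>r\<in>{0<..1}. - (r ^ (N - 1) * W r) < e"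
    proof (rule ccontr)
      assume "\<not> ?thesis"
      then have ge: "- (r ^ (N - 1) * W r) \<ge> e" if "r \<in> {0<..1}" for r using that by (meson not_le)
      have W_le: "W r \<le> - e / r\<^sup>2" if r: "r \<in> {0<..1}" for r
      proof -
        have "r ^ (N - 1) \<le> r\<^sup>2" using r N3 by (intro power_decreasing) auto
        then have "r ^ (N - 1) * (- W r) \<le> r\<^sup>2 * (- W r)" using neg[OF r] by (intro mult_right_mono) auto
        then have "e \<le> r\<^sup>2 * (- W r)" using ge[OF r] by simp
        then show ?thesis using r by (simp add: field_simps)
      qed
      have "V 1 - e \<le> V t - e / t" if t: "0 < t" "t \<le> 1" for t
      proof -
        have "- (V t - e / t) \<le> - (V 1 - e / 1)"
        proof (rule nondecreasing_from_derivative[where f="\<lambda>t. - (V t - e / t)"])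
          show "((\<lambda>t. - (V t - e / t)) has_real_derivative - (W r - - (e / r\<^sup>2))) (at r within {0<..1})"
            if "r \<in> {0<..1}" for r
            using that by (auto intro!: derivative_eq_intros profileD(1)[OF pr] simp: power2_eq_square)
          show "- (W r - - (e / r\<^sup>2)) \<ge> 0" if "t < r" "r < 1" for r
            using W_le[of r] that t by simp
        qed (use t in auto)
        then show ?thesis by simp
      qed
      then have lower: "V 1 - e + e / t \<le> V t" if "0 < t" "t \<le> 1" for t using that by fastforce
      have upper: "V t \<le> ln M - 2 * ln t" if t: "0 < t" "t \<le> 1" for t
      proof -
        have "t\<^sup>2 * exp (V t) \<le> M" by (rule exp_upper_bound[OF pr neg]) (use t in auto)
        then have "ln (t\<^sup>2 * exp (V t)) \<le> ln M" using t M_pos by simp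
        moreover have "ln (t\<^sup>2 * exp (V t)) = 2 * ln t + V t" using t by (simp add: ln_mult ln_realpow)
        ultimately show ?thesis by simp
      qed
      define k where "k = ln M - V 1 + e"
      have k1: "e / t + 2 * ln t \<le> k" if "0 < t" "t \<le> 1" for t
        using lower[OF that] upper[OF that] by (simp add: k_def)
      have k2: "- ln t \<le> 2 / sqrt t" if "0 < t" for t :: real
      proof -
        have "1 / sqrt t > 0" using that by simp
        then have "ln (1 / sqrt t) \<le> 1 / sqrt t" using ln_le_minus_one[of "1 / sqrt t"] by linarith
        moreover have "ln (1 / sqrt t) = - ln t / 2" using that by (simp add: ln_div ln_sqrt)
        ultimately show ?thesis by simp
      qed
      have k: "e / t - 4 / sqrt t \<le> k" if t: "0 < t" "t \<le> 1" for t
      proof -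
        have "4 / sqrt t = 2 * (2 / sqrt t)" by simp
        then show ?thesis using k1[OF t] k2[OF t(1)] by linarith
      qed
      \<comment> \<open>\<open>y\<close> stands for 1 / sqrt t and is so large that e y^2 - 4 y
        exceeds \<open>k\<close>.\<close>
      define y where "y = max 1 ((\<bar>k\<bar> + 5) / e)"
      have y: "y \<ge> 1" "y * e \<ge> \<bar>k\<bar> + 5" using e by (auto simp: y_def field_simps max_def)
      have "e * y\<^sup>2 - 4 * y \<le> k"
        using k[of "1 / y\<^sup>2"] y(1) by (simp add: real_sqrt_divide power_le_one divide_le_eq)
      moreover have "e * y\<^sup>2 - 4 * y \<ge> y * (\<bar>k\<bar> + 1)"
        using mult_right_mono[OF y(2), of y] y(1) by (simp add: power2_eq_square algebra_simps)
      moreover have "y * (\<bar>k\<bar> + 1) \<ge> 1 * (\<bar>k\<bar> + 1)" using y(1) by (intro mult_right_mono) auto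
      ultimately have "1 * (\<bar>k\<bar> + 1) \<le> k" by (meson order_trans)
      then show False by simp
    qed
    then obtain r where r: "r \<in> {0<..1}" "- (r ^ (N - 1) * W r) < e" by blast
    \<comment> \<open>The flux is nonincreasing in the radius and nonpositive, so one small value
      controls all radii nearer to the origin.\<close>
    have "dist (t ^ (N - 1) * W t) 0 < e" if "0 < t" "t < r" for t
    proof -
      have "t ^ (N - 1) * W t \<le> 0" using neg[of t] that r by (auto intro!: mult_nonneg_nonpos)
      then show ?thesis using flux_antimono[OF pr, of t r] that r by simp
    qed
    then show "\<forall>\<^sub>F t in at_right 0. dist (t ^ (N - 1) * W t) 0 < e"
      using ev1[of r] r(1) by (auto elim: eventually_mono)
  qed
qed

text \<open>A bootstrap. Energy grows outwards by at most \<open>C1\<close>, so a large value at R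
  means large energy on all of (0,R], hence r^2 e^V \<le> \<epsilon> there. Then - r V' \<le> 1, so
  r e^V is bounded, so V' is bounded, and V cannot tend to infinity.\<close>

lemma singular_bounded_energy:
  assumes pr: "profile V W" and lim: "filterlim V at_top (at_right 0)"
  shows "\<exists>E0. \<forall>r\<in>{0<..1}. energy V W r \<le> E0"
proof (rule ccontr)
  assume "\<not> ?thesis"
  then have unb: "\<exists>r\<in>{0<..1}. energy V W r > E" for E by (meson not_le)
  have nf: "no_flux W" by (rule singular_no_flux[OF pr lim])
  \<comment> \<open>The value of \<open>b\<close> for which the bound A b / m in
    \<open>derivative_lower_bound\<close> equals 1.\<close>
  define \<epsilon> where "\<epsilon> = m / A"
  have eps: "\<epsilon> > 0" using A_pos m_ge_1 by (simp add: \<epsilon>_def)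
  text \<open>Large energy forces \<open>exp (eta V)\<close> to be small, since it is bounded above.\<close>
  define E where "E = B\<^sup>2 / 2 + 2 * m * (X - 1 - ln (\<epsilon> / (2 * m)))"
  obtain R where R: "R \<in> {0<..1}" "energy V W R > E + C1" using unb by blast
  have small: "t\<^sup>2 * exp (V t) \<le> \<epsilon>" if t: "0 < t" "t \<le> R" for t
  proof (rule ccontr)
    assume "\<not> t\<^sup>2 * exp (V t) \<le> \<epsilon>"
    then have "\<epsilon> / (2 * m) < exp (eta V t)"
      using exp_eta[OF t(1), of V] m_ge_1 by (simp add: field_simps)
    then have "ln (\<epsilon> / (2 * m)) < eta V t"
      using eps m_ge_1 by (metis divide_pos_pos exp_ln exp_less_cancel_iff less_le_trans mult_pos_pos zero_less_numeral zero_less_one)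
    moreover have ap: "exp (eta V t) \<le> X" "\<bar>slope W t\<bar> \<le> B" using a_priori[OF pr nf, of t] t R(1) by auto
    ultimately have "2 * m * (exp (eta V t) - 1 - eta V t) \<le> 2 * m * (X - 1 - ln (\<epsilon> / (2 * m)))"
      using m_ge_1 by (intro mult_left_mono) auto
    moreover have "(slope W t)\<^sup>2 \<le> B\<^sup>2" using ap(2) by (rule abs_le_square_iff[THEN iffD1, OF order_trans]) simp
    ultimately have "energy V W t \<le> E" unfolding energy_def E_def by argo
    then show False using energy_growth[OF pr nf, of t R] t R by simp
  qed
  have p1: "- r * W r \<le> 1" if "0 < r" "r \<le> R" for r
    using derivative_lower_bound[OF pr nf _ small that] R(1) A_pos m_ge_1 by (simp add: \<epsilon>_def)
  define C where "C = R * exp (V R)"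
  have C0: "C > 0" using R by (simp add: C_def)
  \<comment> \<open>- r V' \<le> 1 means that r e^V is nondecreasing, so its value at R bounds
    it.\<close>
  have q1: "t * exp (V t) \<le> C" if t: "0 < t" "t \<le> R" for t
    unfolding C_def
  proof (rule nondecreasing_from_derivative[where f="\<lambda>t. t * exp (V t)"])
    show "((\<lambda>t. t * exp (V t)) has_real_derivative (1 + r * W r) * exp (V r)) (at r within {0<..1})"
      if "r \<in> {0<..1}" for r
      using that by (auto intro!: derivative_eq_intros profileD(1)[OF pr] simp: algebra_simps)
    show "(1 + r * W r) * exp (V r) \<ge> 0" if "t < r" "r < R" for r
      using p1[of r] that t by simp
  qed (use t R in auto)
  have W1: "- W r \<le> A * C / m" if r: "0 < r" "r \<le> R" for r
  proof -
    have "t\<^sup>2 * exp (V t) \<le> r * C" if "0 < t" "t \<le> r" for t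
    proof -
      have "t * (t * exp (V t)) \<le> r * C" using q1[of t] that r C0 by (intro mult_mono) auto
      then show ?thesis by (simp add: power2_eq_square)
    qed
    then have "- r * W r \<le> A * (r * C) / m"
      using r R by (intro derivative_lower_bound[OF pr nf, of r]) auto
    then have "r * (- W r) \<le> r * (A * C / m)" by (simp add: mult_ac)
    then show ?thesis using r(1) by (rule mult_left_le_imp_le)
  qed
  have "V t \<le> V R + A * C / m" if t: "0 < t" "t \<le> R" for t
  proof -
    have "V t + A * C / m * t \<le> V R + A * C / m * R"
    proof (rule nondecreasing_from_derivative[where f="\<lambda>t. V t + A * C / m * t"])
      show "((\<lambda>t. V t + A * C / m * t) has_real_derivative W r + A * C / m) (at r within {0<..1})"
        if "r \<in> {0<..1}" for r
        using that by (auto intro!: derivative_eq_intros profileD(1)[OF pr])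
      show "W r + A * C / m \<ge> 0" if "t < r" "r < R" for r using W1[of r] that t by simp
    qed (use t R in auto)
    moreover have "A * C / m \<ge> 0" using A_pos C0 m_ge_1 by simp
    then have "A * C / m * R \<le> A * C / m * 1" "0 \<le> A * C / m * t"
      using R t by (intro mult_left_mono mult_nonneg_nonneg; simp)+
    ultimately show ?thesis by linarith
  qed
  moreover have "\<forall>\<^sub>F t in at_right 0. V t > V R + A * C / m" using lim by (simp add: filterlim_at_top_dense)
  then have "\<forall>\<^sub>F t in at_right 0. V t > V R + A * C / m \<and> 0 < t \<and> t < R"
    using eventually_at_right_real[of 0 R] R by (auto elim: eventually_elim2)
  then obtain t where "V t > V R + A * C / m" "0 < t" "t < R"
    using eventually_happens'[of "at_right (0::real)"] by auto
  ultimately show False by fastforce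
qed

text \<open>V \<le> \<beta> bounds the source by A e^\<beta>; integrating the flux identity twice
  with this constant puts a parabola below V.\<close>

lemma regular_bounds:
  assumes pr: "profile V W" "no_flux W" and lim: "(V \<longlongrightarrow> \<beta>) (at_right 0)" and r: "r \<in> {0<..1}"
  shows "V r \<le> \<beta>" "- (A * exp \<beta> / real N * r) \<le> W r" "\<beta> - A * exp \<beta> / (2 * real N) * r\<^sup>2 \<le> V r"
proof -
  note neg = flux_nonpos[OF pr]
  have Vle: "V t \<le> \<beta>" if "t \<in> {0<..1}" for t
    by (rule ge_of_tendsto_at_right[OF lim, of t], rule profile_decreasing[OF pr(1)]) (use that neg in auto)
  then show "V r \<le> \<beta>" using r by simp
  have Wge: "- (A * exp \<beta> / real N * t) \<le> W t" if t: "t \<in> {0<..1}" for t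
  proof -
    define H where "H = (\<lambda>t. t ^ (N - 1) * W t + A * exp \<beta> / real N * t ^ N)"
    have "H s \<le> H t" if s: "0 < s" "s < t" for s
    proof (rule nondecreasing_from_derivative[where f=H])
      show "(H has_real_derivative - (r ^ (N - 1) * (a r * exp (V r))) + A * exp \<beta> * r ^ (N - 1)) (at r within {0<..1})"
        if "r \<in> {0<..1}" for r
      proof -
        have "((\<lambda>t. A * exp \<beta> / real N * t ^ N) has_real_derivative A * exp \<beta> * r ^ (N - 1)) (at r within {0<..1})"
          using N3 by (auto intro!: derivative_eq_intros)
        then show ?thesis unfolding H_def by (intro DERIV_add flux_derivative[OF pr(1) that])
      qed
      fix r assume r: "s < r" "r < t"
      have "a r * exp (V r) \<le> A * exp \<beta>"
        using a_le[of r] Vle[of r] A_pos r s t by (intro mult_mono) auto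
      then have "r ^ (N - 1) * (a r * exp (V r)) \<le> r ^ (N - 1) * (A * exp \<beta>)"
        using r s by (intro mult_left_mono) auto
      then show "- (r ^ (N - 1) * (a r * exp (V r))) + A * exp \<beta> * r ^ (N - 1) \<ge> 0" by (simp add: mult_ac)
    qed (use s t in auto)
    moreover have "(H \<longlongrightarrow> 0 + 0) (at_right 0)"
      unfolding H_def using pr(2)[unfolded no_flux_def] N3
      by (intro tendsto_add power_tendsto_0_at_right) auto
    ultimately have "0 \<le> H t" using le_of_tendsto_at_right[of H 0 t "H t"] t by simp
    then have "0 \<le> t ^ (N - 1) * (W t + A * exp \<beta> / real N * t)"
      unfolding H_def power_N by (simp add: algebra_simps)
    moreover have "t ^ (N - 1) > 0" using t by simp
    ultimately have "0 \<le> W t + A * exp \<beta> / real N * t" by (meson zero_le_mult_iff not_le)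
    then show ?thesis by simp
  qed
  then show "- (A * exp \<beta> / real N * r) \<le> W r" using r by simp
  define K where "K = (\<lambda>t. V t + A * exp \<beta> / (2 * real N) * t ^ 2)"
  have "K s \<le> K r" if s: "0 < s" "s < r" for s
  proof (rule nondecreasing_from_derivative[where f=K])
    show "(K has_real_derivative W t + A * exp \<beta> / real N * t) (at t within {0<..1})" if "t \<in> {0<..1}" for t
      unfolding K_def by (rule derivative_eq_intros profileD(1)[OF pr(1) that] refl | simp)+
    show "W t + A * exp \<beta> / real N * t \<ge> 0" if "s < t" "t < r" for t
      using Wge[of t] that s r by simp
  qed (use s r in auto)
  moreover have "(K \<longlongrightarrow> \<beta> + 0) (at_right 0)"
    unfolding K_def by (intro tendsto_add lim power_tendsto_0_at_right) simp
  ultimately have "\<beta> \<le> K r" using le_of_tendsto_at_right[of K \<beta> r "K r"] r by simp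
  then show "\<beta> - A * exp \<beta> / (2 * real N) * r\<^sup>2 \<le> V r" by (simp add: K_def)
qed

text \<open>The radius \<open>exp (- \<beta> / 2)\<close> is where the rescaled solution leaves its boundary layer at the origin.\<close>

lemma regular_energy:
  "\<exists>E0. \<forall>V W \<beta>. profile V W \<longrightarrow> no_flux W \<longrightarrow> (V \<longlongrightarrow> \<beta>) (at_right 0) \<longrightarrow> 0 \<le> \<beta> \<longrightarrow>
     energy V W (exp (- \<beta> / 2)) \<le> E0"
proof (rule exI[of _ "B\<^sup>2 / 2 + 2 * m * (X - 1 + A / (2 * real N) + ln (2 * m))"], intro allI impI)
  fix V W \<beta> assume pr: "profile V W" "no_flux W" and lim: "(V \<longlongrightarrow> \<beta>) (at_right 0)" and \<beta>: "0 \<le> \<beta>"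
  define r where "r = exp (- \<beta> / 2)"
  have r: "r \<in> {0<..1}" using \<beta> by (simp add: r_def)
  have "r\<^sup>2 = exp (- \<beta>)" unfolding r_def by (simp add: power2_eq_square exp_add[symmetric])
  then have "exp \<beta> * r\<^sup>2 = 1" by (simp add: exp_minus)
  then have "A * exp \<beta> / (2 * real N) * r\<^sup>2 = A / (2 * real N)"
    by (metis mult.assoc mult.right_neutral times_divide_eq_left)
  then have "\<beta> - A / (2 * real N) \<le> V r" using regular_bounds(3)[OF pr lim r] by (simp only:)
  moreover have "2 * ln r = - \<beta>" by (simp add: r_def)
  ultimately have "- eta V r \<le> A / (2 * real N) + ln (2 * m)" unfolding eta_def by linarith
  moreover have ap: "exp (eta V r) \<le> X" "\<bar>slope W r\<bar> \<le> B" using a_priori[OF pr r] by auto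
  ultimately have "2 * m * (exp (eta V r) - 1 - eta V r) \<le> 2 * m * (X - 1 + A / (2 * real N) + ln (2 * m))"
    using m_ge_1 by (intro mult_left_mono) auto
  moreover have "(slope W r)\<^sup>2 \<le> B\<^sup>2" using ap(2) by (rule abs_le_square_iff[THEN iffD1, OF order_trans]) simp
  ultimately show "energy V W (exp (- \<beta> / 2)) \<le> B\<^sup>2 / 2 + 2 * m * (X - 1 + A / (2 * real N) + ln (2 * m))"
    unfolding r_def[symmetric] energy_def by argo
qed

section \<open>The limit of the regular solutions\<close>

definition rhs :: "(real \<Rightarrow> real) \<Rightarrow> (real \<Rightarrow> real) \<Rightarrow> real \<Rightarrow> real" where
  "rhs V W r = - (a r * exp (V r)) - (real N - 1) / r * W r"

lemma rhs_uniform_limit: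
  assumes \<delta>: "0 < \<delta>" "\<delta> \<le> 1"
    and lim: "uniform_limit {\<delta>..1} V V0 F" "uniform_limit {\<delta>..1} W W0 F"
    and bd: "\<And>i r. r \<in> {\<delta>..1} \<Longrightarrow> exp (V i r) \<le> C" "\<And>r. r \<in> {\<delta>..1} \<Longrightarrow> exp (V0 r) \<le> C"
  shows "uniform_limit {\<delta>..1} (\<lambda>i. rhs (V i) (W i)) (rhs V0 W0) F"
proof (rule uniform_limitI)
  fix e :: real assume e: "e > 0"
  \<comment> \<open>A Lipschitz constant of \<open>rhs\<close> on [\<delta>,1] plus 1; the extra 1
    makes the final inequality strict.\<close>
  define k where "k = A * \<bar>C\<bar> + (real N - 1) / \<delta> + 1"
  have N1: "real N - 1 \<ge> 0" using N3 by simp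
  have k: "k > 0" using A_pos N1 \<delta> by (simp add: k_def add_nonneg_pos)
  define d where "d = e / k"
  have d: "d > 0" using e k by (simp add: d_def)
  have "\<forall>\<^sub>F i in F. \<forall>r\<in>{\<delta>..1}. dist (V i r) (V0 r) < d" "\<forall>\<^sub>F i in F. \<forall>r\<in>{\<delta>..1}. dist (W i r) (W0 r) < d"
    using lim d by (auto simp: uniform_limit_iff)
  then show "\<forall>\<^sub>F i in F. \<forall>r\<in>{\<delta>..1}. dist (rhs (V i) (W i) r) (rhs V0 W0 r) < e"
  proof eventually_elim
    case (elim i)
    show ?case
    proof
      fix r assume r: "r \<in> {\<delta>..1}"
      have V: "\<bar>V i r - V0 r\<bar> \<le> d" "\<bar>W i r - W0 r\<bar> \<le> d" using elim r by (auto simp: dist_real_def less_imp_le)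
      have "\<bar>exp (V i r) - exp (V0 r)\<bar> \<le> C * \<bar>V i r - V0 r\<bar>"
        by (rule exp_Lipschitz[OF bd(1)[OF r] bd(2)[OF r]])
      also have "\<dots> \<le> \<bar>C\<bar> * d" using V by (intro mult_mono) auto
      finally have "\<bar>a r * (exp (V i r) - exp (V0 r))\<bar> \<le> A * (\<bar>C\<bar> * d)"
        unfolding abs_mult using a_le[of r] a0_le[of r] a0_pos r \<delta> by (intro mult_mono) auto
      moreover have "\<bar>(real N - 1) / r * (W i r - W0 r)\<bar> \<le> (real N - 1) / \<delta> * d"
        unfolding abs_mult using V r \<delta> N1 by (intro mult_mono) (auto simp: frac_le)
      moreover have "rhs (V i) (W i) r - rhs V0 W0 r = - (a r * (exp (V i r) - exp (V0 r))) - (real N - 1) / r * (W i r - W0 r)"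
        by (simp add: rhs_def right_diff_distrib)
      ultimately have "\<bar>rhs (V i) (W i) r - rhs V0 W0 r\<bar> \<le> A * (\<bar>C\<bar> * d) + (real N - 1) / \<delta> * d" by argo
      also have "\<dots> = k * d - d" by (simp add: k_def algebra_simps)
      also have "\<dots> < e" using d k by (simp add: d_def)
      finally show "dist (rhs (V i) (W i) r) (rhs V0 W0 r) < e" by (simp add: dist_real_def)
    qed
  qed
qed

text \<open>Two solutions with \<beta>1 \<le> \<beta>2 are compared from r0 = exp (- \<beta>1 / 2).
  The second has bounded energy at the smaller radius exp (- \<beta>2 / 2), and
  \<open>energy_growth\<close> carries the bound out to \<open>r0\<close>. The contraction then is a
  Cauchy estimate, uniform on [\<delta>,1] once r0 \<le> \<delta>.\<close>

lemma limit_profile: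
  fixes V W :: "real \<Rightarrow> real \<Rightarrow> real"
  assumes pr: "\<And>\<beta>. profile (V \<beta>) (W \<beta>)" "\<And>\<beta>. no_flux (W \<beta>)" and ini: "\<And>\<beta>. (V \<beta> \<longlongrightarrow> \<beta>) (at_right 0)"
  obtains V0 W0 E0 where "profile V0 W0" "no_flux W0" "\<And>r. r \<in> {0<..1} \<Longrightarrow> energy V0 W0 r \<le> E0"
    "\<And>\<delta>. 0 < \<delta> \<Longrightarrow> \<delta> \<le> 1 \<Longrightarrow> uniform_limit {\<delta>..1} V V0 at_top"
    "\<And>\<delta>. 0 < \<delta> \<Longrightarrow> \<delta> \<le> 1 \<Longrightarrow> uniform_limit {\<delta>..1} W W0 at_top"
    "\<And>\<delta>. 0 < \<delta> \<Longrightarrow> \<delta> \<le> 1 \<Longrightarrow> uniform_limit {\<delta>..1} (\<lambda>\<beta>. rhs (V \<beta>) (W \<beta>)) (rhs V0 W0) at_top"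
proof -
  obtain E1 where E1: "\<And>\<beta>. 0 \<le> \<beta> \<Longrightarrow> energy (V \<beta>) (W \<beta>) (exp (- \<beta> / 2)) \<le> E1"
    using regular_energy pr ini by blast
  have E: "energy (V \<beta>) (W \<beta>) r \<le> E1 + C1" if "0 \<le> \<beta>" "exp (- \<beta> / 2) \<le> r" "r \<le> 1" for \<beta> r
    using energy_growth[OF pr exp_gt_zero that(2,3)] E1[OF that(1)] by (rule order_trans[OF _ add_right_mono])
  obtain K where K: "K \<ge> 0" and con: "\<And>V1 W1 V2 W2 r0 r. profile V1 W1 \<Longrightarrow> no_flux W1 \<Longrightarrow> profile V2 W2 \<Longrightarrow> no_flux W2 \<Longrightarrow>
     0 < r0 \<Longrightarrow> r0 \<le> r \<Longrightarrow> r \<le> 1 \<Longrightarrow> energy V1 W1 r0 \<le> E1 + C1 \<Longrightarrow> energy V2 W2 r0 \<le> E1 + C1 \<Longrightarrow>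
     (V1 r - V2 r)\<^sup>2 + (r * (W1 r - W2 r))\<^sup>2 \<le> K * (r0 / r) powr (1 / 3)"
    using contraction[of "E1 + C1"] by blast
  define D where "D = (\<lambda>\<delta> \<beta>. sqrt (K * (exp (- \<beta> / 2) / \<delta>) powr (1 / 3)))"
  have close: "\<bar>V \<beta>1 r - V \<beta>2 r\<bar> \<le> D \<delta> \<beta>1 \<and> \<bar>W \<beta>1 r - W \<beta>2 r\<bar> \<le> D \<delta> \<beta>1 / \<delta>"
    if \<delta>: "0 < \<delta>" "\<delta> \<le> 1" and \<beta>: "max 0 (- 2 * ln \<delta>) \<le> \<beta>1" "\<beta>1 \<le> \<beta>2" and r: "r \<in> {\<delta>..1}" for \<delta> \<beta>1 \<beta>2 r
  proof -
    define r0 where "r0 = exp (- \<beta>1 / 2)"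
    have b0: "0 \<le> \<beta>1" using \<beta>(1) by (rule order_trans[OF max.cobounded1])
    have "- \<beta>1 / 2 \<le> ln \<delta>" using \<beta> by simp
    then have r0: "0 < r0" "r0 \<le> \<delta>" using \<delta> by (simp_all add: r0_def ln_ge_iff)
    have "(V \<beta>1 r - V \<beta>2 r)\<^sup>2 + (r * (W \<beta>1 r - W \<beta>2 r))\<^sup>2 \<le> K * (r0 / r) powr (1 / 3)"
    proof (rule con[OF pr(1,2) pr(1,2) r0(1)])
      show "energy (V \<beta>1) (W \<beta>1) r0 \<le> E1 + C1" by (rule E) (use \<beta> b0 r0 \<delta> in \<open>auto simp: r0_def\<close>)
      show "energy (V \<beta>2) (W \<beta>2) r0 \<le> E1 + C1" by (rule E) (use \<beta> b0 r0 \<delta> in \<open>auto simp: r0_def\<close>)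
    qed (use r r0 in auto)
    also have "\<dots> \<le> K * (r0 / \<delta>) powr (1 / 3)"
      using K r r0 \<delta> by (intro mult_left_mono powr_mono2 divide_left_mono) auto
    finally have sum: "(V \<beta>1 r - V \<beta>2 r)\<^sup>2 + (r * (W \<beta>1 r - W \<beta>2 r))\<^sup>2 \<le> K * (r0 / \<delta>) powr (1 / 3)" .
    have "(V \<beta>1 r - V \<beta>2 r)\<^sup>2 \<le> K * (r0 / \<delta>) powr (1 / 3)" "(r * (W \<beta>1 r - W \<beta>2 r))\<^sup>2 \<le> K * (r0 / \<delta>) powr (1 / 3)"
      using sum zero_le_power2[of "V \<beta>1 r - V \<beta>2 r"] zero_le_power2[of "r * (W \<beta>1 r - W \<beta>2 r)"] by linarith+
    then have 1: "\<bar>V \<beta>1 r - V \<beta>2 r\<bar> \<le> D \<delta> \<beta>1" and 2: "\<bar>r * (W \<beta>1 r - W \<beta>2 r)\<bar> \<le> D \<delta> \<beta>1"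
      unfolding D_def r0_def[symmetric] by (metis real_sqrt_abs real_sqrt_le_mono)+
    have "\<delta> * \<bar>W \<beta>1 r - W \<beta>2 r\<bar> \<le> r * \<bar>W \<beta>1 r - W \<beta>2 r\<bar>" using r by (intro mult_right_mono) auto
    also have "\<dots> = \<bar>r * (W \<beta>1 r - W \<beta>2 r)\<bar>" using r \<delta> by (simp add: abs_mult)
    finally have "\<bar>W \<beta>1 r - W \<beta>2 r\<bar> \<le> D \<delta> \<beta>1 / \<delta>" using 2 \<delta> by (simp add: field_simps)
    with 1 show ?thesis by blast
  qed
  have D0: "(D \<delta> \<longlongrightarrow> 0) at_top" if "0 < \<delta>" for \<delta>
  proof -
    have "((\<lambda>\<beta>::real. exp (- \<beta> / 2)) \<longlongrightarrow> 0) at_top"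
      by real_asymp
    then have "((\<lambda>\<beta>. exp (- \<beta> / 2) / \<delta>) \<longlongrightarrow> 0 / \<delta>) at_top" using that by (intro tendsto_intros) auto
    then have "((\<lambda>\<beta>. (exp (- \<beta> / 2) / \<delta>) powr (1/3)) \<longlongrightarrow> 0) at_top"
      using that by (intro tendsto_zero_powrI[where b="1/3"]) auto
    then have "((\<lambda>\<beta>. sqrt (K * (exp (- \<beta> / 2) / \<delta>) powr (1/3))) \<longlongrightarrow> sqrt (K * 0)) at_top"
      by (intro tendsto_intros)
    then show ?thesis by (simp add: D_def)
  qed
  obtain V0 where V0: "\<And>\<delta>. 0 < \<delta> \<Longrightarrow> \<delta> \<le> 1 \<Longrightarrow> uniform_limit {\<delta>..1} V V0 at_top"
  proof -
    have "\<exists>g. \<forall>\<delta>. 0 < \<delta> \<longrightarrow> \<delta> \<le> 1 \<longrightarrow> uniform_limit {\<delta>..1} V g at_top"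
    proof (rule uniform_limit_Cauchy_at_top)
      fix \<delta> :: real assume "0 < \<delta>" "\<delta> \<le> 1"
      then show "\<exists>D \<beta>0. (D \<longlongrightarrow> 0) at_top \<and> (\<forall>\<beta>1\<ge>\<beta>0. \<forall>\<beta>2\<ge>\<beta>1. \<forall>r\<in>{\<delta>..1}. \<bar>V \<beta>1 r - V \<beta>2 r\<bar> \<le> D \<beta>1)"
        using D0 close by (intro exI[of _ "D \<delta>"] exI[of _ "max 0 (- 2 * ln \<delta>)"]) blast
    qed
    then show ?thesis using that by blast
  qed
  obtain W0 where W0: "\<And>\<delta>. 0 < \<delta> \<Longrightarrow> \<delta> \<le> 1 \<Longrightarrow> uniform_limit {\<delta>..1} W W0 at_top"
  proof -
    have "\<exists>g. \<forall>\<delta>. 0 < \<delta> \<longrightarrow> \<delta> \<le> 1 \<longrightarrow> uniform_limit {\<delta>..1} W g at_top"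
    proof (rule uniform_limit_Cauchy_at_top)
      fix \<delta> :: real assume \<delta>: "0 < \<delta>" "\<delta> \<le> 1"
      have "((\<lambda>\<beta>. D \<delta> \<beta> / \<delta>) \<longlongrightarrow> 0 / \<delta>) at_top" using \<delta> by (intro tendsto_intros D0) auto
      then show "\<exists>D \<beta>0. (D \<longlongrightarrow> 0) at_top \<and> (\<forall>\<beta>1\<ge>\<beta>0. \<forall>\<beta>2\<ge>\<beta>1. \<forall>r\<in>{\<delta>..1}. \<bar>W \<beta>1 r - W \<beta>2 r\<bar> \<le> D \<beta>1)"
        using close[OF \<delta>] by (intro exI[of _ "\<lambda>\<beta>. D \<delta> \<beta> / \<delta>"] exI[of _ "max 0 (- 2 * ln \<delta>)"]) auto
    qed
    then show ?thesis using that by blast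
  qed
  have ptV: "((\<lambda>\<beta>. V \<beta> r) \<longlongrightarrow> V0 r) at_top" and ptW: "((\<lambda>\<beta>. W \<beta> r) \<longlongrightarrow> W0 r) at_top" if "r \<in> {0<..1}" for r
    using tendsto_uniform_limitI[OF V0[of r], of r] tendsto_uniform_limitI[OF W0[of r], of r] that by auto
  have expb: "exp (V \<beta> r) \<le> M / \<delta>\<^sup>2" if "0 < \<delta>" "\<delta> \<le> r" "r \<le> 1" for \<beta> \<delta> r
  proof -
    have "r\<^sup>2 * exp (V \<beta> r) \<le> M" by (rule exp_upper_bound[OF pr(1) flux_nonpos[OF pr]]) (use that in auto)
    moreover have "\<delta>\<^sup>2 * exp (V \<beta> r) \<le> r\<^sup>2 * exp (V \<beta> r)" using that by (intro mult_right_mono power_mono) auto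
    ultimately have "\<delta>\<^sup>2 * exp (V \<beta> r) \<le> M" by linarith
    then show ?thesis using that by (simp add: field_simps)
  qed
  have expb0: "exp (V0 r) \<le> M / \<delta>\<^sup>2" if "0 < \<delta>" "\<delta> \<le> r" "r \<le> 1" for \<delta> r
    by (rule tendsto_upperbound[OF tendsto_exp[OF ptV]]) (use that expb in auto)
  have rhs0: "uniform_limit {\<delta>..1} (\<lambda>\<beta>. rhs (V \<beta>) (W \<beta>)) (rhs V0 W0) at_top" if "0 < \<delta>" "\<delta> \<le> 1" for \<delta>
    by (rule rhs_uniform_limit[OF that V0[OF that] W0[OF that], of "M / \<delta>\<^sup>2"]) (use that expb expb0 in auto)
  have seqV: "(\<lambda>n. V (real n) r) \<longlonglongrightarrow> V0 r" and seqW: "(\<lambda>n. W (real n) r) \<longlonglongrightarrow> W0 r" if "r \<in> {0<..1}" for r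
    by (rule filterlim_compose[OF ptV[OF that] filterlim_real_sequentially],
        rule filterlim_compose[OF ptW[OF that] filterlim_real_sequentially])
  have "profile V0 W0"
    unfolding profile_def
  proof (intro ballI conjI)
    fix r :: real assume r: "r \<in> {0<..1}"
    show "(V0 has_real_derivative W0 r) (at r within {0<..1})"
      by (rule derivative_uniform_limit[where f="\<lambda>n. V (real n)" and f'="\<lambda>n. W (real n)", OF profileD(1)[OF pr(1)] seqV _ r])
        (assumption | rule filterlim_compose[OF W0 filterlim_real_sequentially])+
    have "(W0 has_real_derivative rhs V0 W0 r) (at r within {0<..1})"
      by (rule derivative_uniform_limit[where f="\<lambda>n. W (real n)" and f'="\<lambda>n. rhs (V (real n)) (W (real n))",
            OF profileD(2)[OF pr(1), folded rhs_def] seqW _ r])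
        (assumption | rule filterlim_compose[OF rhs0 filterlim_real_sequentially])+
    then show "(W0 has_real_derivative - (a r * exp (V0 r)) - (real N - 1) / r * W0 r) (at r within {0<..1})"
      by (simp add: rhs_def)
  qed
  \<comment> \<open>Pointwise limits need not preserve \<open>no_flux\<close>; what passes to the
    limit is the uniform bound |r W| \<le> B + 2.\<close>
  moreover have "no_flux W0"
  proof (rule no_flux_if_bounded)
    fix r :: real assume r: "r \<in> {0<..1}"
    have "\<bar>r * W \<beta> r\<bar> \<le> B + 2" for \<beta>
      using a_priori(2)[OF pr(1)[of \<beta>] pr(2)[of \<beta>] r] unfolding slope_def by (simp add: abs_le_iff)
    then show "\<bar>r * W0 r\<bar> \<le> B + 2"
      by (intro tendsto_upperbound[OF tendsto_rabs[OF tendsto_mult[OF tendsto_const ptW[OF r]]]]) auto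
  qed
  moreover have "energy V0 W0 r \<le> E1 + C1" if r: "r \<in> {0<..1}" for r
  proof (rule tendsto_upperbound)
    show "((\<lambda>\<beta>. energy (V \<beta>) (W \<beta>) r) \<longlongrightarrow> energy V0 W0 r) at_top"
      unfolding energy_def slope_def eta_def by (intro tendsto_intros ptV ptW r) simp
    show "\<forall>\<^sub>F \<beta> in at_top. energy (V \<beta>) (W \<beta>) r \<le> E1 + C1"
      using eventually_ge_at_top[of "max 0 (- 2 * ln r)"]
    proof eventually_elim
      case (elim \<beta>)
      then have "- \<beta> / 2 \<le> ln r" by simp
      then have "exp (- \<beta> / 2) \<le> r" using r by (simp add: ln_ge_iff)
      then show ?case using E[of \<beta> r] elim r by simp
    qed
  qed simp
  ultimately show ?thesis using V0 W0 rhs0 that by blast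
qed

subsection \<open>The initial value problem\<close>

text \<open>\<open>potential h\<close> is the radial function with Laplacian \<open>h\<close> that
  vanishes at 0 together with its derivative, and \<open>mean_flux h\<close> is that derivative. At
  s = 0 the quotient is 0 by the convention for division, which is the correct value.\<close>

definition mean_flux :: "(real \<Rightarrow> real) \<Rightarrow> real \<Rightarrow> real" where
  "mean_flux h s = integral {0..s} (\<lambda>t. t ^ (N - 1) * h t) / s ^ (N - 1)"

definition potential :: "(real \<Rightarrow> real) \<Rightarrow> real \<Rightarrow> real" where
  "potential h r = integral {0..r} (mean_flux h)"

lemma weighted_integrable:
  fixes h :: "real \<Rightarrow> real"
  assumes "continuous_on {0..1} h" "s \<in> {0..1}"
  shows "(\<lambda>t. t ^ (N - 1) * h t) integrable_on {0..s}"
proof -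
  have "continuous_on {0..s} h" by (rule continuous_on_subset[OF assms(1)]) (use assms(2) in auto)
  then show ?thesis by (intro integrable_continuous_real continuous_intros)
qed

lemma mean_flux_derivative:
  assumes h: "continuous_on {0..1} h" and s: "s \<in> {0<..1}"
  shows "(mean_flux h has_real_derivative h s - (real N - 1) / s * mean_flux h s) (at s within {0..1})"
proof -
  define J where "J = (\<lambda>s. integral {0..s} (\<lambda>t. t ^ (N - 1) * h t))"
  have dJ: "(J has_real_derivative s ^ (N - 1) * h s) (at s within {0..1})"
    unfolding J_def by (rule integral_has_real_derivative) (use s h in \<open>auto intro!: continuous_intros\<close>)
  have "((\<lambda>s. J s / s ^ (N - 1)) has_real_derivative
     (s ^ (N - 1) * h s * s ^ (N - 1) - J s * ((real N - 1) * s ^ (N - 2))) / (s ^ (N - 1) * s ^ (N - 1))) (at s within {0..1})"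
    by (rule DERIV_divide[OF dJ power_N_minus_1_derivative]) (use s in simp)
  moreover have "(s ^ (N - 1) * h s * s ^ (N - 1) - J s * ((real N - 1) * s ^ (N - 2))) / (s ^ (N - 1) * s ^ (N - 1))
     = h s - (real N - 1) / s * (J s / s ^ (N - 1))"
    using s unfolding power_N_minus_1 by (simp add: field_simps)
  ultimately show ?thesis by (simp add: mean_flux_def[abs_def] J_def)
qed

lemma weight_has_integral:
  fixes s b :: real
  assumes "0 \<le> s"
  shows "((\<lambda>t. t ^ (N - 1) * b) has_integral b * s ^ N / real N) {0..s}"
proof -
  have "((\<lambda>t. t ^ (N - 1) * b) has_integral b * s ^ N / real N - b * 0 ^ N / real N) {0..s}"
    by (rule fundamental_theorem_of_calculus)
      (use assms N3 in \<open>auto intro!: derivative_eq_intros simp: has_real_derivative_iff_has_vector_derivative[symmetric]\<close>)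
  then show ?thesis using N3 by (simp add: power_0_left)
qed

lemma weighted_integral_bound:
  assumes h: "continuous_on {0..1} h" and b: "\<And>t. t \<in> {0..s} \<Longrightarrow> \<bar>h t\<bar> \<le> b" and s: "s \<in> {0..1}"
  shows "\<bar>integral {0..s} (\<lambda>t. t ^ (N - 1) * h t)\<bar> \<le> b * s ^ N / real N"
proof -
  have I: "((\<lambda>t. t ^ (N - 1) * b) has_integral b * s ^ N / real N) {0..s}"
    using weight_has_integral s by simp
  have "norm (integral {0..s} (\<lambda>t. t ^ (N - 1) * h t)) \<le> integral {0..s} (\<lambda>t. t ^ (N - 1) * b)"
    by (rule integral_norm_bound_integral[OF weighted_integrable[OF h s] has_integral_integrable[OF I]])
      (use b in \<open>auto simp: abs_mult intro!: mult_left_mono\<close>)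
  also have "\<dots> = b * s ^ N / real N" by (rule integral_unique[OF I])
  finally show ?thesis by simp
qed

text \<open>For constant \<open>h\<close> the mean flux is exactly h s / N. Subtracting
  \<open>h 0\<close> leaves an integrand that is small near 0 by continuity.\<close>

lemma mean_flux_derivative_0:
  assumes h: "continuous_on {0..1} h"
  shows "(mean_flux h has_real_derivative h 0 / real N) (at 0 within {0..1})"
proof -
  have eq: "mean_flux h s - h 0 / real N * s = integral {0..s} (\<lambda>t. t ^ (N - 1) * (h t - h 0)) / s ^ (N - 1)"
    if s: "s \<in> {0<..1}" for s
  proof -
    have I: "((\<lambda>t. t ^ (N - 1) * h 0) has_integral h 0 * s ^ N / real N) {0..s}"
      using weight_has_integral s by simp
    have "integral {0..s} (\<lambda>t. t ^ (N - 1) * h t - t ^ (N - 1) * h 0)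
        = integral {0..s} (\<lambda>t. t ^ (N - 1) * h t) - integral {0..s} (\<lambda>t. t ^ (N - 1) * h 0)"
      by (rule Henstock_Kurzweil_Integration.integral_diff[OF weighted_integrable[OF h] has_integral_integrable[OF I]]) (use s in auto)
    then have "integral {0..s} (\<lambda>t. t ^ (N - 1) * (h t - h 0)) = integral {0..s} (\<lambda>t. t ^ (N - 1) * h t) - h 0 * s ^ N / real N"
      using integral_unique[OF I] by (simp add: right_diff_distrib)
    then show ?thesis using s power_N[of s] by (simp add: mean_flux_def field_simps)
  qed
  have "((\<lambda>s. (mean_flux h s - mean_flux h 0) / (s - 0)) \<longlongrightarrow> h 0 / real N) (at 0 within {0..1})"
  proof (rule tendstoI)
    fix e :: real assume e: "e > 0"
    have "\<exists>d>0. \<forall>t\<in>{0..1}. dist t 0 < d \<longrightarrow> dist (h t) (h 0) < e"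
      using h[unfolded continuous_on_iff, rule_format, of 0 e] e by simp
    then obtain d where d: "d > 0" "\<And>t. t \<in> {0..1} \<Longrightarrow> dist t 0 < d \<Longrightarrow> dist (h t) (h 0) < e"
      by blast
    have "dist ((mean_flux h s - mean_flux h 0) / (s - 0)) (h 0 / real N) < e" if s: "s \<in> {0..1}" "s \<noteq> 0" "dist s 0 < d" for s
    proof -
      have s1: "s \<in> {0<..1}" using s by auto
      have "\<bar>integral {0..s} (\<lambda>t. t ^ (N - 1) * (h t - h 0))\<bar> \<le> e * s ^ N / real N"
      proof (rule weighted_integral_bound[OF _ _ s(1)])
        show "continuous_on {0..1} (\<lambda>t. h t - h 0)" by (intro continuous_intros h)
        show "\<bar>h t - h 0\<bar> \<le> e" if "t \<in> {0..s}" for t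
          using d(2)[of t] that s by (auto simp: dist_real_def)
      qed
      then have "\<bar>integral {0..s} (\<lambda>t. t ^ (N - 1) * (h t - h 0))\<bar> / s ^ (N - 1) \<le> (e * s ^ N / real N) / s ^ (N - 1)"
        by (rule divide_right_mono) (use s1 in simp)
      then have "\<bar>mean_flux h s - h 0 / real N * s\<bar> \<le> (e * s ^ N / real N) / s ^ (N - 1)"
        unfolding eq[OF s1] abs_divide using s1 by simp
      also have "\<dots> = e / real N * s"
        using s1 power_N[of s] by simp
      finally have "\<bar>mean_flux h s - h 0 / real N * s\<bar> / s \<le> e / real N"
        using s1 by (simp only: pos_divide_le_eq greaterThanAtMost_iff)
      moreover have "mean_flux h s / s - h 0 / real N = (mean_flux h s - h 0 / real N * s) / s"
        using s1 by (simp add: diff_divide_distrib)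
      ultimately have "\<bar>mean_flux h s / s - h 0 / real N\<bar> \<le> e / real N" using s1 by (simp only: abs_divide) simp
      also have "\<dots> < e" using e N3 by (simp add: divide_less_eq)
      finally show ?thesis using N3 by (simp add: mean_flux_def[of _ 0] dist_real_def)
    qed
    then show "\<forall>\<^sub>F s in at 0 within {0..1}. dist ((mean_flux h s - mean_flux h 0) / (s - 0)) (h 0 / real N) < e"
      using d(1) by (auto simp: eventually_at intro!: exI[of _ d])
  qed
  then show ?thesis by (simp add: has_field_derivative_iff)
qed

lemma continuous_mean_flux:
  assumes "continuous_on {0..1} h"
  shows "continuous_on {0..1} (mean_flux h)"
  unfolding continuous_on_eq_continuous_within
proof
  fix s :: real assume s: "s \<in> {0..1}"
  show "continuous (at s within {0..1}) (mean_flux h)"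
    using DERIV_continuous[OF mean_flux_derivative_0[OF assms]] DERIV_continuous[OF mean_flux_derivative[OF assms, of s]] s
    by (cases "s = 0") auto
qed

lemma potential_derivative:
  assumes "continuous_on {0..1} h" "r \<in> {0..1}"
  shows "(potential h has_real_derivative mean_flux h r) (at r within {0..1})"
  unfolding potential_def[abs_def] by (rule integral_has_real_derivative[OF continuous_mean_flux[OF assms(1)] assms(2)])

lemma integral_exp_le:
  fixes k D s :: real
  assumes k: "k > 0" and D: "D \<ge> 0" and s: "0 \<le> s"
  shows "(\<lambda>t. D * exp (k * t)) integrable_on {0..s}" "integral {0..s} (\<lambda>t. D * exp (k * t)) \<le> D * exp (k * s) / k"
proof -
  have I: "((\<lambda>t. D * exp (k * t)) has_integral D * exp (k * s) / k - D * exp (k * 0) / k) {0..s}"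
    by (rule fundamental_theorem_of_calculus)
      (use k s in \<open>auto intro!: derivative_eq_intros simp: has_real_derivative_iff_has_vector_derivative[symmetric]\<close>)
  then show "(\<lambda>t. D * exp (k * t)) integrable_on {0..s}" by (rule has_integral_integrable)
  show "integral {0..s} (\<lambda>t. D * exp (k * t)) \<le> D * exp (k * s) / k"
    using integral_unique[OF I] k D by simp
qed

text \<open>In the norm weighted by exp (- k t) each of the two integrations gains a factor 1 / k,
  because t^(N-1) / s^(N-1) \<le> 1. A large k thus turns any Lipschitz nonlinearity into a
  contraction.\<close>

lemma potential_bound:
  assumes h: "continuous_on {0..1} h" and k: "k > 0" and D: "D \<ge> 0"
    and b: "\<And>t. t \<in> {0..1} \<Longrightarrow> \<bar>h t\<bar> \<le> D * exp (k * t)" and r: "r \<in> {0..1}"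
  shows "\<bar>potential h r\<bar> \<le> D / k\<^sup>2 * exp (k * r)"
proof -
  have G: "\<bar>mean_flux h s\<bar> \<le> D / k * exp (k * s)" if s: "s \<in> {0..1}" for s
  proof (cases "s = 0")
    case True
    then show ?thesis using N3 k D by (simp add: mean_flux_def)
  next
    case False
    have int: "(\<lambda>t. s ^ (N - 1) * (D * exp (k * t))) integrable_on {0..s}"
      using integrable_cmul[OF integral_exp_le(1)[OF k D, of s], of "s ^ (N - 1)"] s by simp
    have "norm (integral {0..s} (\<lambda>t. t ^ (N - 1) * h t)) \<le> integral {0..s} (\<lambda>t. s ^ (N - 1) * (D * exp (k * t)))"
      by (rule integral_norm_bound_integral[OF weighted_integrable[OF h s] int])
        (use b s in \<open>auto simp: abs_mult intro!: mult_mono power_mono\<close>)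
    also have "\<dots> = s ^ (N - 1) * integral {0..s} (\<lambda>t. D * exp (k * t))" by simp
    also have "\<dots> \<le> s ^ (N - 1) * (D * exp (k * s) / k)"
      using integral_exp_le(2)[OF k D, of s] s by (intro mult_left_mono) auto
    finally show ?thesis using s False by (simp add: mean_flux_def abs_divide divide_le_eq mult_ac)
  qed
  have "norm (integral {0..r} (mean_flux h)) \<le> integral {0..r} (\<lambda>s. D / k * exp (k * s))"
    by (rule integral_norm_bound_integral[OF integrable_continuous_real[OF continuous_on_subset[OF continuous_mean_flux[OF h]]]
          integral_exp_le(1)[OF k]])
      (use r k D G in auto)
  also have "\<dots> \<le> D / k * exp (k * r) / k"
    by (rule integral_exp_le(2)[OF k]) (use k D r in auto)
  finally show ?thesis by (simp add: potential_def power2_eq_square)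
qed

lemma potential_diff:
  assumes "continuous_on {0..1} h1" "continuous_on {0..1} h2" "r \<in> {0..1}"
  shows "potential h1 r - potential h2 r = potential (\<lambda>t. h1 t - h2 t) r"
proof -
  have G: "mean_flux (\<lambda>t. h1 t - h2 t) s = mean_flux h1 s - mean_flux h2 s" if "s \<in> {0..1}" for s
    using Henstock_Kurzweil_Integration.integral_diff[OF weighted_integrable[OF assms(1) that] weighted_integrable[OF assms(2) that]]
    by (simp add: mean_flux_def right_diff_distrib diff_divide_distrib)
  have "potential (\<lambda>t. h1 t - h2 t) r = integral {0..r} (\<lambda>s. mean_flux h1 s - mean_flux h2 s)"
    unfolding potential_def by (rule Henstock_Kurzweil_Integration.integral_cong) (use G assms(3) in auto)
  also have "\<dots> = potential h1 r - potential h2 r"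
    unfolding potential_def
    by (intro Henstock_Kurzweil_Integration.integral_diff integrable_continuous_real
        continuous_on_subset[OF continuous_mean_flux] assms) (use assms(3) in auto)
  finally show ?thesis by simp
qed

lemma potential_nonneg:
  assumes "continuous_on {0..1} h" "\<And>t. t \<in> {0..1} \<Longrightarrow> h t \<ge> 0" "r \<in> {0..1}"
  shows "potential h r \<ge> 0"
proof -
  have "mean_flux h s \<ge> 0" if "s \<in> {0..1}" for s
    unfolding mean_flux_def using that assms(2)
    by (intro divide_nonneg_nonneg Henstock_Kurzweil_Integration.integral_nonneg weighted_integrable[OF assms(1)]) auto
  then show ?thesis
    unfolding potential_def using assms(3)
    by (intro Henstock_Kurzweil_Integration.integral_nonneg integrable_continuous_real
        continuous_on_subset[OF continuous_mean_flux[OF assms(1)]]) auto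
qed

text \<open>The initial value problem integrated twice, which removes the singular coefficient (N -
  1) / r. Picard iteration and comparison work on this form; it is shown below to be equivalent to
  \<open>initial_value_solution\<close>.\<close>

definition integral_solution :: "real \<Rightarrow> (real \<Rightarrow> real) \<Rightarrow> bool" where
  "integral_solution \<beta> w \<longleftrightarrow> continuous_on {0..1} w \<and>
     (\<forall>r\<in>{0..1}. w r = \<beta> - potential (\<lambda>t. a t * exp (w t)) r)"

lemma continuous_reaction: "continuous_on {0..1} w \<Longrightarrow> continuous_on {0..1} (\<lambda>t. a t * exp (w t))"
  by (intro continuous_intros cont_a)

lemma integral_solution_derivatives:
  assumes "integral_solution \<beta> w"
  defines "G \<equiv> mean_flux (\<lambda>t. a t * exp (w t))"
  shows "r \<in> {0..1} \<Longrightarrow> (w has_real_derivative - G r) (at r within {0..1})"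
    and "r \<in> {0<..1} \<Longrightarrow> ((\<lambda>r. - G r) has_real_derivative - (a r * exp (w r)) - (real N - 1) / r * (- G r)) (at r within {0..1})"
    and "((\<lambda>r. - G r) has_real_derivative - (a 0 * exp (w 0) / real N)) (at 0 within {0..1})"
proof -
  have w: "continuous_on {0..1} w" and eq: "\<And>r. r \<in> {0..1} \<Longrightarrow> w r = \<beta> - potential (\<lambda>t. a t * exp (w t)) r"
    using assms(1) by (auto simp: integral_solution_def)
  note h = continuous_reaction[OF w]
  show "(w has_real_derivative - G r) (at r within {0..1})" if r: "r \<in> {0..1}"
  proof -
    have "((\<lambda>r. \<beta> - potential (\<lambda>t. a t * exp (w t)) r) has_real_derivative - G r) (at r within {0..1})"
      unfolding G_def using potential_derivative[OF h r] by (auto intro!: derivative_eq_intros)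
    then show ?thesis
      unfolding has_field_derivative_def by (rule has_derivative_transform[OF r, rotated]) (rule eq)
  qed
  show "((\<lambda>r. - G r) has_real_derivative - (a r * exp (w r)) - (real N - 1) / r * (- G r)) (at r within {0..1})"
    if "r \<in> {0<..1}"
    using DERIV_minus[OF mean_flux_derivative[OF h that]] by (simp add: G_def)
  show "((\<lambda>r. - G r) has_real_derivative - (a 0 * exp (w 0) / real N)) (at 0 within {0..1})"
    unfolding G_def by (rule DERIV_minus[OF mean_flux_derivative_0[OF h]])
qed

text \<open>Away from 0 this is differentiation of the formula. The delicate point is the continuity
  of w'' at 0, where (N - 1) w' / r tends to (N - 1) w''(0).\<close>

lemma initial_value_solution_if_integral_solution:
  assumes sol: "integral_solution \<beta> w"
  shows "initial_value_solution N a \<beta> w"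
proof -
  define G where "G = mean_flux (\<lambda>t. a t * exp (w t))"
  note d = integral_solution_derivatives[OF sol, folded G_def]
  have w: "continuous_on {0..1} w" using sol by (simp add: integral_solution_def)
  have G0: "G 0 = 0" using N3 by (simp add: G_def mean_flux_def)
  define f'' where "f'' = (\<lambda>r. if r = 0 then - (a 0 * exp (w 0) / real N) else - (a r * exp (w r)) - (real N - 1) / r * (- G r))"
  have d2: "((\<lambda>r. - G r) has_real_derivative f'' r) (at r within {0..1})" if "r \<in> {0..1}" for r
    using d(2)[of r] d(3) that by (auto simp: f''_def)
  have "continuous_on {0..1} f''"
    unfolding continuous_on_def
  proof
    fix r :: real assume r: "r \<in> {0..1}"
    show "(f'' \<longlongrightarrow> f'' r) (at r within {0..1})"
    proof (cases "r = 0")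
      case True
      have G: "((\<lambda>s. (- G s - - G 0) / (s - 0)) \<longlongrightarrow> - (a 0 * exp (w 0) / real N)) (at 0 within {0..1})"
        using d(3) by (simp only: has_field_derivative_iff)
      have R: "((\<lambda>s. a s * exp (w s)) \<longlongrightarrow> a 0 * exp (w 0)) (at 0 within {0..1})"
        using continuous_reaction[OF w] by (simp add: continuous_on_def)
      have "((\<lambda>s. - (a s * exp (w s)) - (real N - 1) * ((- G s - - G 0) / (s - 0))) \<longlongrightarrow>
          - (a 0 * exp (w 0)) - (real N - 1) * (- (a 0 * exp (w 0) / real N))) (at 0 within {0..1})"
        by (rule tendsto_diff[OF tendsto_minus[OF R] tendsto_mult_left[OF G]])
      \<comment> \<open>With h = a(0) e^w(0) this is - h + (N - 1) h / N = - h / N, so the limit is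
        the second derivative at 0.\<close>
      moreover have "- (a 0 * exp (w 0)) - (real N - 1) * (- (a 0 * exp (w 0) / real N)) = f'' 0"
        using N3 by (simp add: f''_def field_simps)
      ultimately have "((\<lambda>s. - (a s * exp (w s)) - (real N - 1) * ((- G s - - G 0) / (s - 0))) \<longlongrightarrow> f'' 0) (at 0 within {0..1})"
        by simp
      then show ?thesis
        unfolding True by (rule Lim_transform_eventually) (auto simp: eventually_at_filter f''_def G0)
    next
      case False
      have "((\<lambda>s. - (a s * exp (w s)) - (real N - 1) / s * (- G s)) \<longlongrightarrow> - (a r * exp (w r)) - (real N - 1) / r * (- G r)) (at r within {0..1})"
      proof (rule tendsto_diff[OF tendsto_minus tendsto_mult[OF tendsto_divide[OF tendsto_const tendsto_ident_at False] tendsto_minus]])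
        show "((\<lambda>s. a s * exp (w s)) \<longlongrightarrow> a r * exp (w r)) (at r within {0..1})"
          using continuous_reaction[OF w] r by (simp add: continuous_on_def)
        show "(G \<longlongrightarrow> G r) (at r within {0..1})"
          using continuous_mean_flux[OF continuous_reaction[OF w]] r by (simp add: continuous_on_def G_def)
      qed
      moreover have "\<forall>\<^sub>F s in at r within {0..1}. s \<noteq> 0"
        using False by (intro eventually_neq_at_within)
      then have "\<forall>\<^sub>F s in at r within {0..1}. - (a s * exp (w s)) - (real N - 1) / s * (- G s) = f'' s"
        by eventually_elim (simp add: f''_def)
      ultimately show ?thesis
        using False by (auto simp: f''_def[of] intro: Lim_transform_eventually)
    qed
  qed
  note C2 = C2_onI[OF at_within_Icc_neq_bot d(1) d2 this]
  have "w 0 = \<beta>" using sol by (simp add: integral_solution_def potential_def)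
  moreover have "- radial_laplacian N {0..1} w r = a r * exp (w r)" if "r \<in> {0<..1}" for r
    using C2(2,3)[of r] that by (simp add: radial_laplacian_def f''_def)
  moreover have "rderiv {0..1} w 0 = 0" using C2(2)[of 0] G0 by simp
  ultimately show ?thesis using C2(1) by (simp add: initial_value_solution_def)
qed

text \<open>- t^(N-1) w' is an antiderivative of t^(N-1) a e^w on all of [0,1]; at t = 0 the
  derivative and the integrand both vanish. Applying the fundamental theorem twice gives the
  integral equation.\<close>

lemma integral_solution_if_initial_value_solution:
  assumes "initial_value_solution N a \<beta> w"
  shows "integral_solution \<beta> w"
proof -
  define w1 where "w1 = rderiv {0..1} w"
  define w2 where "w2 = rderiv {0..1} w1"
  have C2: "w differentiable_on {0..1}" "w1 differentiable_on {0..1}"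
    and ode: "\<And>r. r \<in> {0<..1} \<Longrightarrow> w2 r = - (a r * exp (w r)) - (real N - 1) / r * w1 r"
    and w0: "w 0 = \<beta>" "w1 0 = 0"
    using assms by (force simp: initial_value_solution_def C2_on_def w1_def w2_def radial_laplacian_def)+
  have d1: "(w has_real_derivative w1 r) (at r within {0..1})" and d2: "(w1 has_real_derivative w2 r) (at r within {0..1})"
    if "r \<in> {0..1}" for r
    unfolding w1_def w2_def
    using differentiable_on_rderiv[OF C2(1) that at_within_Icc_neq_bot[OF that]]
      differentiable_on_rderiv[OF C2(2) that at_within_Icc_neq_bot[OF that]] by (auto simp: w1_def)
  have cw: "continuous_on {0..1} w" using C2(1) by (rule differentiable_imp_continuous_on)
  note h = continuous_reaction[OF cw]
  have dflux: "((\<lambda>t. - (t ^ (N - 1) * w1 t)) has_real_derivative t ^ (N - 1) * (a t * exp (w t))) (at t within {0..1})"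
    if t: "t \<in> {0..1}" for t
  proof -
    have "- ((real N - 1) * t ^ (N - 2) * w1 t + w2 t * t ^ (N - 1)) = t ^ (N - 1) * (a t * exp (w t))"
    proof (cases "t = 0")
      case True
      then show ?thesis using N3 w0 by (simp add: power_0_left)
    next
      case False
      then have "t \<in> {0<..1}" using t by auto
      then show ?thesis unfolding ode[OF \<open>t \<in> {0<..1}\<close>] power_N_minus_1 by (simp add: field_simps)
    qed
    then show ?thesis using DERIV_minus[OF DERIV_mult[OF power_N_minus_1_derivative d2[OF t]]] by simp
  qed
  have w1: "w1 s = - mean_flux (\<lambda>t. a t * exp (w t)) s" if s: "s \<in> {0..1}" for s
  proof (cases "s = 0")
    case True
    then show ?thesis using N3 w0 by (simp add: mean_flux_def)
  next
    case False
    have "((\<lambda>t. t ^ (N - 1) * (a t * exp (w t))) has_integral - (s ^ (N - 1) * w1 s) - - (0 ^ (N - 1) * w1 0)) {0..s}"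
    proof (rule fundamental_theorem_of_calculus)
      fix t assume t: "t \<in> {0..s}"
      have "((\<lambda>t. - (t ^ (N - 1) * w1 t)) has_real_derivative t ^ (N - 1) * (a t * exp (w t))) (at t within {0..s})"
        by (rule DERIV_subset[OF dflux]) (use t s in auto)
      then show "((\<lambda>t. - (t ^ (N - 1) * w1 t)) has_vector_derivative t ^ (N - 1) * (a t * exp (w t))) (at t within {0..s})"
        by (simp add: has_real_derivative_iff_has_vector_derivative)
    qed (use s in auto)
    then have "integral {0..s} (\<lambda>t. t ^ (N - 1) * (a t * exp (w t))) = - (s ^ (N - 1) * w1 s)"
      using w0 by (simp add: integral_unique)
    then show ?thesis using False s by (simp add: mean_flux_def)
  qed
  have "w r = \<beta> - potential (\<lambda>t. a t * exp (w t)) r" if r: "r \<in> {0..1}" for r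
  proof -
    have "((\<lambda>s. mean_flux (\<lambda>t. a t * exp (w t)) s) has_integral - w r - - w 0) {0..r}"
    proof (rule fundamental_theorem_of_calculus)
      fix t assume t: "t \<in> {0..r}"
      have "((\<lambda>t. - w t) has_real_derivative - w1 t) (at t within {0..r})"
        by (rule DERIV_subset[OF DERIV_minus[OF d1]]) (use t r in auto)
      then show "((\<lambda>t. - w t) has_vector_derivative mean_flux (\<lambda>t. a t * exp (w t)) t) (at t within {0..r})"
        using w1[of t] t r by (simp add: has_real_derivative_iff_has_vector_derivative)
    qed (use r in auto)
    then show ?thesis using w0 by (simp add: integral_unique potential_def)
  qed
  then show ?thesis using cw by (simp add: integral_solution_def)
qed

lemma integral_solution_le:
  assumes "integral_solution \<beta> w" "r \<in> {0..1}"
  shows "w r \<le> \<beta>"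
proof -
  have "potential (\<lambda>t. a t * exp (w t)) r \<ge> 0"
  proof (rule potential_nonneg[OF continuous_reaction _ assms(2)])
    show "continuous_on {0..1} w" using assms(1) by (simp add: integral_solution_def)
    show "a t * exp (w t) \<ge> 0" if "t \<in> {0..1}" for t using a0_le[OF that] a0_pos by simp
  qed
  then show ?thesis using assms by (simp add: integral_solution_def)
qed

text \<open>Picard iteration for the nonlinearity truncated at \<open>b\<close>, a contraction for the norm weighted by \<open>exp (- k r)\<close>.\<close>

lemma truncated_difference:
  fixes y1 y2 :: "real \<Rightarrow> real"
  assumes y: "continuous_on {0..1} y1" "continuous_on {0..1} y2" and k: "k > 0" "A * exp b \<le> q * k\<^sup>2" and D: "D \<ge> 0"
    and d: "\<And>t. t \<in> {0..1} \<Longrightarrow> \<bar>y1 t - y2 t\<bar> \<le> D * exp (k * t)" and r: "r \<in> {0..1}"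
  shows "\<bar>potential (\<lambda>t. a t * exp (min (y1 t) b)) r - potential (\<lambda>t. a t * exp (min (y2 t) b)) r\<bar> \<le> q * D * exp (k * r)"
proof -
  have c: "continuous_on {0..1} (\<lambda>t. a t * exp (min (y1 t) b))" "continuous_on {0..1} (\<lambda>t. a t * exp (min (y2 t) b))"
    by (intro continuous_intros cont_a y)+
  have "\<bar>a t * exp (min (y1 t) b) - a t * exp (min (y2 t) b)\<bar> \<le> (A * exp b * D) * exp (k * t)" if t: "t \<in> {0..1}" for t
  proof -
    have "\<bar>exp (min (y1 t) b) - exp (min (y2 t) b)\<bar> \<le> exp b * \<bar>min (y1 t) b - min (y2 t) b\<bar>"
      by (rule exp_Lipschitz) auto
    also have "\<dots> \<le> exp b * (D * exp (k * t))"
      using d[OF t] by (intro mult_left_mono) auto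
    finally have "\<bar>a t\<bar> * \<bar>exp (min (y1 t) b) - exp (min (y2 t) b)\<bar> \<le> A * (exp b * (D * exp (k * t)))"
      using a_le[OF t] a0_le[OF t] a0_pos by (intro mult_mono) auto
    then show ?thesis by (simp add: abs_mult[symmetric] right_diff_distrib mult_ac)
  qed
  then have "\<bar>potential (\<lambda>t. a t * exp (min (y1 t) b) - a t * exp (min (y2 t) b)) r\<bar> \<le> (A * exp b * D) / k\<^sup>2 * exp (k * r)"
    using A_pos D by (intro potential_bound[OF _ k(1) _ _ r] continuous_intros c) auto
  also have "\<dots> \<le> q * D * exp (k * r)"
  proof (rule mult_right_mono)
    have "A * exp b * D \<le> q * k\<^sup>2 * D" using k D by (intro mult_right_mono) auto
    then show "A * exp b * D / k\<^sup>2 \<le> q * D" using k by (simp add: divide_le_eq mult_ac)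
  qed simp
  finally show ?thesis by (simp add: potential_diff[OF c r])
qed

text \<open>Truncation makes the nonlinearity globally Lipschitz. The fixed point lies below \<beta>
  because the potential of a nonnegative function is nonnegative, so the truncation is inactive on
  it.\<close>

lemma integral_solution_exists: "\<exists>w. integral_solution \<beta> w"
proof -
  \<comment> \<open>\<open>k\<close> \<ge> 1 and \<open>k\<close> \<ge> 2 A e^\<beta> give A
    e^\<beta> \<le> k^2 / 2, which is the contraction factor 1/2.\<close>
  define k where "k = max 1 (2 * A * exp \<beta>)"
  have k: "k \<ge> 1" "2 * A * exp \<beta> \<le> k" by (auto simp: k_def)
  have kk: "k > 0" "A * exp \<beta> \<le> (1/2) * k\<^sup>2"
  proof -
    show "k > 0" using k by simp
    have "k * 1 \<le> k * k" using k by (intro mult_left_mono) auto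
    then have "2 * A * exp \<beta> \<le> k\<^sup>2" using k(2) by (simp add: power2_eq_square)
    then show "A * exp \<beta> \<le> (1/2) * k\<^sup>2" by argo
  qed
  define T where "T = (\<lambda>y r. \<beta> - potential (\<lambda>t. a t * exp (min (y t) \<beta>)) r)"
  have cT: "continuous_on {0..1} (T y)" if "continuous_on {0..1} y" for y
  proof -
    have "continuous_on {0..1} (\<lambda>t. a t * exp (min (y t) \<beta>))" by (intro continuous_intros cont_a that)
    from potential_derivative[OF this] have "continuous_on {0..1} (potential (\<lambda>t. a t * exp (min (y t) \<beta>)))"
      by (rule DERIV_continuous_on)
    then show ?thesis unfolding T_def by (intro continuous_intros)
  qed
  have T_diff: "\<bar>T y1 r - T y2 r\<bar> \<le> (1/2) * D * exp (k * r)"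
    if "continuous_on {0..1} y1" "continuous_on {0..1} y2" "D \<ge> 0" "\<And>t. t \<in> {0..1} \<Longrightarrow> \<bar>y1 t - y2 t\<bar> \<le> D * exp (k * t)" "r \<in> {0..1}"
    for y1 y2 D r
    using truncated_difference[OF that(1,2) kk that(3,4,5)] by (simp add: T_def abs_minus_commute)
  define Y where "Y = (\<lambda>n. (T ^^ n) (\<lambda>_. \<beta>))"
  have Y0: "Y 0 = (\<lambda>_. \<beta>)" and YS: "Y (Suc n) = T (Y n)" for n by (simp_all add: Y_def)
  have cY: "continuous_on {0..1} (Y n)" for n by (induction n) (auto simp: Y0 YS cT)
  have dY: "\<bar>Y (Suc n) r - Y n r\<bar> \<le> (1/2) ^ n * exp (k * r)" if "r \<in> {0..1}" for n r
    using that
  proof (induction n arbitrary: r)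
    case 0
    have "\<bar>potential (\<lambda>t. a t * exp \<beta>) r\<bar> \<le> (A * exp \<beta>) / k\<^sup>2 * exp (k * r)"
    proof (rule potential_bound[OF _ kk(1) _ _ 0])
      show "continuous_on {0..1} (\<lambda>t. a t * exp \<beta>)" by (intro continuous_intros cont_a)
      show "\<bar>a t * exp \<beta>\<bar> \<le> A * exp \<beta> * exp (k * t)" if t: "t \<in> {0..1}" for t
      proof -
        have "\<bar>a t * exp \<beta>\<bar> * 1 \<le> (A * exp \<beta>) * exp (k * t)"
          using a_le[OF t] a0_le[OF t] a0_pos kk t A_pos by (intro mult_mono) auto
        then show ?thesis by simp
      qed
    qed (use A_pos in simp)
    also have "\<dots> \<le> 1 * exp (k * r)"
    proof (rule mult_right_mono)
      have "A * exp \<beta> \<le> k\<^sup>2" using kk(2) zero_le_power2[of k] by linarith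
      then show "A * exp \<beta> / k\<^sup>2 \<le> 1" using kk(1) by simp
    qed simp
    finally show ?case by (simp add: YS Y0 T_def)
  next
    case (Suc n)
    have "\<bar>T (Y (Suc n)) r - T (Y n) r\<bar> \<le> (1/2) * (1/2) ^ n * exp (k * r)"
      by (rule T_diff[OF cY cY _ Suc.IH Suc.prems]) auto
    then show ?case unfolding YS[of "Suc n"] YS[of n] by (simp add: YS)
  qed
  \<comment> \<open>The iterates are the partial sums of a telescoping series, which a geometric
    series majorizes.\<close>
  define y where "y = (\<lambda>r. \<beta> + (\<Sum>i. Y (Suc i) r - Y i r))"
  have "uniform_limit {0..1} (\<lambda>n r. \<Sum>i<n. Y (Suc i) r - Y i r) (\<lambda>r. \<Sum>i. Y (Suc i) r - Y i r) sequentially"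
  proof (rule Weierstrass_m_test)
    show "norm (Y (Suc n) r - Y n r) \<le> exp k * (1/2) ^ n" if "r \<in> {0..1}" for n r
    proof -
      have "k * r \<le> k * 1" using that kk by (intro mult_left_mono) auto
      then have "(1/2) ^ n * exp (k * r) \<le> (1/2) ^ n * exp k" by (intro mult_left_mono) auto
      from order_trans[OF dY[OF that] this] show ?thesis by (simp add: mult.commute)
    qed
    show "summable (\<lambda>n. exp k * (1/2) ^ n)" by (intro summable_mult summable_geometric) simp
  qed
  then have lim: "uniform_limit {0..1} Y y sequentially"
  proof -
    have Yn: "Y n r = \<beta> + (\<Sum>i<n. Y (Suc i) r - Y i r)" for n r
      using sum_lessThan_telescope[of "\<lambda>i. Y i r" n] by (simp add: Y0)
    assume "uniform_limit {0..1} (\<lambda>n r. \<Sum>i<n. Y (Suc i) r - Y i r) (\<lambda>r. \<Sum>i. Y (Suc i) r - Y i r) sequentially"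
    then have "uniform_limit {0..1} (\<lambda>n r. \<beta> + (\<Sum>i<n. Y (Suc i) r - Y i r)) y sequentially"
      unfolding y_def by (intro uniform_limit_add uniform_limit_const)
    then show ?thesis by (simp add: Yn[symmetric])
  qed
  have cy: "continuous_on {0..1} y"
    by (rule uniform_limit_theorem[OF _ lim]) (auto simp: cY)
  have fix': "y r = T y r" if r: "r \<in> {0..1}" for r
  proof (rule LIMSEQ_unique)
    show "(\<lambda>n. Y (Suc n) r) \<longlonglongrightarrow> y r"
      by (rule LIMSEQ_Suc, rule tendsto_uniform_limitI[OF lim r])
    show "(\<lambda>n. Y (Suc n) r) \<longlonglongrightarrow> T y r"
    proof (rule tendstoI)
      fix e :: real assume e: "e > 0"
      define d where "d = e / exp k"
      have d: "d > 0" using e by (simp add: d_def)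
      have "\<forall>\<^sub>F n in sequentially. \<forall>t\<in>{0..1}. dist (Y n t) (y t) < d"
        using lim d by (simp add: uniform_limit_iff)
      then show "\<forall>\<^sub>F n in sequentially. dist (Y (Suc n) r) (T y r) < e"
      proof eventually_elim
        case (elim n)
        have "\<bar>Y n t - y t\<bar> \<le> d * exp (k * t)" if t: "t \<in> {0..1}" for t
        proof -
          have "d * 1 \<le> d * exp (k * t)" using d kk t by (intro mult_left_mono) auto
          then show ?thesis using elim t by (force simp: dist_real_def)
        qed
        then have "\<bar>T (Y n) r - T y r\<bar> \<le> (1/2) * d * exp (k * r)"
          using d by (intro T_diff[OF cY cy _ _ r]) auto
        also have "\<dots> \<le> (1/2) * d * exp k"
          using r kk d mult_left_mono[of r 1 k] by (intro mult_left_mono) auto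
        also have "\<dots> < e" using e by (simp add: d_def)
        finally show ?case by (simp add: dist_real_def YS)
      qed
    qed
  qed
  have "potential (\<lambda>t. a t * exp (min (y t) \<beta>)) r \<ge> 0" if "r \<in> {0..1}" for r
    using a0_le a0_pos that by (intro potential_nonneg continuous_intros cont_a cy) (force intro: less_imp_le)+
  then have "y t \<le> \<beta>" if "t \<in> {0..1}" for t using fix'[OF that] that by (simp add: T_def)
  then have eq: "potential (\<lambda>t. a t * exp (min (y t) \<beta>)) r = potential (\<lambda>t. a t * exp (y t)) r" if "r \<in> {0..1}" for r
    unfolding potential_def mean_flux_def using that
    by (intro Henstock_Kurzweil_Integration.integral_cong arg_cong2[where f="(/)"]) (auto simp: min_absorb1)
  have "integral_solution \<beta> y"
    unfolding integral_solution_def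
  proof (intro conjI ballI)
    show "y r = \<beta> - potential (\<lambda>t. a t * exp (y t)) r" if "r \<in> {0..1}" for r
      using fix'[OF that] unfolding T_def eq[OF that] .
  qed (rule cy)
  then show ?thesis by blast
qed

text \<open>Let D be the maximum of |w1 - w2| exp (- k t). The equations give |(w1 - w2) - (\<beta>1
  - \<beta>2)| \<le> q D exp (k s), and at the point of maximum this becomes D (1 - q) \<le>
  |\<beta>1 - \<beta>2|.\<close>

lemma integral_solution_difference:
  assumes sol: "integral_solution \<beta>1 w1" "integral_solution \<beta>2 w2" and b: "\<beta>1 \<le> b" "\<beta>2 \<le> b"
    and k: "k > 0" "A * exp b \<le> q * k\<^sup>2" and q: "0 \<le> q" "q < 1" and r: "r \<in> {0..1}"
  shows "\<bar>(w1 r - w2 r) - (\<beta>1 - \<beta>2)\<bar> \<le> q / (1 - q) * \<bar>\<beta>1 - \<beta>2\<bar> * exp k"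
proof -
  have c: "continuous_on {0..1} w1" "continuous_on {0..1} w2" using sol by (auto simp: integral_solution_def)
  have trunc: "potential (\<lambda>t. a t * exp (w t)) s = potential (\<lambda>t. a t * exp (min (w t) b)) s"
    if "integral_solution \<beta> w" "\<beta> \<le> b" "s \<in> {0..1}" for \<beta> w s
    unfolding potential_def mean_flux_def using that integral_solution_le[OF that(1)]
    by (intro Henstock_Kurzweil_Integration.integral_cong arg_cong2[where f="(/)"]) (force simp: min_absorb1)+
  have "continuous_on {0..1} (\<lambda>t. \<bar>w1 t - w2 t\<bar> * exp (- (k * t)))" by (intro continuous_intros c)
  then obtain ts where ts: "ts \<in> {0..1}" "\<And>t. t \<in> {0..1} \<Longrightarrow> \<bar>w1 t - w2 t\<bar> * exp (- (k * t)) \<le> \<bar>w1 ts - w2 ts\<bar> * exp (- (k * ts))"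
    using continuous_attains_sup[OF compact_Icc, of 0 1 "\<lambda>t. \<bar>w1 t - w2 t\<bar> * exp (- (k * t))"] by auto
  define D where "D = \<bar>w1 ts - w2 ts\<bar> * exp (- (k * ts))"
  have D: "D \<ge> 0" by (simp add: D_def)
  have Dt: "\<bar>w1 t - w2 t\<bar> \<le> D * exp (k * t)" if "t \<in> {0..1}" for t
  proof -
    have "\<bar>w1 t - w2 t\<bar> = (\<bar>w1 t - w2 t\<bar> * exp (- (k * t))) * exp (k * t)" by (simp add: exp_minus)
    also have "\<dots> \<le> D * exp (k * t)" unfolding D_def by (rule mult_right_mono[OF ts(2)[OF that]]) simp
    finally show ?thesis .
  qed
  have diff: "\<bar>(w1 s - w2 s) - (\<beta>1 - \<beta>2)\<bar> \<le> q * D * exp (k * s)" if s: "s \<in> {0..1}" for s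
  proof -
    have "(w1 s - w2 s) - (\<beta>1 - \<beta>2) = - (potential (\<lambda>t. a t * exp (min (w1 t) b)) s - potential (\<lambda>t. a t * exp (min (w2 t) b)) s)"
      using sol s trunc[OF sol(1) b(1) s] trunc[OF sol(2) b(2) s] by (simp add: integral_solution_def)
    then show ?thesis
      using truncated_difference[OF c k D Dt s] by (simp only: abs_minus_cancel)
  qed
  have Dle: "D \<le> \<bar>\<beta>1 - \<beta>2\<bar> / (1 - q)"
  proof -
    define E where "E = exp (k * ts)"
    have E: "E \<ge> 1" using k ts by (simp add: E_def)
    have "\<bar>w1 ts - w2 ts\<bar> = D * E" by (simp add: D_def E_def exp_minus)
    then have "D * E \<le> \<bar>\<beta>1 - \<beta>2\<bar> + q * D * E" using diff[OF ts(1)] unfolding E_def[symmetric] by linarith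
    then have "(D * (1 - q)) * E \<le> \<bar>\<beta>1 - \<beta>2\<bar>" by (simp add: algebra_simps)
    moreover have "(D * (1 - q)) * 1 \<le> (D * (1 - q)) * E" using D q E by (intro mult_left_mono) auto
    ultimately show ?thesis using q by (simp add: pos_le_divide_eq)
  qed
  have "\<bar>(w1 r - w2 r) - (\<beta>1 - \<beta>2)\<bar> \<le> q * D * exp (k * r)" by (rule diff[OF r])
  also have "\<dots> \<le> q * (\<bar>\<beta>1 - \<beta>2\<bar> / (1 - q)) * exp k"
    using q D Dle r k mult_left_mono[of r 1 k] by (intro mult_mono) auto
  finally show ?thesis by simp
qed

subsection \<open>The bifurcation curve\<close>

lemma v_sol_solution: "integral_solution \<beta> (v_sol N a \<beta>)"
proof -
  obtain w where "integral_solution \<beta> w" using integral_solution_exists by blast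
  then have "initial_value_solution N a \<beta> w" by (rule initial_value_solution_if_integral_solution)
  then have "initial_value_solution N a \<beta> (v_sol N a \<beta>)" 
    unfolding v_sol_def by (rule someI[where P="initial_value_solution N a \<beta>"])
  then show ?thesis by (rule integral_solution_if_initial_value_solution)
qed

definition v' :: "real \<Rightarrow> real \<Rightarrow> real" where
  "v' \<beta> r = - mean_flux (\<lambda>t. a t * exp (v_sol N a \<beta> t)) r"

lemma v_sol_continuous: "continuous_on {0..1} (v_sol N a \<beta>)"
  using v_sol_solution by (simp add: integral_solution_def)

lemma v_sol_profile: "profile (v_sol N a \<beta>) (v' \<beta>)"
  unfolding profile_def
proof (intro ballI conjI)
  fix r :: real assume r: "r \<in> {0<..1}"
  note d = integral_solution_derivatives[OF v_sol_solution[of \<beta>], folded v'_def]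
  show "(v_sol N a \<beta> has_real_derivative v' \<beta> r) (at r within {0<..1})"
    by (rule DERIV_subset[OF d(1)]) (use r in auto)
  have "(v' \<beta> has_real_derivative - (a r * exp (v_sol N a \<beta> r)) - (real N - 1) / r * v' \<beta> r) (at r within {0..1})"
    using d(2)[OF r] by (simp add: v'_def[abs_def])
  then show "(v' \<beta> has_real_derivative - (a r * exp (v_sol N a \<beta> r)) - (real N - 1) / r * v' \<beta> r) (at r within {0<..1})"
    by (rule DERIV_subset) auto
qed

lemma v_sol_no_flux: "no_flux (v' \<beta>)"
proof -
  have "continuous_on {0..1} (v' \<beta>)"
    unfolding v'_def by (intro continuous_intros continuous_mean_flux continuous_reaction v_sol_continuous)
  then have "bounded ((\<lambda>r. r * v' \<beta> r) ` {0..1})"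
    by (intro compact_imp_bounded compact_continuous_image continuous_intros) auto
  then obtain b where "\<forall>r\<in>{0..1}. \<bar>r * v' \<beta> r\<bar> \<le> b" unfolding bounded_iff by auto
  then show ?thesis by (intro no_flux_if_bounded[of _ b]) auto
qed

lemma v_sol_initial: "(v_sol N a \<beta> \<longlongrightarrow> \<beta>) (at_right 0)"
proof -
  have "v_sol N a \<beta> 0 = \<beta>" using v_sol_solution[of \<beta>] by (simp add: integral_solution_def potential_def)
  moreover have "(v_sol N a \<beta> \<longlongrightarrow> v_sol N a \<beta> 0) (at 0 within {0..1})"
    using v_sol_continuous[of \<beta>] by (simp add: continuous_on_def)
  ultimately show ?thesis by (simp add: at_within_Icc_at_right)
qed

lemma ln_lam: "ln (lam N a \<beta>) = v_sol N a \<beta> 1"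
  by (simp add: lam_def)

lemma alpha_eq: "alpha N a \<beta> = \<beta> - v_sol N a \<beta> 1"
  by (simp add: alpha_def ln_lam)

lemma v_sol_1_le: "v_sol N a \<beta> 1 \<le> \<beta>"
  using integral_solution_le[OF v_sol_solution] by simp

lemma alpha_le: "alpha N a \<beta> \<le> A * exp \<beta> / (2 * real N)"
  using regular_bounds(3)[OF v_sol_profile v_sol_no_flux v_sol_initial, of 1 \<beta>] by (simp add: alpha_eq)

text \<open>On each half line \<beta> < b the difference estimate with q = 1/2 is a Lipschitz bound,
  with a constant depending on b.\<close>

lemma v_sol_1_continuous: "continuous_on S (\<lambda>\<beta>. v_sol N a \<beta> 1)"
proof -
  have "continuous_on {..<b} (\<lambda>\<beta>. v_sol N a \<beta> 1)" for b
  proof -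
    define k where "k = max 1 (2 * A * exp b)"
    have k: "k \<ge> 1" "2 * A * exp b \<le> k" by (auto simp: k_def)
    have "k * 1 \<le> k * k" using k by (intro mult_left_mono) auto
    then have "2 * A * exp b \<le> k\<^sup>2" using k(2) by (simp add: power2_eq_square)
    then have kk: "A * exp b \<le> (1/2) * k\<^sup>2" by argo
    have "\<bar>v_sol N a \<beta>1 1 - v_sol N a \<beta>2 1\<bar> \<le> (1 + exp k) * \<bar>\<beta>1 - \<beta>2\<bar>" if "\<beta>1 < b" "\<beta>2 < b" for \<beta>1 \<beta>2
    proof -
      have "\<bar>(v_sol N a \<beta>1 1 - v_sol N a \<beta>2 1) - (\<beta>1 - \<beta>2)\<bar> \<le> (1/2) / (1 - 1/2) * \<bar>\<beta>1 - \<beta>2\<bar> * exp k"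
        by (rule integral_solution_difference[OF v_sol_solution v_sol_solution _ _ _ kk]) (use that k in auto)
      also have "\<dots> = exp k * \<bar>\<beta>1 - \<beta>2\<bar>" by simp
      finally have "\<bar>v_sol N a \<beta>1 1 - v_sol N a \<beta>2 1\<bar> \<le> \<bar>\<beta>1 - \<beta>2\<bar> + exp k * \<bar>\<beta>1 - \<beta>2\<bar>" by argo
      then show ?thesis by (simp add: distrib_right)
    qed
    then have "(1 + exp k)-lipschitz_on {..<b} (\<lambda>\<beta>. v_sol N a \<beta> 1)"
      by (intro lipschitz_onI) (auto simp: dist_real_def add_nonneg_nonneg)
    then show ?thesis by (rule lipschitz_on_continuous_on)
  qed
  then have "isCont (\<lambda>\<beta>. v_sol N a \<beta> 1) \<beta>" for \<beta>
    using continuous_on_eq_continuous_at[of "{..<\<beta> + 1}" "\<lambda>\<beta>. v_sol N a \<beta> 1"] by auto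
  then show ?thesis by (simp add: continuous_at_imp_continuous_on)
qed

text \<open>With k = 1 and q = 1/5 the factor q e^k / (1 - q) is e / 4 \<le> 3/4, so v(1, .) differs
  from the identity by a map with Lipschitz constant below 1.\<close>

lemma v_sol_1_inj:
  assumes "A * exp b \<le> 1 / 5" "\<beta>1 \<le> b" "\<beta>2 \<le> b" "v_sol N a \<beta>1 1 = v_sol N a \<beta>2 1"
  shows "\<beta>1 = \<beta>2"
proof -
  have "\<bar>(v_sol N a \<beta>1 1 - v_sol N a \<beta>2 1) - (\<beta>1 - \<beta>2)\<bar> \<le> (1/5) / (1 - 1/5) * \<bar>\<beta>1 - \<beta>2\<bar> * exp 1"
    by (rule integral_solution_difference[OF v_sol_solution v_sol_solution assms(2,3)]) (use assms in auto)
  also have "\<dots> = (exp 1 / 4) * \<bar>\<beta>1 - \<beta>2\<bar>" by simp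
  also have "\<dots> \<le> (3 / 4) * \<bar>\<beta>1 - \<beta>2\<bar>" using exp_le by (intro mult_right_mono) auto
  finally have "\<bar>\<beta>1 - \<beta>2\<bar> \<le> (3 / 4) * \<bar>\<beta>1 - \<beta>2\<bar>"
    unfolding assms(4) by (simp only: diff_self diff_0 abs_minus_cancel)
  then have "\<bar>\<beta>1 - \<beta>2\<bar> \<le> 0" by argo
  then show ?thesis by simp
qed

text \<open>For \<beta> \<ge> b the values v(1, \<beta>) are bounded below, on a compact interval by
  continuity and beyond it by the limit. Small parameters thus come only from \<beta> < b, where
  v(1, .) is injective.\<close>

lemma curve_near_0:
  assumes lim: "((\<lambda>\<beta>. v_sol N a \<beta> 1) \<longlongrightarrow> c) at_top"
  shows "\<exists>lhat>0. \<forall>l. 0 < l \<and> l < lhat \<longrightarrow> (\<exists>!p. p \<in> bifurcation_curve N a \<and> fst p = l)"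
proof -
  define b where "b = ln (1 / (5 * A))"
  have b: "A * exp b \<le> 1 / 5" using A_pos by (simp add: b_def)
  have "\<forall>\<^sub>F \<beta> in at_top. v_sol N a \<beta> 1 > c - 1" by (rule order_tendstoD(1)[OF lim]) simp
  then obtain b1 where b1: "\<And>\<beta>. \<beta> \<ge> b1 \<Longrightarrow> v_sol N a \<beta> 1 > c - 1" by (auto simp: eventually_at_top_linorder)
  obtain bm where bm: "bm \<in> {b..max b b1}" "\<And>\<beta>. \<beta> \<in> {b..max b b1} \<Longrightarrow> v_sol N a bm 1 \<le> v_sol N a \<beta> 1"
    using continuous_attains_inf[OF compact_Icc, of b "max b b1" "\<lambda>\<beta>. v_sol N a \<beta> 1"] v_sol_1_continuous by auto
  define s where "s = min (c - 1) (v_sol N a bm 1)"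
  have s: "s \<le> v_sol N a \<beta> 1" if "\<beta> \<ge> b" for \<beta>
    using b1[of \<beta>] bm(2)[of \<beta>] that by (cases "\<beta> \<ge> b1") (auto simp: s_def)
  show ?thesis
  proof (intro exI[of _ "exp s"] conjI allI impI)
    show "exp s > 0" by simp
    fix l :: real assume "0 < l \<and> l < exp s"
    then have "ln l < ln (exp s)" by (subst ln_less_cancel_iff) auto
    with \<open>0 < l \<and> l < exp s\<close> have l: "0 < l" "ln l < s" by simp_all
    have below: "\<beta> < b" if "lam N a \<beta> = l" for \<beta>
      using s[of \<beta>] l ln_lam[of \<beta>] that by (cases "\<beta> < b") auto
    have "ln l \<le> b" using l s[of b] v_sol_1_le[of b] by simp
    \<comment> \<open>v(1, ln l) \<le> ln l because v(1, \<beta>) \<le> \<beta>, while v(1, b) \<ge>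
      s > ln l; the intermediate value theorem applies.\<close>
    then have "\<exists>\<beta>\<ge>ln l. \<beta> \<le> b \<and> v_sol N a \<beta> 1 = ln l"
      using l s[of b] v_sol_1_le[of "ln l"] v_sol_1_continuous by (intro IVT') auto
    then obtain \<beta> where \<beta>: "v_sol N a \<beta> 1 = ln l" by blast
    then have lam: "lam N a \<beta> = l" using l by (simp add: lam_def)
    show "\<exists>!p. p \<in> bifurcation_curve N a \<and> fst p = l"
    proof (rule ex1I[of _ "(lam N a \<beta>, alpha N a \<beta>)"])
      show "(lam N a \<beta>, alpha N a \<beta>) \<in> bifurcation_curve N a \<and> fst (lam N a \<beta>, alpha N a \<beta>) = l"
        using lam by (auto simp: bifurcation_curve_def)
      fix p assume p: "p \<in> bifurcation_curve N a \<and> fst p = l"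
      then obtain \<beta>' where \<beta>': "p = (lam N a \<beta>', alpha N a \<beta>')" by (auto simp: bifurcation_curve_def)
      then have lam': "lam N a \<beta>' = l" using p by simp
      have "v_sol N a \<beta>' 1 = v_sol N a \<beta> 1"
        using ln_lam[of \<beta>'] ln_lam[of \<beta>] unfolding lam lam' by (rule trans[OF sym])
      with b less_imp_le[OF below[OF lam']] less_imp_le[OF below[OF lam]] have "\<beta>' = \<beta>"
        by (rule v_sol_1_inj)
      then show "p = (lam N a \<beta>, alpha N a \<beta>)" using \<beta>' by simp
    qed
  qed
qed

text \<open>An upper bound on \<beta> bounds alpha by \<open>alpha_le\<close>. Conversely alpha is
  \<beta> minus a function that converges at infinity.\<close>

lemma alpha_at_top_iff:
  assumes lim: "((\<lambda>\<beta>. v_sol N a \<beta> 1) \<longlongrightarrow> c) at_top"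
  shows "filterlim (\<lambda>k. alpha N a (b k)) at_top F \<longleftrightarrow> filterlim b at_top F"
proof
  assume top: "filterlim (\<lambda>k. alpha N a (b k)) at_top F"
  show "filterlim b at_top F"
    unfolding filterlim_at_top
  proof
    fix Z
    have "\<forall>\<^sub>F k in F. A * exp Z / (2 * real N) < alpha N a (b k)"
      using top by (simp add: filterlim_at_top_dense)
    then show "\<forall>\<^sub>F k in F. Z \<le> b k"
    proof eventually_elim
      case (elim k)
      show ?case
      proof (rule ccontr)
        assume "\<not> Z \<le> b k"
        then have "A * exp (b k) / (2 * real N) \<le> A * exp Z / (2 * real N)"
          using A_pos by (intro divide_right_mono mult_left_mono) auto
        then show False using elim alpha_le[of "b k"] by linarith
      qed
    qed
  qed
next
  assume b: "filterlim b at_top F"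
  have "filterlim (alpha N a) at_top at_top"
    using filterlim_tendsto_add_at_top[OF tendsto_minus[OF lim] filterlim_ident]
    by (simp add: alpha_eq[abs_def])
  then show "filterlim (\<lambda>k. alpha N a (b k)) at_top F" using b by (rule filterlim_compose)
qed

section \<open>From profiles to the singular solution of (P)\<close>

lemma profile_continuous:
  assumes "profile V W"
  shows "continuous_on {0<..1} V" "continuous_on {0<..1} W" "continuous_on {0<..1} (rhs V W)"
proof -
  show 1: "continuous_on {0<..1} V" "continuous_on {0<..1} W"
    using DERIV_continuous_on[OF profileD(1)[OF assms]] DERIV_continuous_on[OF profileD(2)[OF assms]] by blast+
  show "continuous_on {0<..1} (rhs V W)"
    unfolding rhs_def by (intro continuous_intros 1 continuous_on_subset[OF cont_a]) auto
qed

text \<open>The constant \<open>c\<close> covers the regular and the singular solutions of (P)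
  alike; each is a profile minus its value at 1.\<close>

lemma profile_C2:
  assumes "profile V W"
  shows "C2_on {0<..1} (\<lambda>r. V r - c)" "\<And>r. r \<in> {0<..1} \<Longrightarrow> rderiv {0<..1} (\<lambda>r. V r - c) r = W r"
    "\<And>r. r \<in> {0<..1} \<Longrightarrow> rderiv {0<..1} (rderiv {0<..1} (\<lambda>r. V r - c)) r = rhs V W r"
proof -
  have "((\<lambda>r. V r - c) has_real_derivative W r) (at r within {0<..1})" if "r \<in> {0<..1}" for r
    using profileD(1)[OF assms that] by (auto intro!: derivative_eq_intros)
  note C = C2_onI[OF at_within_Ioc_neq_bot this profileD(2)[OF assms, folded rhs_def] profile_continuous(3)[OF assms]]
  show "C2_on {0<..1} (\<lambda>r. V r - c)" "\<And>r. r \<in> {0<..1} \<Longrightarrow> rderiv {0<..1} (\<lambda>r. V r - c) r = W r"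
    "\<And>r. r \<in> {0<..1} \<Longrightarrow> rderiv {0<..1} (rderiv {0<..1} (\<lambda>r. V r - c)) r = rhs V W r"
    using C by blast+
qed

lemma profile_strictly_decreasing:
  assumes pr: "profile V W" "no_flux W" and r: "0 < r" "r < 1"
  shows "V 1 < V r"
proof (rule DERIV_neg_imp_decreasing_open[OF r(2)])
  show "continuous_on {r..1} V"
    by (rule continuous_on_subset[OF profile_continuous(1)[OF pr(1)]]) (use r in auto)
  fix x assume x: "r < x" "x < 1"
  then have x1: "x \<in> {0<..1}" using r by auto
  have "(V has_real_derivative W x) (at x)"
    using profileD(1)[OF pr(1) x1] at_within_open_subset[of x "{0<..<1}" "{0<..1}"] x r by force
  moreover have "exp (V x) * a0 / real N * x > 0" using a0_pos N3 x r by simp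
  then have "W x < 0" using derivative_upper_bound[OF pr(1) flux_nonpos[OF pr] x1] by linarith
  ultimately show "\<exists>y. (V has_real_derivative y) (at x) \<and> y < 0" by blast
qed

text \<open>The equation is imposed for r < 1 only, while a profile satisfies it at 1 too. Both
  sides are continuous on (0,1], so it extends to the end point.\<close>

lemma singular_solution_profile:
  assumes sol: "singular_radial_solution N a l U"
  shows "profile (\<lambda>r. U r + ln l) (rderiv {0<..1} U)" "filterlim (\<lambda>r. U r + ln l) at_top (at_right 0)"
proof -
  define U1 where "U1 = rderiv {0<..1} U"
  define U2 where "U2 = rderiv {0<..1} U1"
  have l: "l > 0" and C2: "U differentiable_on {0<..1}" "U1 differentiable_on {0<..1}" "continuous_on {0<..1} U2"
    and top: "filterlim U at_top (at_right 0)"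
    and ode: "\<And>r. 0 < r \<Longrightarrow> r < 1 \<Longrightarrow> U2 r = - (a r * exp (U r + ln l)) - (real N - 1) / r * U1 r"
    using sol by (auto simp: singular_radial_solution_def C2_on_def U1_def U2_def radial_laplacian_def exp_add field_simps)
  show "filterlim (\<lambda>r. U r + ln l) at_top (at_right 0)"
    using filterlim_tendsto_add_at_top[OF tendsto_const top, of "ln l"] by (simp add: add.commute)
  have d1: "(U has_real_derivative U1 r) (at r within {0<..1})" and d2: "(U1 has_real_derivative U2 r) (at r within {0<..1})"
    if "r \<in> {0<..1}" for r
    unfolding U1_def U2_def
    using differentiable_on_rderiv[OF C2(1) that at_within_Ioc_neq_bot[OF that]]
      differentiable_on_rderiv[OF C2(2) that at_within_Ioc_neq_bot[OF that]] by (auto simp: U1_def)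
  define R where "R = (\<lambda>r. - (a r * exp (U r + ln l)) - (real N - 1) / r * U1 r)"
  have cR: "continuous_on {0<..1} R"
    unfolding R_def using C2(1,2)
    by (intro continuous_intros continuous_on_subset[OF cont_a] differentiable_imp_continuous_on) auto
  have one: "(1::real) \<in> {0<..1}" by simp
  have "U2 1 = R 1"
  proof (rule tendsto_unique[OF at_within_Ioc_neq_bot[OF one]])
    show "(U2 \<longlongrightarrow> U2 1) (at 1 within {0<..1})" using C2(3) one by (auto simp: continuous_on_def)
    have "(R \<longlongrightarrow> R 1) (at 1 within {0<..1})" using cR one by (auto simp: continuous_on_def)
    then show "(U2 \<longlongrightarrow> R 1) (at 1 within {0<..1})"
      by (rule Lim_transform_eventually) (auto simp: eventually_at_filter R_def ode)
  qed
  then have "U2 r = R r" if "r \<in> {0<..1}" for r using that ode[of r] by (cases "r = 1") (auto simp: R_def)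
  then show "profile (\<lambda>r. U r + ln l) (rderiv {0<..1} U)"
    unfolding profile_def U1_def[symmetric] using d1 d2
    by (auto intro!: derivative_eq_intros simp: R_def)
qed

text \<open>The function \<open>p\<close>, which is - r U'(r), is exported for
  \<open>H10_radial\<close>, where it has to be continuous up to 0.\<close>

lemma singular_solution_and_curve:
  "\<exists>lstar Ustar p.
      singular_radial_solution N a lstar Ustar \<and>
      (\<forall>l U. singular_radial_solution N a l U \<longrightarrow> l = lstar \<and> (\<forall>r\<in>{0<..1}. U r = Ustar r)) \<and>
      (lam N a \<longlongrightarrow> lstar) at_top \<and>
      C2_loc_limit {0<..1} (u_sol N a) Ustar at_top \<and>
      (\<forall>b :: nat \<Rightarrow> real. filterlim (\<lambda>k. alpha N a (b k)) at_top sequentially \<longleftrightarrow>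
          filterlim b at_top sequentially) \<and>
      (\<exists>lhat>0. \<forall>l. 0 < l \<and> l < lhat \<longrightarrow> (\<exists>!p. p \<in> bifurcation_curve N a \<and> fst p = l)) \<and>
      continuous_on {0<..1} Ustar \<and>
      continuous_on {0..1} p \<and> (\<forall>r\<in>{0..1}. p r \<ge> 0) \<and>
      (\<forall>r. 0 < r \<and> r < 1 \<longrightarrow> (Ustar has_real_derivative - p r / r) (at r)) \<and>
      (\<lambda>r. Ustar r - (- 2 * ln r + ln (2 * (real N - 2)) - ln lstar)) \<in> o[at_right 0](\<lambda>_. 1)"
proof -
  obtain V0 W0 E0 where pr: "profile V0 W0" "no_flux W0" and E: "\<And>r. r \<in> {0<..1} \<Longrightarrow> energy V0 W0 r \<le> E0"
    and limV: "\<And>\<delta>. 0 < \<delta> \<Longrightarrow> \<delta> \<le> 1 \<Longrightarrow> uniform_limit {\<delta>..1} (v_sol N a) V0 at_top"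
    and limW: "\<And>\<delta>. 0 < \<delta> \<Longrightarrow> \<delta> \<le> 1 \<Longrightarrow> uniform_limit {\<delta>..1} v' W0 at_top"
    and limR: "\<And>\<delta>. 0 < \<delta> \<Longrightarrow> \<delta> \<le> 1 \<Longrightarrow> uniform_limit {\<delta>..1} (\<lambda>\<beta>. rhs (v_sol N a \<beta>) (v' \<beta>)) (rhs V0 W0) at_top"
    by (rule limit_profile[OF v_sol_profile v_sol_no_flux v_sol_initial]) (rule that, assumption+)
  define lstar where "lstar = exp (V0 1)"
  define U where "U = (\<lambda>r. V0 r - V0 1)"
  \<comment> \<open>The value 2 is the limit of - r W0 at the origin, because
    \<open>slope W0\<close> tends to 0.\<close>
  define p where "p = (\<lambda>r. if r = 0 then 2 else - r * W0 r)"
  note C2 = profile_C2[OF pr(1), where c="V0 1", folded U_def]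
  note asym = tendsto_slope_eta_0[OF pr E]
  have lim1: "((\<lambda>\<beta>. v_sol N a \<beta> 1) \<longlongrightarrow> V0 1) at_top"
    by (rule tendsto_uniform_limitI[OF limV[of 1]]) auto
  have U_eq: "U r = eta V0 r + (- 2 * ln r + ln (2 * (real N - 2)) - ln lstar)" for r
    by (simp add: U_def eta_def m_def lstar_def)
  have "filterlim U at_top (at_right 0)"
  proof -
    have "filterlim (\<lambda>r::real. - 2 * ln r + ln (2 * (real N - 2)) - ln lstar) at_top (at_right 0)"
      by real_asymp
    from filterlim_tendsto_add_at_top[OF asym(2) this] show ?thesis by (simp add: U_eq[abs_def])
  qed
  then have "singular_radial_solution N a lstar U"
    unfolding singular_radial_solution_def
  proof (intro conjI allI impI)
    fix r :: real assume r: "0 < r \<and> r < 1"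
    then have r1: "r \<in> {0<..1}" by auto
    have "exp (U r) * lstar = exp (V0 r)" by (simp add: U_def lstar_def exp_diff)
    then show "- radial_laplacian N {0<..1} U r = lstar * a r * exp (U r)"
      unfolding radial_laplacian_def C2(2)[OF r1] C2(3)[OF r1] by (simp add: rhs_def mult_ac)
    show "U r > 0" using profile_strictly_decreasing[OF pr] r by (simp add: U_def)
  qed (use C2(1) in \<open>auto simp: U_def lstar_def\<close>)
  moreover have "l = lstar \<and> (\<forall>r\<in>{0<..1}. U' r = U r)" if sol: "singular_radial_solution N a l U'" for l U'
  proof -
    note sp = singular_solution_profile[OF sol]
    obtain E1 where E1: "\<And>r. r \<in> {0<..1} \<Longrightarrow> energy (\<lambda>r. U' r + ln l) (rderiv {0<..1} U') r \<le> E1"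
      using singular_bounded_energy[OF sp] by blast
    \<comment> \<open>Both profiles have bounded energy and hence coincide; at r = 1, where U'
      vanishes, this determines l.\<close>
    have eq: "U' r + ln l = V0 r" if "r \<in> {0<..1}" for r
      by (rule bounded_energy_unique[OF sp(1) singular_no_flux[OF sp] pr E1 E that])
    have "U' 1 = 0" "l > 0" using sol by (auto simp: singular_radial_solution_def)
    then have "ln l = V0 1" using eq[of 1] by simp
    then have "l = lstar" using exp_ln[OF \<open>l > 0\<close>] by (simp only: lstar_def)
    then show ?thesis using eq \<open>ln l = V0 1\<close> by (force simp: U_def)
  qed
  moreover have "(lam N a \<longlongrightarrow> lstar) at_top"
    unfolding lam_def[abs_def] lstar_def by (rule tendsto_exp[OF lim1])
  moreover have "C2_loc_limit {0<..1} (u_sol N a) U at_top"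
    unfolding C2_loc_limit_def
  proof (intro allI impI)
    fix K :: "real set" assume K: "compact K \<and> K \<subseteq> {0<..1}"
    obtain \<delta> where \<delta>: "0 < \<delta>" "\<delta> \<le> 1" "K \<subseteq> {\<delta>..1}"
    proof (cases "K = {}")
      case False
      then obtain \<delta> where "\<delta> \<in> K" "\<And>x. x \<in> K \<Longrightarrow> \<delta> \<le> x" using compact_attains_inf[of K] K by blast
      then show ?thesis using K that[of \<delta>] by fastforce
    qed (use that[of 1] in auto)
    have u: "u_sol N a \<beta> = (\<lambda>r. v_sol N a \<beta> r - v_sol N a \<beta> 1)" for \<beta>
      by (simp add: u_sol_def[abs_def] ln_lam)
    have KI: "r \<in> {0<..1}" if "r \<in> K" for r using K that by auto
    have "uniform_limit {\<delta>..1} (\<lambda>\<beta> r. v_sol N a \<beta> 1) (\<lambda>r. V0 1) at_top"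
      using lim1 by (auto simp: uniform_limit_iff tendsto_iff elim: eventually_mono)
    then have "uniform_limit {\<delta>..1} (u_sol N a) U at_top"
      unfolding u[abs_def] U_def by (intro uniform_limit_minus limV \<delta>)
    then have "uniform_limit K (u_sol N a) U at_top" using \<delta>(3) by (rule uniform_limit_on_subset)
    moreover have "uniform_limit K (\<lambda>\<beta>. rderiv {0<..1} (u_sol N a \<beta>)) (rderiv {0<..1} U) at_top"
      using uniform_limit_on_subset[OF limW[OF \<delta>(1,2)] \<delta>(3)]
      by (rule uniform_limit_cong'[THEN iffD1, rotated 2]) (use profile_C2(2)[OF v_sol_profile] C2(2) KI in \<open>auto simp: u\<close>)
    moreover have "uniform_limit K (\<lambda>\<beta>. rderiv {0<..1} (rderiv {0<..1} (u_sol N a \<beta>))) (rderiv {0<..1} (rderiv {0<..1} U)) at_top"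
      using uniform_limit_on_subset[OF limR[OF \<delta>(1,2)] \<delta>(3)]
      by (rule uniform_limit_cong'[THEN iffD1, rotated 2]) (use profile_C2(3)[OF v_sol_profile] C2(3) KI in \<open>auto simp: u\<close>)
    ultimately show "uniform_limit K (u_sol N a) U at_top \<and>
        uniform_limit K (\<lambda>\<beta>. rderiv {0<..1} (u_sol N a \<beta>)) (rderiv {0<..1} U) at_top \<and>
        uniform_limit K (\<lambda>\<beta>. rderiv {0<..1} (rderiv {0<..1} (u_sol N a \<beta>))) (rderiv {0<..1} (rderiv {0<..1} U)) at_top"
      by blast
  qed
  moreover have "continuous_on {0<..1} U"
    unfolding U_def by (intro continuous_intros profile_continuous(1)[OF pr(1)])
  moreover have "continuous_on {0..1} p"
    unfolding continuous_on_def
  proof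
    fix r :: real assume r: "r \<in> {0..1}"
    show "(p \<longlongrightarrow> p r) (at r within {0..1})"
    proof (cases "r = 0")
      case True
      have "((\<lambda>r. slope W0 r + 2) \<longlongrightarrow> 2) (at_right 0)"
        using tendsto_add[OF asym(1) tendsto_const, of 2] by simp
      then have "(p \<longlongrightarrow> 2) (at_right 0)"
        by (rule Lim_transform_eventually) (auto simp: eventually_at_filter slope_def p_def)
      then show ?thesis by (simp add: True at_within_Icc_at_right p_def)
    next
      case False
      then have r1: "r \<in> {0<..1}" using r by auto
      have "((\<lambda>r. - r * W0 r) \<longlongrightarrow> - r * W0 r) (at r within {0<..1})"
        using profile_continuous(2)[OF pr(1)] r1 by (intro tendsto_intros) (auto simp: continuous_on_def)
      moreover have "at r within {0<..1} = at r within {0..1}"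
        by (rule at_within_nhd[of _ "{0<..}"]) (use r1 in auto)
      ultimately have "((\<lambda>r. - r * W0 r) \<longlongrightarrow> p r) (at r within {0..1})" using False by (simp add: p_def)
      moreover have "\<forall>\<^sub>F s in at r within {0..1}. s \<noteq> 0" using False by (intro eventually_neq_at_within)
      then have "\<forall>\<^sub>F s in at r within {0..1}. - s * W0 s = p s" by eventually_elim (simp add: p_def)
      ultimately show ?thesis by (rule Lim_transform_eventually)
    qed
  qed
  moreover have "\<forall>r\<in>{0..1}. p r \<ge> 0"
    using flux_nonpos[OF pr] by (auto simp: p_def mult_nonneg_nonpos)
  moreover have "\<forall>r. 0 < r \<and> r < 1 \<longrightarrow> (U has_real_derivative - p r / r) (at r)"
  proof (intro allI impI)
    fix r :: real assume r: "0 < r \<and> r < 1"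
    then have "(V0 has_real_derivative W0 r) (at r)"
      using profileD(1)[OF pr(1), of r] at_within_open_subset[of r "{0<..<1}" "{0<..1}"] by force
    then show "(U has_real_derivative - p r / r) (at r)"
      unfolding U_def p_def using r by (auto intro!: derivative_eq_intros)
  qed
  moreover have "(\<lambda>r. U r - (- 2 * ln r + ln (2 * (real N - 2)) - ln lstar)) \<in> o[at_right 0](\<lambda>_. 1)"
    using asym(2) by (intro smalloI_tendsto) (simp_all add: U_eq)
  ultimately show ?thesis
    using curve_near_0[OF lim1] alpha_at_top_iff[OF lim1] by blast
qed

end

section \<open>The weight, and the conclusion\<close>

text \<open>Along a ray, differentiability of a(|x|) at the origin bounds the difference quotient
  (a(r) - 1) / r near 0; farther out the bound of a suffices.\<close>

lemma radial_weight_exists: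
  fixes a :: "real \<Rightarrow> real"
  assumes N: "3 \<le> N"
    and C2: "Ck_closure 2 (ball (0 :: 'a::euclidean_space) 1) (\<lambda>x. a (norm x))"
    and pos: "\<forall>r\<in>{0..1}. a r > 0" and a_0: "a 0 = 1"
  shows "\<exists>a0 A L. radial_weight N a a0 A L"
proof -
  obtain e :: 'a where e: "e \<in> Basis" using nonempty_Basis by blast
  then have ne: "norm e = 1" by (rule norm_Basis)
  define f where "f = (\<lambda>x::'a. a (norm x))"
  have cf: "continuous_on (cball 0 1) f" and df: "f differentiable (at 0)"
    using C2 by (simp_all add: numeral_2_eq_2 f_def)
  have af: "a r = f (r *\<^sub>R e)" if "r \<ge> 0" for r using that ne by (simp add: f_def)
  have "continuous_on {0..1} (\<lambda>r. f (r *\<^sub>R e))"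
    by (rule continuous_on_compose2[OF cf]) (auto intro!: continuous_intros simp: ne)
  then have cont: "continuous_on {0..1} a" by (rule continuous_on_eq) (simp add: af)
  obtain rmin where rmin: "rmin \<in> {0..1}" "\<And>r. r \<in> {0..1} \<Longrightarrow> a rmin \<le> a r"
    using continuous_attains_inf[OF compact_Icc _ cont] by auto
  obtain rmax where rmax: "rmax \<in> {0..1}" "\<And>r. r \<in> {0..1} \<Longrightarrow> a r \<le> a rmax"
    using continuous_attains_sup[OF compact_Icc _ cont] by auto
  obtain f' where f': "(f has_derivative f') (at 0)" using df by (auto simp: differentiable_def)
  have "((\<lambda>r::real. r *\<^sub>R e) has_derivative (\<lambda>h. h *\<^sub>R e)) (at 0)" by (auto intro!: derivative_eq_intros)
  from has_derivative_compose[OF this, of f f'] f'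
  have "((\<lambda>r. f (r *\<^sub>R e)) has_derivative (\<lambda>h. f' (h *\<^sub>R e))) (at 0)" by simp
  moreover have "(\<lambda>h. f' (h *\<^sub>R e)) = (*) (f' e)"
    using linear_scale[OF has_derivative_linear[OF f']] by (auto simp: mult.commute)
  ultimately have "((\<lambda>r. f (r *\<^sub>R e)) has_real_derivative f' e) (at 0)"
    by (simp add: has_field_derivative_def)
  then have "(\<lambda>h. (f (h *\<^sub>R e) - f 0) / h) \<midarrow>0\<rightarrow> f' e" by (simp add: DERIV_def)
  then have "\<forall>\<^sub>F h in at 0. \<bar>(f (h *\<^sub>R e) - f 0) / h\<bar> < \<bar>f' e\<bar> + 1"
    using order_tendstoD(2)[OF tendsto_rabs] by fastforce
  then obtain d where d: "d > 0" "\<And>h. h \<noteq> 0 \<Longrightarrow> \<bar>h\<bar> < d \<Longrightarrow> \<bar>(f (h *\<^sub>R e) - f 0) / h\<bar> < \<bar>f' e\<bar> + 1"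
    by (auto simp: eventually_at)
  \<comment> \<open>The part |f' e| + 1 serves r < d; the quotient by d serves r \<ge> d, where r /
    d \<ge> 1.\<close>
  define L where "L = \<bar>f' e\<bar> + 1 + (a rmax + 1) / d"
  have amax: "a rmax > 0" using pos rmax by blast
  have "\<bar>a r - 1\<bar> \<le> L * r" if r: "r \<in> {0..1}" for r
  proof (cases "r < d")
    case True
    show ?thesis
    proof (cases "r = 0")
      case False
      then have "\<bar>(a r - 1) / r\<bar> \<le> \<bar>f' e\<bar> + 1"
        using d(2)[of r] True r af[of r] af[of 0] a_0 by simp
      then have "\<bar>a r - 1\<bar> \<le> (\<bar>f' e\<bar> + 1) * r" using False r by (simp add: abs_divide pos_divide_le_eq)
      also have "\<dots> \<le> L * r" using r d amax by (intro mult_right_mono) (auto simp: L_def)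
      finally show ?thesis .
    qed (simp add: a_0)
  next
    case False
    have "\<bar>a r - 1\<bar> \<le> a rmax + 1" using rmax(2)[OF r] pos r by (auto simp: abs_le_iff) (smt (verit) atLeastAtMost_iff)
    also have "\<dots> = (a rmax + 1) / d * d" using d by simp
    also have "\<dots> \<le> L * r" using False d amax by (intro mult_mono) (auto simp: L_def)
    finally show ?thesis .
  qed
  moreover have "L \<ge> 0" using d amax by (simp add: L_def)
  ultimately have "radial_weight N a (a rmin) (a rmax) L"
    using N cont pos rmin rmax by unfold_locales auto
  then show ?thesis by blast
qed

theorem theorem1p2:
  fixes a :: "real \<Rightarrow> real" and N :: nat
  assumes N_def: "N = CARD('n::finite)"
    and N_ge: "N \<ge> 3"
    and a_C2: "Ck_closure 2 (ball (0 :: real ^ 'n) 1) (\<lambda>x. a (norm x))"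
    and a_pos: "\<forall>r\<in>{0..1}. a r > 0"
    and a_0: "a 0 = 1"
  shows "\<exists>lstar Ustar.
      singular_radial_solution N a lstar Ustar \<and>
      (\<forall>l U. singular_radial_solution N a l U \<longrightarrow> l = lstar \<and> (\<forall>r\<in>{0<..1}. U r = Ustar r)) \<and>
      (lam N a \<longlongrightarrow> lstar) at_top \<and>
      C2_loc_limit {0<..1} (u_sol N a) Ustar at_top \<and>
      (\<forall>b :: nat \<Rightarrow> real. filterlim (\<lambda>k. alpha N a (b k)) at_top sequentially \<longleftrightarrow>
          filterlim b at_top sequentially) \<and>
      (\<exists>lhat>0. \<forall>l. 0 < l \<and> l < lhat \<longrightarrow> (\<exists>!p. p \<in> bifurcation_curve N a \<and> fst p = l)) \<and>
      (\<lambda>x :: real ^ 'n. Ustar (norm x)) \<in> H10 (ball 0 1) \<and>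
      (\<lambda>r. Ustar r - (- 2 * ln r + ln (2 * (real N - 2)) - ln lstar)) \<in> o[at_right 0](\<lambda>_. 1)"
proof -
  obtain a0 A L where "radial_weight N a a0 A L"
    using radial_weight_exists[OF N_ge a_C2 a_pos a_0] by blast
  then interpret radial_weight N a a0 A L .
  obtain lstar Ustar p where main: "singular_radial_solution N a lstar Ustar"
      "\<forall>l U. singular_radial_solution N a l U \<longrightarrow> l = lstar \<and> (\<forall>r\<in>{0<..1}. U r = Ustar r)"
      "(lam N a \<longlongrightarrow> lstar) at_top"
      "C2_loc_limit {0<..1} (u_sol N a) Ustar at_top"
      "\<forall>b :: nat \<Rightarrow> real. filterlim (\<lambda>k. alpha N a (b k)) at_top sequentially \<longleftrightarrow>
          filterlim b at_top sequentially"
      "\<exists>lhat>0. \<forall>l. 0 < l \<and> l < lhat \<longrightarrow> (\<exists>!p. p \<in> bifurcation_curve N a \<and> fst p = l)"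
      "(\<lambda>r. Ustar r - (- 2 * ln r + ln (2 * (real N - 2)) - ln lstar)) \<in> o[at_right 0](\<lambda>_. 1)"
    and p: "continuous_on {0<..1} Ustar" "continuous_on {0..1} p" "\<forall>r\<in>{0..1}. p r \<ge> 0"
      "\<forall>r. 0 < r \<and> r < 1 \<longrightarrow> (Ustar has_real_derivative - p r / r) (at r)"
    using singular_solution_and_curve by blast
  have "(\<lambda>x :: real ^ 'n. Ustar (norm x)) \<in> H10 (ball 0 1)"
  proof (rule H10_radial[where p=p])
    show "DIM(real ^ 'n) \<ge> 3" using N_def N_ge by simp
  qed (use main(1) p in \<open>auto simp: singular_radial_solution_def\<close>)
  with main show ?thesis by blast
qed

end
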